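(* Let $m\geq1$ be an integer, and equip $K_0(\mathbf{Var}^{tor}_{\mathbb{F}_{1^m}})=\mathbb{Z}[\mathbb{T}]$ with the Lie algebra structure, that is, the bi-ring structure in which $\mathbb{D}=\mathbb{T}-m$ satisfies $\Delta(\mathbb{D})=\mathbb{D}\otimes1+1\otimes\mathbb{D}$ and $\epsilon(\mathbb{D})=0$. Then under the natural one-to-one correspondence $$\mathbf{comm}(K_0(\mathbf{Var}^{tor}_{\mathbb{F}_{1^m}}),\mathbb{Z})\leftrightarrow\mathbf{comm}^+_{bi}(K_0(\mathbf{Var}^{tor}_{\mathbb{F}_{1^m}}),\mathbb{L}(\mathbb{Z}))$$ the motivic measure $\mu_{2m}:K_0(\mathbf{Var}^{tor}_{\mathbb{F}_{1^m}})\to\mathbb{Z}$, $\mathbb{T}\mapsto 2m$, corresponds to a unique bi-ring morphism $c_{\mu_{2m}}:K_0(\mathbf{Var}^{tor}_{\mathbb{F}_{1^m}})\to\mathbb{L}(\mathbb{Z})$, making the following diagram commute. The diagram consists of the morphisms $\zeta_{\mathbb{F}_{1^m}}:K_0(\mathbf{Var}^{tor}_{\mathbb{F}_{1^m}})\to\mathbb{W}(\mathbb{Z})$ and $c_{\mu_{2m}}:K_0(\mathbf{Var}^{tor}_{\mathbb{F}_{1^m}})\to\mathbb{L}(\mathbb{Z})$, together with the square formed by $L_{\mathbb{Z}}:\mathbb{W}_0(\mathbb{Z})\to\mathbb{W}(\mathbb{Z})$, $gh_0:\mathbb{W}_0(\mathbb{Z})\to\mathbb{L}(\mathbb{Z})$,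 $gh:\mathbb{W}(\mathbb{Z})\to\mathbb{Z}^\infty$ and the inclusion $i:\mathbb{L}(\mathbb{Z})\to\mathbb{Z}^\infty$; that is, $$i\circ c_{\mu_{2m}}=gh\circ\zeta_{\mathbb{F}_{1^m}}\quad\text{and}\quad i\circ gh_0=gh\circ L_{\mathbb{Z}}.$$ Moreover, there does not exist a ring morphism $r:K_0(\mathbf{Var}^{tor}_{\mathbb{F}_{1^m}})\to\mathbb{W}_0(\mathbb{Z})$ compatible with this diagram, that is, with $L_{\mathbb{Z}}\circ r=\zeta_{\mathbb{F}_{1^m}}$ and $gh_0\circ r=c_{\mu_{2m}}$.
   Context: An $\mathbb{F}_{1^m}$-variety is a torified variety, that is, a complex variety defined over $\mathbb{Z}$ with a decomposition $X=\sqcup_iT_i$ into tori $T_i\simeq\mathbb{G}_m^{d_i}$, with the natural action of the group of $m$-th roots of unity on each torus. The Grothendieck ring $K_0(\mathbf{Var}^{tor}_{\mathbb{F}_{1^m}})$ of these is identified with the polynomial ring $\mathbb{Z}[\mathbb{T}]$, $\mathbb{T}=[\mathbb{G}_m]$. A motivic measure on it with values in $\mathbb{Z}$ is a ring morphism to $\mathbb{Z}$. $\mathbf{comm}$ is the category of commutative rings, $\mathbf{comm}^+_{bi}$ the category of torsion free commutative and co-commutative $\mathbb{Z}$-birings. $\mathbb{L}(\mathbb{Z})=\varinjlim\,(\mathbb{Z}[t]/(p(t)))^*$ (limit over monic $p\in\mathbb{Z}[t]$) is the set of all integral linear recursive sequences $f=(f_0,f_1,f_2,\ldots)$, where $f$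 is identified with the functional $t^n\mapsto f_n$ on $\mathbb{Z}[t]$. It is a bi-ring with componentwise (Hadamard) multiplication, unit $1=(1,1,1,\ldots)$, co-ring structure dual to the ring structures on the $\mathbb{Z}[t]/(p(t))$, and counit $\epsilon(f)=f_0$. The functor forgetting the co-ring structure has a right adjoint sending $\mathbb{Z}$ to $\mathbb{L}(\mathbb{Z})$; the resulting one-to-one correspondence sends a bi-ring morphism $c:A\to\mathbb{L}(\mathbb{Z})$ to the ring morphism $A\to\mathbb{Z}$, $a\mapsto c(a)_1$ (composition with projection on the second component). $\mathbb{W}(\mathbb{Z})$ is $1+t\mathbb{Z}[[t]]$ with addition given by multiplication of power series and multiplication $\ast$ determined functorially by $(1-at)^{-1}\ast(1-bt)^{-1}=(1-abt)^{-1}$. The ghost map is $gh:\mathbb{W}(\mathbb{Z})\to\mathbb{Z}^\infty$, $gh(P)=(a_1,a_2,\ldots)$ with $t\frac{d}{dt}\log(P)=\sum_{n\geq1}a_nt^n$. The inclusion $i:\mathbb{L}(\mathbb{Z})\to\mathbb{Z}^\infty$ sends $(f_0,f_1,f_2,\ldots)$ to the sequence with the same entries, so $f_{n-1}$ is compared with $a_n$. The $\mathbb{F}_{1^m}$-zeta function is the ring morphism $\zeta_{\mathbb{F}_{1^m}}:K_0(\mathbf{Var}^{tor}_{\mathbb{F}_{1^m}})=\mathbb{Z}[\mathbb{T}]\to\mathbb{W}(\mathbb{Z})$, $\sum_{k=0}^Na_k\mathbb{T}^k\mapsto\exp(\sum_{k=0}^Na_km^kLi_{1-k}(t))$, where $Li_{1-k}(t)=\sum_{l\geq1}l^{k-1}t^l$.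 $\mathbb{W}_0(\mathbb{Z})$ is the quotient of the Grothendieck ring of the category of pairs $(E,f)$, with $E$ a projective $\mathbb{Z}$-module of finite rank and $f\in End_{\mathbb{Z}}(E)$ (sum induced by $\oplus$, product by $\otimes$), by the ideal consisting of the pairs $(E,0)$. $L_{\mathbb{Z}}:\mathbb{W}_0(\mathbb{Z})\to\mathbb{W}(\mathbb{Z})$ is the ring morphism $(E,f)\mapsto\det(1-tM_f)^{-1}$, with $M_f$ the matrix of $f$, and $gh_0:\mathbb{W}_0(\mathbb{Z})\to\mathbb{L}(\mathbb{Z})$ is the ghost ring morphism $(E,f)\mapsto(Tr(M_f),Tr(M_f^2),\ldots)$.
   Formalization: Since ζ(T)=exp(mt/(1−t)) does not have integer coefficients (for m=1 the t² coefficient is 3/2), ζ and L_Z are taken with values in W(Q)=1+tQ[[t]] instead of W(Z), and gh and i with values in Q^∞ instead of Z^∞. *)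

theory Defs
imports "Jordan_Normal_Form.Char_Poly" "HOL-Library.Poly_Mapping" "HOL-Computational_Algebra.Formal_Power_Series"
begin

section \<open>Ring morphisms\<close>

text \<open>
  The sort \<open>{comm_ring, comm_monoid_mult}\<close> is that of commutative unital rings in which \<open>0 = 1\<close> is
  not excluded; unlike \<^class>\<open>comm_ring_1\<close> it is closed under tensor products.
\<close>

definition ring_morphism ::
  "('a::{comm_ring, comm_monoid_mult} \<Rightarrow> 'b::{comm_ring, comm_monoid_mult}) \<Rightarrow> bool"
  where "ring_morphism f \<longleftrightarrow> ab_group_add_hom f \<and> comm_monoid_mult_hom f"

lemma ring_morphismI:
  assumes "\<And>x y. f (x + y) = f x + f y" "f 1 = 1" "\<And>x y. f (x * y) = f x * f y"
  shows "ring_morphism f"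
proof -
  have "f 0 + f 0 = f 0" using assms(1)[of 0 0] by simp
  then have "f 0 = 0" by simp
  then show ?thesis
    unfolding ring_morphism_def by (intro conjI; unfold_locales) (use assms in auto)
qed

lemma ring_morphismD:
  assumes "ring_morphism f"
  shows "f (x + y) = f x + f y" "f 1 = 1" "f (x * y) = f x * f y" "f 0 = 0" "f (- x) = - f x" "f (x - y) = f x - f y"
proof -
  interpret ab_group_add_hom f using assms by (simp add: ring_morphism_def)
  interpret comm_monoid_mult_hom f using assms by (simp add: ring_morphism_def)
  show "f (x + y) = f x + f y" "f 1 = 1" "f (x * y) = f x * f y" "f 0 = 0" "f (- x) = - f x" "f (x - y) = f x - f y"
    by (simp_all add: hom_add hom_mult hom_uminus hom_minus)
qed

lemma ring_morphism_comp:
  "ring_morphism f \<Longrightarrow> ring_morphism g \<Longrightarrow> ring_morphism (\<lambda>x. f (g x))"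
  by (rule ring_morphismI) (simp_all add: ring_morphismD)

lemma ring_morphism_id: "ring_morphism (\<lambda>x. x)"
  by (rule ring_morphismI) simp_all

lemma ring_morphism_poly_eqI:
  fixes f g :: "int poly \<Rightarrow> 'a::{comm_ring, comm_monoid_mult}"
  assumes f: "ring_morphism f" and g: "ring_morphism g" and X: "f [:0, 1:] = g [:0, 1:]"
  shows "f = g"
proof
  fix p :: "int poly"
  have c: "f [:a:] = g [:a:]" for a
  proof (induction a rule: int_induct[of _ 0])
    case base then show ?case using f g by (simp add: ring_morphismD)
  next
    case (step1 i)
    have "[:i + 1:] = [:i:] + (1 :: int poly)" by (simp add: one_pCons)
    then show ?case using f g step1 by (simp add: ring_morphismD)
  next
    case (step2 i)
    have "[:i - 1:] = [:i:] - (1 :: int poly)" by (simp add: one_pCons)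
    then show ?case using f g step2 by (simp add: ring_morphismD)
  qed
  show "f p = g p"
  proof (induction p)
    case 0 then show ?case using f g by (simp add: ring_morphismD)
  next
    case (pCons a p)
    have "pCons a p = [:a:] + [:0, 1:] * p" by simp
    then show ?case using f g c X pCons by (simp only: ring_morphismD)
  qed
qed


section \<open>Tensor products over the integers\<close>

inductive_set tensor_rels :: "(('a::ab_group_add \<times> 'b::ab_group_add) \<Rightarrow>\<^sub>0 int) set" where
  zero: "0 \<in> tensor_rels"
| left: "frag_of (a + a', b) - frag_of (a, b) - frag_of (a', b) \<in> tensor_rels"
| right: "frag_of (a, b + b') - frag_of (a, b) - frag_of (a, b') \<in> tensor_rels"
| diff: "x \<in> tensor_rels \<Longrightarrow> y \<in> tensor_rels \<Longrightarrow> x - y \<in> tensor_rels"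

lemma tensor_rels_uminus: "x \<in> tensor_rels \<Longrightarrow> - x \<in> tensor_rels"
  using tensor_rels.diff[OF tensor_rels.zero] by fastforce

lemma tensor_rels_add: "x \<in> tensor_rels \<Longrightarrow> y \<in> tensor_rels \<Longrightarrow> x + y \<in> tensor_rels"
  using tensor_rels.diff[OF _ tensor_rels_uminus] by fastforce

quotient_type (overloaded) ('a, 'b) tensor =
    "('a::ab_group_add \<times> 'b::ab_group_add) \<Rightarrow>\<^sub>0 int" / "\<lambda>x y. x - y \<in> tensor_rels"
proof (rule equivpI)
  show "reflp (\<lambda>x y :: ('a \<times> 'b) \<Rightarrow>\<^sub>0 int. x - y \<in> tensor_rels)"
    by (rule reflpI) (simp add: tensor_rels.zero)
  show "symp (\<lambda>x y :: ('a \<times> 'b) \<Rightarrow>\<^sub>0 int. x - y \<in> tensor_rels)"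
    by (rule sympI) (use tensor_rels_uminus in fastforce)
  show "transp (\<lambda>x y :: ('a \<times> 'b) \<Rightarrow>\<^sub>0 int. x - y \<in> tensor_rels)"
    by (rule transpI) (use tensor_rels_add in fastforce)
qed

instantiation tensor :: (ab_group_add, ab_group_add) ab_group_add
begin

lift_definition zero_tensor :: "('a, 'b) tensor" is 0 .

lift_definition plus_tensor :: "('a, 'b) tensor \<Rightarrow> ('a, 'b) tensor \<Rightarrow> ('a, 'b) tensor" is "(+)"
  by (metis add_diff_add tensor_rels_add)

lift_definition uminus_tensor :: "('a, 'b) tensor \<Rightarrow> ('a, 'b) tensor" is uminus
  by (metis minus_diff_minus tensor_rels_uminus)

lift_definition minus_tensor :: "('a, 'b) tensor \<Rightarrow> ('a, 'b) tensor \<Rightarrow> ('a, 'b) tensor" is "(-)"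
proof -
  fix a b c d :: "('a \<times> 'b) \<Rightarrow>\<^sub>0 int"
  assume "a - b \<in> tensor_rels" "c - d \<in> tensor_rels"
  moreover have "a - c - (b - d) = (a - b) - (c - d)" by simp
  ultimately show "a - c - (b - d) \<in> tensor_rels" by (metis tensor_rels.diff)
qed

instance
proof
  fix a b c :: "('a, 'b) tensor"
  show "a + b + c = a + (b + c)" by transfer (simp add: add.assoc tensor_rels.zero)
  show "a + b = b + a" by transfer (simp add: tensor_rels.zero)
  show "0 + a = a" by transfer (simp add: tensor_rels.zero)
  show "- a + a = 0" by transfer (simp add: tensor_rels.zero)
  show "a - b = a + - b" by transfer (simp add: tensor_rels.zero)
qed

end

lift_definition tens :: "'a::ab_group_add \<Rightarrow> 'b::ab_group_add \<Rightarrow> ('a, 'b) tensor" (infixl "\<otimes>\<^sub>Z" 75)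
  is "\<lambda>a b. frag_of (a, b)" .

lemma tens_add_left: "(a + a') \<otimes>\<^sub>Z b = a \<otimes>\<^sub>Z b + a' \<otimes>\<^sub>Z b"
  by transfer (metis diff_diff_eq tensor_rels.left)

lemma tens_add_right: "a \<otimes>\<^sub>Z (b + b') = a \<otimes>\<^sub>Z b + a \<otimes>\<^sub>Z b'"
  by transfer (metis diff_diff_eq tensor_rels.right)

lemma tens_0_left [simp]: "0 \<otimes>\<^sub>Z b = 0"
  using tens_add_left[of 0 0 b] by simp

lemma tens_0_right [simp]: "b \<otimes>\<^sub>Z 0 = 0"
  using tens_add_right[of b 0 0] by simp

lemma tens_uminus_left: "(- a) \<otimes>\<^sub>Z b = - (a \<otimes>\<^sub>Z b)"
  using tens_add_left[of a "-a" b] by (simp add: eq_neg_iff_add_eq_0 add.commute)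

lemma tens_uminus_right: "a \<otimes>\<^sub>Z (- b) = - (a \<otimes>\<^sub>Z b)"
  using tens_add_right[of a b "-b"] by (simp add: eq_neg_iff_add_eq_0 add.commute)

lemma tens_sum_left: "(\<Sum>i\<in>I. f i) \<otimes>\<^sub>Z b = (\<Sum>i\<in>I. f i \<otimes>\<^sub>Z b)"
  by (induction I rule: infinite_finite_induct) (simp_all add: tens_add_left)

lemma tens_sum_right: "b \<otimes>\<^sub>Z (\<Sum>i\<in>I. f i) = (\<Sum>i\<in>I. b \<otimes>\<^sub>Z f i)"
  by (induction I rule: infinite_finite_induct) (simp_all add: tens_add_right)

lemma frag_diff_induct:
  assumes "P 0" "\<And>a. P (frag_of a)" "\<And>x y. P x \<Longrightarrow> P y \<Longrightarrow> P (x - y)"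
  shows "P (x :: 'a \<Rightarrow>\<^sub>0 int)"
  using subset_UNIV assms(1,2) by (rule frag_induction) (rule assms(3))

lemma abs_rep_tensor [simp]: "abs_tensor (rep_tensor x) = x"
  by (rule Quotient3_abs_rep[OF Quotient3_tensor])

lemma tensor_induct [case_names zero tens diff, induct type: tensor]:
  assumes "P 0" "\<And>a b. P (a \<otimes>\<^sub>Z b)" "\<And>x y. P x \<Longrightarrow> P y \<Longrightarrow> P (x - y)"
  shows "P x"
proof -
  have "P (abs_tensor u)" for u :: "('a \<times> 'b) \<Rightarrow>\<^sub>0 int"
  proof (induction u rule: frag_diff_induct)
    case 1 then show ?case using assms(1) by (simp add: zero_tensor.abs_eq)
  next
    case (2 a) then show ?case using assms(2)[of "fst a" "snd a"] by (simp add: tens.abs_eq)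
  next
    case (3 x y) then show ?case using assms(3) by (metis minus_tensor.abs_eq)
  qed
  from this[of "rep_tensor x"] show ?thesis by simp
qed

text \<open>
  The morphism \<open>A \<otimes> B \<rightarrow> C \<otimes> D\<close> given on pure tensors by \<open>F\<close>; it does not depend on the chosen
  representative if \<open>F\<close> is biadditive.
\<close>

definition tensor_lift :: "('a::ab_group_add \<Rightarrow> 'b::ab_group_add \<Rightarrow> ('c::ab_group_add, 'd::ab_group_add) tensor) \<Rightarrow>
    ('a, 'b) tensor \<Rightarrow> ('c, 'd) tensor"
  where "tensor_lift F x =
    abs_tensor (frag_extend (\<lambda>(a, b). rep_tensor (F a b)) (rep_tensor x))"

locale biadditive =
  fixes F :: "'a::ab_group_add \<Rightarrow> 'b::ab_group_add \<Rightarrow> 'c::ab_group_add"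
  assumes add_left: "F (a + a') b = F a b + F a' b"
    and add_right: "F a (b + b') = F a b + F a b'"

lemma abs_frag_extend_diff:
  "abs_tensor (frag_extend F (x - y)) = abs_tensor (frag_extend F x) - abs_tensor (frag_extend F y)"
  by (simp add: frag_extend_diff minus_tensor.abs_eq)

lemma tensor_lift_wf:
  fixes F :: "'a::ab_group_add \<Rightarrow> 'b::ab_group_add \<Rightarrow> ('c::ab_group_add, 'd::ab_group_add) tensor"
  assumes "biadditive F" and "x \<in> tensor_rels"
  shows "abs_tensor (frag_extend (\<lambda>(a, b). rep_tensor (F a b)) x) = 0"
  using assms(2)
proof induction
  case zero then show ?case by (simp add: zero_tensor.abs_eq)
qed (use assms(1) in \<open>simp_all add: abs_frag_extend_diff biadditive_def\<close>)

lemma tensor_lift_abs: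
  assumes "biadditive F"
  shows "tensor_lift F (abs_tensor u) = abs_tensor (frag_extend (\<lambda>(a, b). rep_tensor (F a b)) u)"
proof -
  have "abs_tensor (rep_tensor (abs_tensor u)) = abs_tensor u" by simp
  then have "rep_tensor (abs_tensor u) - u \<in> tensor_rels"
    by (metis tensor.abs_eq_iff)
  from tensor_lift_wf[OF assms this] show ?thesis
    by (simp add: tensor_lift_def abs_frag_extend_diff)
qed

lemma tensor_lift_tens:
  assumes "biadditive F"
  shows "tensor_lift F (a \<otimes>\<^sub>Z b) = F a b"
  by (simp add: tens.abs_eq tensor_lift_abs[OF assms])

lemma tensor_lift_diff:
  assumes "biadditive F"
  shows "tensor_lift F (x - y) = tensor_lift F x - tensor_lift F y"
proof -
  obtain u v where "x = abs_tensor u" "y = abs_tensor v" by (metis abs_rep_tensor)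
  then show ?thesis
    by (simp add: minus_tensor.abs_eq tensor_lift_abs[OF assms] abs_frag_extend_diff[symmetric] frag_extend_diff)
qed

lemma tensor_lift_0: "biadditive F \<Longrightarrow> tensor_lift F 0 = 0"
  using tensor_lift_diff[of F 0 0] by simp

lemma tensor_lift_uminus: "biadditive F \<Longrightarrow> tensor_lift F (- x) = - tensor_lift F x"
  using tensor_lift_diff[of F 0 x] by (simp add: tensor_lift_0)

lemma tensor_lift_add: "biadditive F \<Longrightarrow> tensor_lift F (x + y) = tensor_lift F x + tensor_lift F y"
  using tensor_lift_diff[of F x "- y"] by (simp add: tensor_lift_uminus)

lemma tensor_lift_sum: "biadditive F \<Longrightarrow> tensor_lift F (\<Sum>i\<in>I. f i) = (\<Sum>i\<in>I. tensor_lift F (f i))"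
  by (induction I rule: infinite_finite_induct) (simp_all add: tensor_lift_0 tensor_lift_add)

lemma tensor_lift_plus:
  assumes F: "biadditive F" and G: "biadditive G"
  shows "tensor_lift (\<lambda>a b. F a b + G a b) x = tensor_lift F x + tensor_lift G x"
proof -
  have "biadditive (\<lambda>a b. F a b + G a b)"
    using F G by (simp add: biadditive_def)
  then show ?thesis
    by (induction x) (simp_all add: tensor_lift_0 tensor_lift_diff tensor_lift_tens F G)
qed

lemma biadditive_tens: "biadditive tens"
  by (simp add: biadditive_def tens_add_left tens_add_right)

instantiation tensor :: ("{comm_ring, comm_monoid_mult}", "{comm_ring, comm_monoid_mult}")
  "{comm_ring, comm_monoid_mult}"
begin

definition one_tensor :: "('a, 'b) tensor"
  where "1 = 1 \<otimes>\<^sub>Z 1"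

definition times_tensor :: "('a, 'b) tensor \<Rightarrow> ('a, 'b) tensor \<Rightarrow> ('a, 'b) tensor"
  where "x * y = tensor_lift (\<lambda>a b. tensor_lift (\<lambda>c d. (a * c) \<otimes>\<^sub>Z (b * d)) y) x"

lemma biadditive_mult2: "biadditive (\<lambda>c d. (a * c) \<otimes>\<^sub>Z (b * d))" for a :: 'a and b :: 'b
  by (simp add: biadditive_def tens_add_left tens_add_right distrib_left)

lemma biadditive_mult1: "biadditive (\<lambda>a b. tensor_lift (\<lambda>c d. (a * c) \<otimes>\<^sub>Z (b * d)) y)"
  for y :: "('a, 'b) tensor"
proof -
  have l: "tensor_lift (\<lambda>c d. ((a + a') * c) \<otimes>\<^sub>Z (b * d)) y =
      tensor_lift (\<lambda>c d. (a * c) \<otimes>\<^sub>Z (b * d)) y + tensor_lift (\<lambda>c d. (a' * c) \<otimes>\<^sub>Z (b * d)) y"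
    for a a' :: 'a and b :: 'b
    by (simp add: distrib_right tens_add_left tensor_lift_plus biadditive_mult2)
  have r: "tensor_lift (\<lambda>c d. (a * c) \<otimes>\<^sub>Z ((b + b') * d)) y =
      tensor_lift (\<lambda>c d. (a * c) \<otimes>\<^sub>Z (b * d)) y + tensor_lift (\<lambda>c d. (a * c) \<otimes>\<^sub>Z (b' * d)) y"
    for a :: 'a and b b' :: 'b
    by (simp add: distrib_right tens_add_right tensor_lift_plus biadditive_mult2)
  from l r show ?thesis by (simp add: biadditive_def)
qed

lemma tens_times: "(a \<otimes>\<^sub>Z b) * y = tensor_lift (\<lambda>c d. (a * c) \<otimes>\<^sub>Z (b * d)) y"
  for a :: 'a and b :: 'b and y :: "('a, 'b) tensor"
  unfolding times_tensor_def by (rule tensor_lift_tens[OF biadditive_mult1])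

lemma tens_mult: "(a \<otimes>\<^sub>Z b) * (c \<otimes>\<^sub>Z d) = (a * c) \<otimes>\<^sub>Z (b * d)" for a c :: 'a and b d :: 'b
  by (simp add: tens_times tensor_lift_tens biadditive_mult2)

lemma tensor_diff_mult: "(x - y) * z = x * z - y * z" for x y z :: "('a, 'b) tensor"
  by (simp add: times_tensor_def tensor_lift_diff biadditive_mult1)

lemma tensor_mult_diff: "z * (x - y) = z * x - z * y" for x y z :: "('a, 'b) tensor"
proof (induction z)
  case zero then show ?case by (simp add: times_tensor_def tensor_lift_0 biadditive_mult1)
next
  case (tens a b) then show ?case
    by (simp add: tens_times tensor_lift_diff biadditive_mult2)
qed (simp add: tensor_diff_mult)

lemma tensor_0_mult: "0 * z = 0" and tensor_mult_0: "z * 0 = 0" for z :: "('a, 'b) tensor"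
  using tensor_diff_mult[of 0 0 z] tensor_mult_diff[of z 0 0] by simp_all

instance
proof
  fix a b c :: "('a, 'b) tensor"
  show "1 * a = a"
    by (induction a) (simp_all add: one_tensor_def tens_mult tensor_mult_diff tensor_mult_0)
  show comm: "a * b = b * a" for a b :: "('a, 'b) tensor"
  proof (induction a)
    case (tens x y) show ?case
      by (induction b) (simp_all add: tens_mult tensor_mult_diff tensor_mult_0 tensor_diff_mult tensor_0_mult mult.commute)
  qed (simp_all add: tensor_mult_diff tensor_mult_0 tensor_diff_mult tensor_0_mult)
  show "a * b * c = a * (b * c)"
  proof (induction a)
    case (tens x y) show ?case
    proof (induction b)
      case (tens x' y') show ?case
        by (induction c) (simp_all add: tens_mult tensor_mult_diff tensor_mult_0 tensor_diff_mult tensor_0_mult mult.assoc)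
    qed (simp_all add: tensor_mult_diff tensor_mult_0 tensor_diff_mult tensor_0_mult)
  qed (simp_all add: tensor_mult_diff tensor_mult_0 tensor_diff_mult tensor_0_mult)
  have "(a - (- b)) * c = a * c - (- b) * c" by (rule tensor_diff_mult)
  moreover have "(0 - b) * c = 0 * c - b * c" by (rule tensor_diff_mult)
  ultimately show "(a + b) * c = a * c + b * c" by (simp add: tensor_0_mult)
qed

end

definition tensor_map :: "('a::ab_group_add \<Rightarrow> 'c::ab_group_add) \<Rightarrow> ('b::ab_group_add \<Rightarrow> 'd::ab_group_add) \<Rightarrow>
    ('a, 'b) tensor \<Rightarrow> ('c, 'd) tensor"
  where "tensor_map f g = tensor_lift (\<lambda>a b. f a \<otimes>\<^sub>Z g b)"

definition tensor_swap :: "('a::ab_group_add, 'b::ab_group_add) tensor \<Rightarrow> ('b, 'a) tensor"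
  where "tensor_swap = tensor_lift (\<lambda>a b. b \<otimes>\<^sub>Z a)"

definition tensor_assoc :: "(('a::ab_group_add, 'b::ab_group_add) tensor, 'c::ab_group_add) tensor \<Rightarrow>
    ('a, ('b, 'c) tensor) tensor"
  where "tensor_assoc = tensor_lift (\<lambda>x c. tensor_lift (\<lambda>a b. a \<otimes>\<^sub>Z (b \<otimes>\<^sub>Z c)) x)"

lemma biadditive_map:
  "(\<And>x y. f (x + y) = f x + f y) \<Longrightarrow> (\<And>x y. g (x + y) = g x + g y) \<Longrightarrow>
   biadditive (\<lambda>a b. f a \<otimes>\<^sub>Z g b)"
  by (simp add: biadditive_def tens_add_left tens_add_right)

lemma biadditive_swap: "biadditive (\<lambda>a b. b \<otimes>\<^sub>Z a)"
  by (simp add: biadditive_def tens_add_left tens_add_right)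

lemma biadditive_assoc2: "biadditive (\<lambda>a b. a \<otimes>\<^sub>Z (b \<otimes>\<^sub>Z c))"
  by (simp add: biadditive_def tens_add_left tens_add_right)

lemma biadditive_assoc1: "biadditive (\<lambda>x c. tensor_lift (\<lambda>a b. a \<otimes>\<^sub>Z (b \<otimes>\<^sub>Z c)) x)"
proof -
  have "tensor_lift (\<lambda>a b. a \<otimes>\<^sub>Z (b \<otimes>\<^sub>Z (c + c'))) x =
    tensor_lift (\<lambda>a b. a \<otimes>\<^sub>Z (b \<otimes>\<^sub>Z c)) x + tensor_lift (\<lambda>a b. a \<otimes>\<^sub>Z (b \<otimes>\<^sub>Z c')) x"
    for x :: "('a, 'b) tensor" and c c' :: 'c
    by (simp add: tens_add_right tensor_lift_plus biadditive_assoc2)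
  then show ?thesis
    by (intro biadditive.intro tensor_lift_add biadditive_assoc2)
qed

lemma tensor_swap_tens: "tensor_swap (a \<otimes>\<^sub>Z b) = b \<otimes>\<^sub>Z a"
  by (simp add: tensor_swap_def tensor_lift_tens biadditive_swap)

lemma tensor_assoc_tens: "tensor_assoc ((a \<otimes>\<^sub>Z b) \<otimes>\<^sub>Z c) = a \<otimes>\<^sub>Z (b \<otimes>\<^sub>Z c)"
  by (simp add: tensor_assoc_def tensor_lift_tens biadditive_assoc1 biadditive_assoc2)

lemma tensor_map_tens:
  "(\<And>x y. f (x + y) = f x + f y) \<Longrightarrow> (\<And>x y. g (x + y) = g x + g y) \<Longrightarrow>
   tensor_map f g (a \<otimes>\<^sub>Z b) = f a \<otimes>\<^sub>Z g b"
  by (simp add: tensor_map_def tensor_lift_tens biadditive_map)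

lemma ring_morphism_tensor_lift:
  fixes F :: "'a::{comm_ring, comm_monoid_mult} \<Rightarrow> 'b::{comm_ring, comm_monoid_mult} \<Rightarrow>
    ('c::{comm_ring, comm_monoid_mult}, 'd::{comm_ring, comm_monoid_mult}) tensor"
  assumes F: "biadditive F" and 1: "F 1 1 = 1" and m: "\<And>a b c d. F (a * c) (b * d) = F a b * F c d"
  shows "ring_morphism (tensor_lift F)"
proof (rule ring_morphismI)
  fix x y :: "('a, 'b) tensor"
  show "tensor_lift F (x * y) = tensor_lift F x * tensor_lift F y"
  proof (induction x)
    case (tens a b) show ?case
      by (induction y) (simp_all add: tensor_lift_0 tensor_lift_tens tensor_lift_diff F m tens_mult
        right_diff_distrib)
  qed (simp_all add: tensor_lift_0 tensor_lift_diff F left_diff_distrib)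
qed (simp_all add: tensor_lift_add F tensor_lift_tens one_tensor_def[where ?'a = 'a and ?'b = 'b] 1)

lemma ring_morphism_tensor_map:
  "ring_morphism f \<Longrightarrow> ring_morphism g \<Longrightarrow> ring_morphism (tensor_map f g)"
  unfolding tensor_map_def
  by (rule ring_morphism_tensor_lift) (simp_all add: biadditive_map ring_morphismD tens_mult one_tensor_def)

lemma ring_morphism_tensor_swap: "ring_morphism (tensor_swap ::
    ('a::{comm_ring, comm_monoid_mult}, 'b::{comm_ring, comm_monoid_mult}) tensor \<Rightarrow> _)"
  unfolding tensor_swap_def
  by (rule ring_morphism_tensor_lift) (simp_all add: biadditive_swap tens_mult one_tensor_def)

lemma ring_morphism_tensor_assoc: "ring_morphism (tensor_assoc ::
    (('a::{comm_ring, comm_monoid_mult}, 'b::{comm_ring, comm_monoid_mult}) tensor,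
      'c::{comm_ring, comm_monoid_mult}) tensor \<Rightarrow> _)"
  unfolding tensor_assoc_def
proof (rule ring_morphism_tensor_lift[OF biadditive_assoc1])
  show "tensor_lift (\<lambda>a b. a \<otimes>\<^sub>Z (b \<otimes>\<^sub>Z 1)) 1 = (1 :: ('a, ('b, 'c) tensor) tensor)"
    by (simp add: one_tensor_def tensor_lift_tens biadditive_assoc2)
  show "tensor_lift (\<lambda>a b. a \<otimes>\<^sub>Z (b \<otimes>\<^sub>Z (c * d))) (x * y) =
    tensor_lift (\<lambda>a b. a \<otimes>\<^sub>Z (b \<otimes>\<^sub>Z c)) x * tensor_lift (\<lambda>a b. a \<otimes>\<^sub>Z (b \<otimes>\<^sub>Z d)) y"
    for x y :: "('a, 'b) tensor" and c d :: 'c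
  proof (induction x)
    case (tens a b) show ?case
      by (induction y) (simp_all add: tensor_lift_0 tensor_lift_tens tensor_lift_diff biadditive_assoc2 tens_mult
        right_diff_distrib)
  qed (simp_all add: tensor_lift_0 tensor_lift_diff biadditive_assoc2 left_diff_distrib)
qed


section \<open>Birings\<close>

locale biring =
  fixes \<Delta> :: "'a::{comm_ring, comm_monoid_mult} \<Rightarrow> ('a, 'a) tensor" and \<epsilon> :: "'a \<Rightarrow> int"
  assumes comult_hom: "ring_morphism \<Delta>"
    and counit_hom: "ring_morphism \<epsilon>"
    and coassoc: "tensor_assoc (tensor_map \<Delta> (\<lambda>x. x) (\<Delta> a)) = tensor_map (\<lambda>x. x) \<Delta> (\<Delta> a)"
    and counit_left: "tensor_map \<epsilon> (\<lambda>x. x) (\<Delta> a) = 1 \<otimes>\<^sub>Z a"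
    and counit_right: "tensor_map (\<lambda>x. x) \<epsilon> (\<Delta> a) = a \<otimes>\<^sub>Z 1"

text \<open>The objects of the category of torsion free commutative and co-commutative birings.\<close>

locale cocomm_torsion_free_biring = biring +
  assumes cocomm: "tensor_swap (\<Delta> a) = \<Delta> a"
    and torsion_free: "n > 0 \<Longrightarrow> ((+) a ^^ n) 0 = 0 \<Longrightarrow> a = 0"

definition biring_homs ::
  "('a::{comm_ring, comm_monoid_mult} \<Rightarrow> ('a, 'a) tensor) \<Rightarrow> ('a \<Rightarrow> int) \<Rightarrow>
   ('b::{comm_ring, comm_monoid_mult} \<Rightarrow> ('b, 'b) tensor) \<Rightarrow> ('b \<Rightarrow> int) \<Rightarrow> ('a \<Rightarrow> 'b) set"
  where "biring_homs \<Delta>\<^sub>A \<epsilon>\<^sub>A \<Delta>\<^sub>B \<epsilon>\<^sub>B =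
    {c. ring_morphism c \<and> (\<forall>a. \<Delta>\<^sub>B (c a) = tensor_map c c (\<Delta>\<^sub>A a)) \<and> (\<forall>a. \<epsilon>\<^sub>B (c a) = \<epsilon>\<^sub>A a)}"

section \<open>The biring of integral linear recursive sequences\<close>

definition rec_act :: "int poly \<Rightarrow> (nat \<Rightarrow> int) \<Rightarrow> nat \<Rightarrow> int"
  where "rec_act p f n = (\<Sum>k\<le>degree p. coeff p k * f (n + k))"

lemma rec_act_eq: "degree p \<le> N \<Longrightarrow> rec_act p f n = (\<Sum>k\<le>N. coeff p k * f (n + k))"
  unfolding rec_act_def by (rule sum.mono_neutral_left) (auto simp: coeff_eq_0)

lemma rec_act_0 [simp]: "rec_act 0 f n = 0"
  by (simp add: rec_act_def)

lemma rec_act_pCons: "rec_act (pCons a p) f n = a * f n + rec_act p f (Suc n)"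
proof -
  have "rec_act (pCons a p) f n = (\<Sum>k\<le>Suc (degree p). coeff (pCons a p) k * f (n + k))"
    by (rule rec_act_eq) (rule degree_pCons_le)
  then show ?thesis
    by (simp add: sum.atMost_Suc_shift rec_act_def del: sum.atMost_Suc)
qed

lemma rec_act_add: "rec_act (p + q) f n = rec_act p f n + rec_act q f n"
  by (induction p q arbitrary: n rule: poly_induct2) (simp_all add: rec_act_pCons algebra_simps)

lemma rec_act_sum: "rec_act (\<Sum>i\<in>I. p i) f n = (\<Sum>i\<in>I. rec_act (p i) f n)"
  by (induction I rule: infinite_finite_induct) (simp_all add: rec_act_add)

lemma rec_act_fun_add: "rec_act p (\<lambda>k. f k + g k) n = rec_act p f n + rec_act p g n"
  by (induction p arbitrary: n) (simp_all add: rec_act_pCons algebra_simps)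

lemma rec_act_fun_0 [simp]: "rec_act p (\<lambda>k. 0) n = 0"
  by (induction p arbitrary: n) (simp_all add: rec_act_pCons)

lemma rec_act_fun_uminus: "rec_act p (\<lambda>k. - f k) n = - rec_act p f n"
  by (induction p arbitrary: n) (simp_all add: rec_act_pCons)

lemma rec_act_fun_sum: "rec_act p (\<lambda>k. \<Sum>i\<in>I. f i k) n = (\<Sum>i\<in>I. rec_act p (f i) n)"
  by (induction I rule: infinite_finite_induct) (simp_all add: rec_act_fun_add)

lemma rec_act_smult: "rec_act (Polynomial.smult a p) f n = a * rec_act p f n"
  by (induction p arbitrary: n) (simp_all add: rec_act_pCons algebra_simps)

lemma rec_act_shift: "rec_act p (\<lambda>k. f (Suc k)) n = rec_act p f (Suc n)"
  by (induction p arbitrary: n) (simp_all add: rec_act_pCons)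

lemma rec_act_mult: "rec_act (p * q) f n = rec_act p (rec_act q f) n"
  by (induction p arbitrary: n) (simp_all add: rec_act_pCons rec_act_add rec_act_smult)

text \<open>
  The recursion says that the functional \<open>t\<^sup>n \<mapsto> f n\<close> on \<open>\<int>[t]\<close> vanishes on the ideal \<open>(p)\<close>, so
  \<open>linrec_seqs\<close> is the union of the duals of the rings \<open>\<int>[t]/(p)\<close>, \<open>p\<close> monic.
\<close>

definition linrec_seqs :: "(nat \<Rightarrow> int) set"
  where "linrec_seqs = {f. \<exists>p. monic p \<and> (\<forall>n. (\<Sum>k\<le>degree p. coeff p k * f (n + k)) = 0)}"

lemma linrec_seqs_iff: "f \<in> linrec_seqs \<longleftrightarrow> (\<exists>p. monic p \<and> (\<forall>n. rec_act p f n = 0))"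
  by (simp add: linrec_seqs_def rec_act_def)

lemma linrec_system:
  fixes v :: "nat \<Rightarrow> nat \<Rightarrow> int"
  assumes v: "\<And>i n. i < N \<Longrightarrow> v i (Suc n) = (\<Sum>j<N. M i j * v j n)"
  obtains p where "monic p" "\<And>i n. i < N \<Longrightarrow> rec_act p (v i) n = 0"
proof -
  define A where "A = mat N N (\<lambda>(i, j). M i j)"
  define C where "C = char_poly_matrix A"
  have A: "A \<in> carrier_mat N N" by (simp add: A_def)
  have C: "C \<in> carrier_mat N N" using A by (simp add: C_def char_poly_matrix_def)
  have C_index: "C $$ (i, j) = [:- M i j, if i = j then 1 else 0:]" if "i < N" "j < N" for i j
    using that by (auto simp: C_def char_poly_matrix_def A_def)
  have act_C: "(\<Sum>j<N. rec_act (C $$ (i, j)) (v j) n) = 0" if "i < N" for i n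
  proof -
    have "(\<Sum>j<N. rec_act (C $$ (i, j)) (v j) n)
      = (\<Sum>j<N. (if j = i then v j (Suc n) else 0) - M i j * v j n)"
      by (rule sum.cong) (use that in \<open>auto simp: C_index rec_act_pCons\<close>)
    also have "\<dots> = 0"
      using v[OF that] that by (simp add: sum_subtractf sum.delta)
    finally show ?thesis .
  qed
  have adj: "adj_mat C \<in> carrier_mat N N" "adj_mat C * C = det C \<cdot>\<^sub>m 1\<^sub>m N"
    using adj_mat[OF C] by auto
  have "rec_act (char_poly A) (v k) n = 0" if k: "k < N" for k n
  proof -
    have "0 = (\<Sum>i<N. rec_act (adj_mat C $$ (k, i)) (\<lambda>n. \<Sum>j<N. rec_act (C $$ (i, j)) (v j) n) n)"
      by (simp add: act_C)
    also have "\<dots> = (\<Sum>i<N. \<Sum>j<N. rec_act (adj_mat C $$ (k, i) * C $$ (i, j)) (v j) n)"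
      by (simp add: rec_act_fun_sum rec_act_mult)
    also have "\<dots> = (\<Sum>j<N. rec_act (\<Sum>i<N. adj_mat C $$ (k, i) * C $$ (i, j)) (v j) n)"
      by (subst sum.swap) (simp add: rec_act_sum)
    also have "\<dots> = (\<Sum>j<N. rec_act ((adj_mat C * C) $$ (k, j)) (v j) n)"
      using C adj(1) k by (intro sum.cong refl) (auto simp: scalar_prod_def atLeast0LessThan)
    also have "\<dots> = (\<Sum>j<N. if j = k then rec_act (char_poly A) (v j) n else 0)"
      unfolding adj(2) using k by (intro sum.cong refl) (auto simp: char_poly_def C_def)
    finally show ?thesis using k by simp
  qed
  moreover have "monic (char_poly A)" using degree_monic_char_poly[OF A] by simp
  ultimately show ?thesis using that by blast
qed

lemma sum_div_mod:
  fixes h :: "nat \<Rightarrow> nat \<Rightarrow> 'a::comm_monoid_add"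
  shows "(\<Sum>k<d * e. h (k div e) (k mod e)) = (\<Sum>i<d. \<Sum>j<e. h i j)"
proof -
  have "(\<Sum>i<d. \<Sum>j<e. h i j) = (\<Sum>(i, j)\<in>{..<d} \<times> {..<e}. h i j)"
    by (rule sum.cartesian_product)
  also have "\<dots> = (\<Sum>k<d * e. h (k div e) (k mod e))"
  proof (rule sum.reindex_bij_witness[of _ "\<lambda>k. (k div e, k mod e)" "\<lambda>(i, j). i * e + j"])
    fix a assume a: "a \<in> {..<d} \<times> {..<e}"
    then obtain i j where ij: "a = (i, j)" "i < d" "j < e" by auto
    have "i * e + j < Suc i * e" using ij by simp
    also have "\<dots> \<le> d * e" using ij by (intro mult_right_mono) auto
    finally show "(case a of (i, j) \<Rightarrow> i * e + j) \<in> {..<d * e}" using ij by simp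
    show "((case a of (i, j) \<Rightarrow> i * e + j) div e, (case a of (i, j) \<Rightarrow> i * e + j) mod e) = a"
      using ij by simp
    show "h ((case a of (i, j) \<Rightarrow> i * e + j) div e) ((case a of (i, j) \<Rightarrow> i * e + j) mod e) =
         (case a of (i, j) \<Rightarrow> h i j)"
      using ij by simp
  next
    fix k assume "k \<in> {..<d * e}"
    then have k: "k < d * e" by simp
    then have "e > 0" by (cases e) auto
    then show "(k div e, k mod e) \<in> {..<d} \<times> {..<e}"
      using k by (simp add: less_mult_imp_div_less)
    show "(case (k div e, k mod e) of (i, j) \<Rightarrow> i * e + j) = k" by simp
  qed
  finally show ?thesis ..
qed

lemma companion:
  fixes f :: "nat \<Rightarrow> int"
  assumes p: "monic p" and f: "\<And>n. rec_act p f n = 0"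
  obtains F where "\<And>i n. i < degree p \<Longrightarrow> f (Suc n + i) = (\<Sum>k<degree p. F i k * f (n + k))"
proof
  define d where "d = degree p"
  define F where "F = (\<lambda>i k. if Suc i < d then (if k = Suc i then 1 else 0) else - coeff p k)"
  fix i n assume "i < degree p"
  then have i: "i < d" by (simp add: d_def)
  show "f (Suc n + i) = (\<Sum>k<degree p. F i k * f (n + k))"
  proof (cases "Suc i < d")
    case True
    have "(\<Sum>k<d. F i k * f (n + k)) = (\<Sum>k<d. if k = Suc i then f (n + k) else 0)"
      using True by (intro sum.cong) (auto simp: F_def)
    then show ?thesis using True by (simp add: d_def)
  next
    case False
    then have d: "d = Suc i" using i by simp
    have "0 = (\<Sum>k\<le>d. coeff p k * f (n + k))"
      using f[of n] by (simp add: rec_act_def d_def)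
    also have "\<dots> = (\<Sum>k<d. coeff p k * f (n + k)) + f (n + d)"
      using p by (simp add: lessThan_Suc_atMost[symmetric] d_def)
    finally show ?thesis
      using False by (simp add: F_def d_def[symmetric] d sum_negf)
  qed
qed

lemma linrec_seqs_mult:
  assumes "f \<in> linrec_seqs" "g \<in> linrec_seqs"
  shows "(\<lambda>n. f n * g n) \<in> linrec_seqs"
proof -
  obtain p where p: "monic p" "\<And>n. rec_act p f n = 0"
    using assms(1) by (auto simp: linrec_seqs_iff)
  obtain q where q: "monic q" "\<And>n. rec_act q g n = 0"
    using assms(2) by (auto simp: linrec_seqs_iff)
  show ?thesis
  proof (cases "degree p = 0 \<or> degree q = 0")
    case True
    then have "(\<forall>n. f n = 0) \<or> (\<forall>n. g n = 0)"
      using p q by (auto simp: rec_act_def)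
    then have "(\<lambda>n. f n * g n) = (\<lambda>n. 0)" by auto
    then show ?thesis by (auto simp: linrec_seqs_iff intro!: exI[of _ 1])
  next
    case False
    define d e where "d = degree p" and "e = degree q"
    have de: "d > 0" "e > 0" using False by (auto simp: d_def e_def)
    obtain F where F: "\<And>i n. i < d \<Longrightarrow> f (Suc n + i) = (\<Sum>k<d. F i k * f (n + k))"
      using companion[OF p] by (metis d_def)
    obtain G where G: "\<And>i n. i < e \<Longrightarrow> g (Suc n + i) = (\<Sum>k<e. G i k * g (n + k))"
      using companion[OF q] by (metis e_def)
    define v where "v = (\<lambda>k n. f (n + k div e) * g (n + k mod e))"
    have "v i (Suc n) = (\<Sum>j<d * e. F (i div e) (j div e) * G (i mod e) (j mod e) * v j n)"
      if "i < d * e" for i n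
    proof -
      have i: "i div e < d" "i mod e < e" using that de by (simp_all add: less_mult_imp_div_less)
      have "v i (Suc n) = (\<Sum>j<d. \<Sum>k<e. F (i div e) j * G (i mod e) k * (f (n + j) * g (n + k)))"
        using F[OF i(1), of n] G[OF i(2), of n]
        by (simp add: v_def sum_product mult_ac)
      also have "\<dots> = (\<Sum>j<d * e. F (i div e) (j div e) * G (i mod e) (j mod e) * v j n)"
        by (simp add: v_def sum_div_mod[symmetric])
      finally show ?thesis .
    qed
    then obtain r where r: "monic r" "\<And>i n. i < d * e \<Longrightarrow> rec_act r (v i) n = 0"
      using linrec_system[of "d * e" v "\<lambda>i j. F (i div e) (j div e) * G (i mod e) (j mod e)"] by blast
    have "v 0 = (\<lambda>n. f n * g n)" by (simp add: v_def)
    then show ?thesis using r(2)[of 0] r(1) de by (auto simp: linrec_seqs_iff)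
  qed
qed

lemma monic_mult_int: "monic p \<Longrightarrow> monic q \<Longrightarrow> monic (p * q)" for p q :: "int poly"
  by (simp add: lead_coeff_mult)

lemma linrec_seqs_add:
  assumes "f \<in> linrec_seqs" "g \<in> linrec_seqs"
  shows "(\<lambda>n. f n + g n) \<in> linrec_seqs"
proof -
  obtain p where p: "monic p" "\<And>n. rec_act p f n = 0"
    using assms(1) by (auto simp: linrec_seqs_iff)
  obtain q where q: "monic q" "\<And>n. rec_act q g n = 0"
    using assms(2) by (auto simp: linrec_seqs_iff)
  have "rec_act p f = (\<lambda>n. 0)" "rec_act q g = (\<lambda>n. 0)" using p(2) q(2) by auto
  then have 1: "rec_act (q * p) f n = 0" and 2: "rec_act (p * q) g n = 0" for n
    by (simp_all add: rec_act_mult)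
  have "rec_act (p * q) (\<lambda>n. f n + g n) n = 0" for n
    using 1 2 by (simp add: rec_act_fun_add mult.commute)
  then show ?thesis using monic_mult_int[OF p(1) q(1)] by (auto simp: linrec_seqs_iff)
qed

lemma linrec_seqs_uminus: "f \<in> linrec_seqs \<Longrightarrow> (\<lambda>n. - f n) \<in> linrec_seqs"
  by (auto simp: linrec_seqs_iff rec_act_fun_uminus)

lemma linrec_seqs_0: "(\<lambda>n. 0) \<in> linrec_seqs"
  by (auto simp: linrec_seqs_iff intro!: exI[of _ 1])

lemma linrec_seqs_1: "(\<lambda>n. 1) \<in> linrec_seqs"
  by (auto simp: linrec_seqs_iff rec_act_pCons intro!: exI[of _ "[:-1, 1:]"])

typedef linrec = linrec_seqs
  morphisms linrec_nth Abs_linrec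
  using linrec_seqs_0 by blast

setup_lifting type_definition_linrec

instantiation linrec :: comm_ring_1
begin

lift_definition zero_linrec :: linrec is "\<lambda>n. 0" by (rule linrec_seqs_0)
lift_definition one_linrec :: linrec is "\<lambda>n. 1" by (rule linrec_seqs_1)
lift_definition plus_linrec :: "linrec \<Rightarrow> linrec \<Rightarrow> linrec" is "\<lambda>f g n. f n + g n"
  by (rule linrec_seqs_add)
lift_definition times_linrec :: "linrec \<Rightarrow> linrec \<Rightarrow> linrec" is "\<lambda>f g n. f n * g n"
  by (rule linrec_seqs_mult)
lift_definition uminus_linrec :: "linrec \<Rightarrow> linrec" is "\<lambda>f n. - f n"
  by (rule linrec_seqs_uminus)
lift_definition minus_linrec :: "linrec \<Rightarrow> linrec \<Rightarrow> linrec" is "\<lambda>f g n. f n - g n"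
  using linrec_seqs_add[OF _ linrec_seqs_uminus] by simp

instance
  by standard (transfer; simp add: algebra_simps fun_eq_iff)+

end

lemma linrec_nth_simps [simp]:
  "linrec_nth 0 n = 0" "linrec_nth 1 n = 1"
  "linrec_nth (f + g) n = linrec_nth f n + linrec_nth g n"
  "linrec_nth (f * g) n = linrec_nth f n * linrec_nth g n"
  "linrec_nth (- f) n = - linrec_nth f n"
  "linrec_nth (f - g) n = linrec_nth f n - linrec_nth g n"
  by (simp_all add: minus_linrec.rep_eq zero_linrec.rep_eq one_linrec.rep_eq plus_linrec.rep_eq
      times_linrec.rep_eq uminus_linrec.rep_eq)

lemma linrec_nth_sum [simp]: "linrec_nth (\<Sum>i\<in>I. f i) n = (\<Sum>i\<in>I. linrec_nth (f i) n)"
  by (induction I rule: infinite_finite_induct) simp_all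

lemma linrec_eqI: "(\<And>n. linrec_nth f n = linrec_nth g n) \<Longrightarrow> f = g"
  by (simp add: linrec_nth_inject[symmetric] fun_eq_iff)

text \<open>
  The pairing of \<open>L(\<int>) \<otimes> L(\<int>)\<close> with \<open>t\<^sup>i \<otimes> t\<^sup>j\<close>.
\<close>

definition linrec_pair :: "(linrec, linrec) tensor \<Rightarrow> nat \<Rightarrow> nat \<Rightarrow> int"
  where "linrec_pair x i j = (\<Sum>(f, g)\<in>Poly_Mapping.keys (rep_tensor x).
    Poly_Mapping.lookup (rep_tensor x) (f, g) * (linrec_nth f i * linrec_nth g j))"

text \<open>
  The comultiplication dual to the multiplication of \<open>\<int>[t]\<close>: the functional \<open>\<Delta> f\<close> sends
  \<open>t\<^sup>i \<otimes> t\<^sup>j\<close> to the value of \<open>f\<close> at \<open>t\<^sup>i t\<^sup>j\<close>.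
\<close>

definition linrec_comult :: "linrec \<Rightarrow> (linrec, linrec) tensor"
  where "linrec_comult f = (THE x. \<forall>i j. linrec_pair x i j = linrec_nth f (i + j))"

definition linrec_counit :: "linrec \<Rightarrow> int"
  where "linrec_counit f = linrec_nth f 0"

definition frag_val :: "('a \<Rightarrow> int) \<Rightarrow> ('a \<Rightarrow>\<^sub>0 int) \<Rightarrow> int"
  where "frag_val h x = (\<Sum>a\<in>Poly_Mapping.keys x. Poly_Mapping.lookup x a * h a)"

lemma frag_val_superset:
  "finite S \<Longrightarrow> Poly_Mapping.keys x \<subseteq> S \<Longrightarrow> frag_val h x = (\<Sum>a\<in>S. Poly_Mapping.lookup x a * h a)"
  unfolding frag_val_def by (rule sum.mono_neutral_left) (auto simp: in_keys_iff)

lemma frag_val_diff: "frag_val h (x - y) = frag_val h x - frag_val h y"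
proof -
  let ?S = "Poly_Mapping.keys x \<union> Poly_Mapping.keys y"
  have "Poly_Mapping.keys (x - y) \<subseteq> ?S" by (rule keys_diff)
  then show ?thesis
    by (simp add: frag_val_superset[of ?S] lookup_minus left_diff_distrib sum_subtractf)
qed

lemma frag_val_of [simp]: "frag_val h (frag_of a) = h a"
  by (simp add: frag_val_def)

lemma frag_val_0 [simp]: "frag_val h 0 = 0"
  by (simp add: frag_val_def)

lemma linrec_pair_abs:
  "linrec_pair (abs_tensor u) i j = frag_val (\<lambda>(f, g). linrec_nth f i * linrec_nth g j) u"
proof -
  let ?h = "\<lambda>(f, g). linrec_nth f i * linrec_nth g j"
  have z: "frag_val ?h w = 0" if "w \<in> tensor_rels" for w
    using that by induction (simp_all add: frag_val_diff distrib_left distrib_right)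
  have "abs_tensor (rep_tensor (abs_tensor u)) = abs_tensor u" by simp
  then have "rep_tensor (abs_tensor u) - u \<in> tensor_rels"
    by (metis tensor.abs_eq_iff)
  from z[OF this] have "frag_val ?h (rep_tensor (abs_tensor u)) = frag_val ?h u"
    by (simp add: frag_val_diff)
  then show ?thesis
    by (simp add: linrec_pair_def frag_val_def split_beta)
qed

lemma linrec_pair_tens [simp]: "linrec_pair (f \<otimes>\<^sub>Z g) i j = linrec_nth f i * linrec_nth g j"
  by (simp add: tens.abs_eq linrec_pair_abs)

lemma linrec_pair_diff: "linrec_pair (x - y) i j = linrec_pair x i j - linrec_pair y i j"
proof -
  obtain u v where "x = abs_tensor u" "y = abs_tensor v" by (metis abs_rep_tensor)
  then show ?thesis by (simp add: minus_tensor.abs_eq linrec_pair_abs frag_val_diff)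
qed

lemma linrec_pair_0 [simp]: "linrec_pair 0 i j = 0"
  using linrec_pair_diff[of 0 0] by simp

lemma linrec_pair_add: "linrec_pair (x + y) i j = linrec_pair x i j + linrec_pair y i j"
  using linrec_pair_diff[of "x + y" y] by simp

lemma linrec_pair_sum: "linrec_pair (\<Sum>k\<in>K. f k) i j = (\<Sum>k\<in>K. linrec_pair (f k) i j)"
  by (induction K rule: infinite_finite_induct) (simp_all add: linrec_pair_add)

lemma linrec_pair_mult: "linrec_pair (x * y) i j = linrec_pair x i j * linrec_pair y i j"
proof (induction x)
  case (tens a b) show ?case
    by (induction y) (simp_all add: tens_mult linrec_pair_diff right_diff_distrib)
qed (simp_all add: linrec_pair_diff left_diff_distrib)

lemma linrec_pair_swap: "linrec_pair (tensor_swap x) i j = linrec_pair x j i"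
  by (induction x) (simp_all add: tensor_swap_tens tensor_swap_def tensor_lift_0 tensor_lift_diff biadditive_swap
      tensor_lift_tens linrec_pair_diff)


subsection \<open>Existence and uniqueness of the comultiplication\<close>

text \<open>The basis dual to \<open>1, t, t\<^sup>2, \<dots>\<close> of \<open>\<int>[t]/(p(t))\<close>.\<close>

fun dual_seq :: "int poly \<Rightarrow> nat \<Rightarrow> nat \<Rightarrow> int" where
  "dual_seq p i n = (if n < degree p then (if n = i then 1 else 0)
     else - (\<Sum>k<degree p. coeff p k * (if k < degree p then dual_seq p i (n - degree p + k) else 0)))"

declare dual_seq.simps [simp del]

lemma dual_seq_init: "n < degree p \<Longrightarrow> dual_seq p i n = (if n = i then 1 else 0)"
  by (simp add: dual_seq.simps)

lemma dual_seq_rec: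
  assumes "monic p"
  shows "rec_act p (dual_seq p i) n = 0"
proof -
  have "dual_seq p i (n + degree p) = - (\<Sum>k<degree p. coeff p k * dual_seq p i (n + k))"
    by (subst dual_seq.simps) simp
  then show ?thesis
    using assms by (simp add: rec_act_def lessThan_Suc_atMost[symmetric])
qed

lift_definition linrec_shift :: "nat \<Rightarrow> linrec \<Rightarrow> linrec" is "\<lambda>i f n. f (i + n)"
proof -
  fix i :: nat and f assume "f \<in> linrec_seqs"
  then obtain p where p: "monic p" "\<And>n. (\<Sum>k\<le>degree p. coeff p k * f (n + k)) = 0"
    by (auto simp: linrec_seqs_def)
  have "(\<Sum>k\<le>degree p. coeff p k * f (i + (n + k))) = 0" for n
    using p(2)[of "i + n"] by (simp add: add.assoc)
  then show "(\<lambda>n. f (i + n)) \<in> linrec_seqs"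
    unfolding linrec_seqs_def using p(1) by blast
qed

definition linrec_dual :: "int poly \<Rightarrow> nat \<Rightarrow> linrec"
  where "linrec_dual p i = Abs_linrec (dual_seq p i)"

lemma linrec_nth_dual: "monic p \<Longrightarrow> linrec_nth (linrec_dual p i) n = dual_seq p i n"
  unfolding linrec_dual_def
  by (subst Abs_linrec_inverse) (auto simp: linrec_seqs_iff dual_seq_rec)

definition annihilates :: "int poly \<Rightarrow> linrec \<Rightarrow> bool"
  where "annihilates p f \<longleftrightarrow> (\<forall>n. rec_act p (linrec_nth f) n = 0)"

lemma annihilates_mult: "annihilates p f \<Longrightarrow> annihilates (q * p) f"
proof -
  assume "annihilates p f"
  then have "rec_act p (linrec_nth f) = (\<lambda>n. 0)" by (simp add: annihilates_def fun_eq_iff)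
  then show ?thesis by (simp add: annihilates_def rec_act_mult)
qed

lemma annihilates_ex:
  obtains p where "monic p" "degree p > 0" "annihilates p f"
proof -
  have "linrec_nth f \<in> linrec_seqs" by (rule linrec_nth)
  then obtain p where p: "monic p" "annihilates p f"
    by (auto simp: linrec_seqs_iff annihilates_def)
  let ?q = "[:0, 1:] * p"
  have "monic ?q" using p(1) by (intro monic_mult_int) auto
  moreover have "p \<noteq> 0" using p(1) by auto
  then have "degree ?q > 0" by (simp add: degree_mult_eq)
  moreover have "annihilates ?q f" using p(2) by (rule annihilates_mult)
  ultimately show ?thesis using that by blast
qed

lemma annihilates_ex_finite:
  assumes "finite S"
  obtains p where "monic p" "\<And>f. f \<in> S \<Longrightarrow> annihilates p f"
  using assms
proof (induction S arbitrary: thesis)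
  case empty
  then show ?case by (metis empty_iff lead_coeff_1)
next
  case (insert g S)
  obtain p where p: "monic p" "\<And>f. f \<in> S \<Longrightarrow> annihilates p f" using insert.IH by blast
  obtain q where q: "monic q" "annihilates q g" using annihilates_ex[of g] by blast
  show ?case
    by (rule insert.prems[of "q * p"])
      (use p q annihilates_mult[of p _ q] annihilates_mult[of q _ p] monic_mult_int in \<open>auto simp: mult.commute\<close>)
qed

lemma linrec_expand_nth:
  assumes p: "monic p" and f: "\<And>n. rec_act p f n = 0"
  shows "f n = (\<Sum>i<degree p. f i * dual_seq p i n)"
proof (induction n rule: less_induct)
  case (less n)
  show ?case
  proof (cases "n < degree p")
    case True
    then show ?thesis by (simp add: dual_seq_init if_distrib[of "\<lambda>x. _ * x"] cong: if_cong)
  next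
    case False
    define d where "d = degree p"
    obtain m where n: "n = m + d" using False by (metis d_def le_add_diff_inverse2 not_less)
    have rec: "h (m + d) = - (\<Sum>k<d. coeff p k * h (m + k))" if "rec_act p h m = 0" for h
      using that p by (simp add: rec_act_def lessThan_Suc_atMost[symmetric] d_def)
    have "f n = - (\<Sum>k<d. coeff p k * f (m + k))" unfolding n by (rule rec[OF f])
    also have "\<dots> = - (\<Sum>k<d. coeff p k * (\<Sum>i<d. f i * dual_seq p i (m + k)))"
      using less.IH by (intro arg_cong[of _ _ uminus] sum.cong refl) (simp add: n d_def)
    also have "\<dots> = (\<Sum>i<d. f i * (- (\<Sum>k<d. coeff p k * dual_seq p i (m + k))))"
      by (simp add: sum_distrib_left sum_negf) (subst sum.swap, simp add: mult_ac)
    also have "\<dots> = (\<Sum>i<d. f i * dual_seq p i n)"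
      unfolding n by (simp add: rec[OF dual_seq_rec[OF p]])
    finally show ?thesis by (simp add: d_def)
  qed
qed

lemma int_scale_tens:
  fixes f g :: linrec
  shows "((of_int k * f) \<otimes>\<^sub>Z g) = (f \<otimes>\<^sub>Z (of_int k * g))"
proof (induction k rule: int_induct[of _ 0])
  case (step1 i) then show ?case by (simp add: distrib_right tens_add_left tens_add_right)
next
  case (step2 i) 
  have "(of_int i * f - f) \<otimes>\<^sub>Z g = (of_int i * f) \<otimes>\<^sub>Z g - f \<otimes>\<^sub>Z g"
    using tens_add_left[of "of_int i * f" "- f" g] by (simp add: tens_uminus_left)
  moreover have "f \<otimes>\<^sub>Z (of_int i * g - g) = f \<otimes>\<^sub>Z (of_int i * g) - f \<otimes>\<^sub>Z g"
    using tens_add_right[of f "of_int i * g" "- g"] by (simp add: tens_uminus_right)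
  ultimately show ?case using step2 by (simp add: left_diff_distrib)
qed simp

lemma linrec_nth_of_int [simp]: "linrec_nth (of_int k) n = k"
  by (induction k rule: int_induct[of _ 0]) simp_all

lemma linrec_expand:
  assumes "monic p" "annihilates p f"
  shows "f = (\<Sum>i<degree p. of_int (linrec_nth f i) * linrec_dual p i)"
  using assms by (intro linrec_eqI) (simp add: linrec_nth_dual annihilates_def linrec_expand_nth[of p, symmetric])

lemma linrec_pair_eq_0:
  assumes "\<And>i j. linrec_pair x i j = 0"
  shows "x = 0"
proof -
  let ?Q = "\<lambda>x S. finite S \<and> (\<forall>p. monic p \<longrightarrow> (\<forall>f\<in>S. annihilates p f) \<longrightarrow>
    (\<exists>h. x = (\<Sum>i<degree p. linrec_dual p i \<otimes>\<^sub>Z h i)))"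
  have "\<exists>S. ?Q x S"
  proof (induction x)
    case zero
    show ?case by (intro exI[of _ "{}"]) (auto intro!: exI[of _ "\<lambda>_. 0"])
  next
    case (tens f g)
    have main: "f \<otimes>\<^sub>Z g = (\<Sum>i<degree p. linrec_dual p i \<otimes>\<^sub>Z (of_int (linrec_nth f i) * g))"
      if "monic p" "annihilates p f" for p
      by (subst linrec_expand[OF that]) (simp add: tens_sum_left int_scale_tens)
    show ?case
      by (intro exI[of _ "{f}"] conjI allI impI, simp, rule exI, rule main) simp_all
  next
    case (diff x y)
    obtain S where S: "?Q x S" using diff by blast
    obtain S' where S': "?Q y S'" using diff by blast
    have "\<exists>h. x - y = (\<Sum>i<degree p. linrec_dual p i \<otimes>\<^sub>Z h i)"
      if p: "monic p" "\<forall>f\<in>S \<union> S'. annihilates p f" for p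
    proof -
      obtain h where h: "x = (\<Sum>i<degree p. linrec_dual p i \<otimes>\<^sub>Z h i)" using p S by blast
      obtain h' where h': "y = (\<Sum>i<degree p. linrec_dual p i \<otimes>\<^sub>Z h' i)" using p S' by blast
      have "x - y = (\<Sum>i<degree p. linrec_dual p i \<otimes>\<^sub>Z (h i + - h' i))"
        unfolding h h' tens_add_right tens_uminus_right by (simp add: sum_subtractf)
      then show ?thesis by (rule exI[of _ "\<lambda>i. h i + - h' i"])
    qed
    then show ?case using S S' by (intro exI[of _ "S \<union> S'"]) blast
  qed
  then obtain S where S: "?Q x S" by blast
  obtain p where p: "monic p" "\<And>f. f \<in> S \<Longrightarrow> annihilates p f"
    using annihilates_ex_finite[of S] S by blast
  then obtain h where h: "x = (\<Sum>i<degree p. linrec_dual p i \<otimes>\<^sub>Z h i)" using S by blast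
  have "linrec_nth (h i) j = 0" if "i < degree p" for i j
  proof -
    have "0 = (\<Sum>k<degree p. dual_seq p k i * linrec_nth (h k) j)"
      using assms[of i j] by (simp add: h linrec_pair_sum linrec_nth_dual p)
    also have "\<dots> = (\<Sum>k<degree p. if k = i then linrec_nth (h k) j else 0)"
      using that by (intro sum.cong) (auto simp: dual_seq_init)
    finally show ?thesis using that by simp
  qed
  then have "h i = 0" if "i < degree p" for i
    using that by (intro linrec_eqI) simp
  then show ?thesis by (simp add: h)
qed

lemma linrec_pair_eqI:
  assumes "\<And>i j. linrec_pair x i j = linrec_pair y i j"
  shows "x = y"
  using linrec_pair_eq_0[of "x - y"] assms by (simp add: linrec_pair_diff)

lemma linrec_pair_expand:
  assumes "monic p" "annihilates p f"
  shows "linrec_pair (\<Sum>i<degree p. linrec_dual p i \<otimes>\<^sub>Z linrec_shift i f) a b = linrec_nth f (a + b)"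
proof -
  have "rec_act p (\<lambda>a. linrec_nth f (a + b)) n = 0" for n
  proof (induction b arbitrary: n)
    case 0
    then show ?case using assms(2) by (simp add: annihilates_def)
  next
    case (Suc b)
    then show ?case using rec_act_shift[of p "\<lambda>a. linrec_nth f (a + b)" n] by simp
  qed
  from linrec_expand_nth[OF assms(1) this, of a] show ?thesis
    using assms by (simp add: linrec_pair_sum linrec_nth_dual linrec_shift.rep_eq mult.commute)
qed

lemma linrec_comult_eqI:
  assumes "\<And>i j. linrec_pair x i j = linrec_nth f (i + j)"
  shows "linrec_comult f = x"
  unfolding linrec_comult_def using assms linrec_pair_eqI by (intro the_equality) (auto intro: linrec_pair_eqI)

lemma linrec_comult_expand:
  assumes "monic p" "annihilates p f"
  shows "linrec_comult f = (\<Sum>i<degree p. linrec_dual p i \<otimes>\<^sub>Z linrec_shift i f)"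
  by (rule linrec_comult_eqI) (rule linrec_pair_expand[OF assms])

lemma linrec_pair_comult [simp]: "linrec_pair (linrec_comult f) i j = linrec_nth f (i + j)"
proof -
  obtain p where "monic p" "annihilates p f" using annihilates_ex[of f] by blast
  then show ?thesis by (simp add: linrec_comult_expand linrec_pair_expand)
qed

lemma ring_morphism_linrec_comult: "ring_morphism linrec_comult"
  by (rule ring_morphismI; rule linrec_pair_eqI) (simp_all add: linrec_pair_add linrec_pair_mult one_tensor_def)

lemma ring_morphism_linrec_counit: "ring_morphism linrec_counit"
  by (rule ring_morphismI) (simp_all add: linrec_counit_def)

lemma annihilates_shift: "annihilates p f \<Longrightarrow> annihilates p (linrec_shift i f)"
proof -
  assume p: "annihilates p f"
  have "rec_act p (\<lambda>n. linrec_nth f (i + n)) n = 0" for n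
    using p by (simp add: annihilates_def rec_act_def add.assoc[symmetric])
  then show ?thesis by (simp add: annihilates_def linrec_shift.rep_eq)
qed

lemma annihilates_dual: "monic p \<Longrightarrow> annihilates p (linrec_dual p i)"
  using dual_seq_rec by (simp add: annihilates_def rec_act_def linrec_nth_dual)

theorem linrec_biring: "cocomm_torsion_free_biring linrec_comult linrec_counit"
proof
  note hom = ring_morphismD[OF ring_morphism_linrec_comult] ring_morphismD[OF ring_morphism_linrec_counit]
  show "ring_morphism linrec_comult" by (rule ring_morphism_linrec_comult)
  show "ring_morphism linrec_counit" by (rule ring_morphism_linrec_counit)
  fix f :: linrec
  obtain p where p: "monic p" "degree p > 0" "annihilates p f" using annihilates_ex[of f] by blast
  define d where "d = degree p"
  have \<Delta>: "linrec_comult f = (\<Sum>i<d. linrec_dual p i \<otimes>\<^sub>Z linrec_shift i f)"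
    using linrec_comult_expand[OF p(1,3)] by (simp add: d_def)
  show "tensor_swap (linrec_comult f) = linrec_comult f"
    by (rule linrec_pair_eqI) (simp add: linrec_pair_swap add.commute)
  have b1: "biadditive (\<lambda>a b. linrec_counit a \<otimes>\<^sub>Z b)" and b2: "biadditive (\<lambda>a b. a \<otimes>\<^sub>Z linrec_counit b)"
    and b3: "biadditive (\<lambda>a b. linrec_comult a \<otimes>\<^sub>Z b)" and b4: "biadditive (\<lambda>a b. a \<otimes>\<^sub>Z linrec_comult b)"
    for b :: linrec
    by (simp_all add: biadditive_map hom)
  have "tensor_map linrec_counit (\<lambda>x. x) (linrec_comult f) =
    (\<Sum>i<d. (if i = 0 then 1 \<otimes>\<^sub>Z f else 0))"
    unfolding \<Delta> tensor_map_def tensor_lift_sum[OF b1] tensor_lift_tens[OF b1]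
  proof (intro sum.cong refl)
    fix i assume "i \<in> {..<d}"
    have "linrec_counit (linrec_dual p i) = (if i = 0 then 1 else 0)"
      using p by (simp add: linrec_counit_def linrec_nth_dual dual_seq_init)
    moreover have "linrec_shift 0 f = f" by (rule linrec_eqI) (simp add: linrec_shift.rep_eq)
    ultimately show "linrec_counit (linrec_dual p i) \<otimes>\<^sub>Z linrec_shift i f = (if i = 0 then 1 \<otimes>\<^sub>Z f else 0)"
      by simp
  qed
  also have "\<dots> = 1 \<otimes>\<^sub>Z f" using p by (simp add: d_def)
  finally show l: "tensor_map linrec_counit (\<lambda>x. x) (linrec_comult f) = 1 \<otimes>\<^sub>Z f" .
  have sw: "tensor_map (\<lambda>x. x) linrec_counit (tensor_swap x) = tensor_swap (tensor_map linrec_counit (\<lambda>x. x) x)"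
    for x :: "(linrec, linrec) tensor"
    unfolding tensor_map_def tensor_swap_def
    by (induction x) (simp_all only: tensor_lift_0 tensor_lift_diff tensor_lift_tens biadditive_swap b1 b2)
  show "tensor_map (\<lambda>x. x) linrec_counit (linrec_comult f) = f \<otimes>\<^sub>Z 1"
    using sw[of "linrec_comult f"] \<open>tensor_swap (linrec_comult f) = linrec_comult f\<close> l
    by (simp add: tensor_swap_tens)
  have "tensor_assoc (tensor_map linrec_comult (\<lambda>x. x) (linrec_comult f)) =
    (\<Sum>i<d. tensor_assoc (linrec_comult (linrec_dual p i) \<otimes>\<^sub>Z linrec_shift i f))"
    unfolding \<Delta> tensor_map_def tensor_lift_sum[OF b3] tensor_lift_tens[OF b3] tensor_assoc_def
      tensor_lift_sum[OF biadditive_assoc1] ..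
  also have "\<dots> = (\<Sum>i<d. \<Sum>j<d. linrec_dual p j \<otimes>\<^sub>Z (linrec_shift j (linrec_dual p i) \<otimes>\<^sub>Z linrec_shift i f))"
    unfolding linrec_comult_expand[OF p(1) annihilates_dual[OF p(1)], folded d_def] tens_sum_left
    by (simp add: tensor_assoc_def tensor_lift_sum biadditive_assoc1)
      (simp add: tensor_assoc_def[symmetric] tensor_assoc_tens)
  also have "\<dots> = (\<Sum>j<d. linrec_dual p j \<otimes>\<^sub>Z (\<Sum>i<d. linrec_shift j (linrec_dual p i) \<otimes>\<^sub>Z linrec_shift i f))"
    by (subst sum.swap) (simp add: tens_sum_right)
  also have "\<dots> = (\<Sum>j<d. linrec_dual p j \<otimes>\<^sub>Z linrec_comult (linrec_shift j f))"
  proof (intro sum.cong refl arg_cong[of _ _ "tens _"] linrec_pair_eqI)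
    fix j a b
    have "linrec_pair (\<Sum>i<d. linrec_shift j (linrec_dual p i) \<otimes>\<^sub>Z linrec_shift i f) a b =
      linrec_pair (\<Sum>i<d. linrec_dual p i \<otimes>\<^sub>Z linrec_shift i f) (j + a) b"
      by (simp add: linrec_pair_sum linrec_shift.rep_eq)
    also have "\<dots> = linrec_nth f (j + a + b)"
      using linrec_pair_expand[OF p(1,3)] by (simp add: d_def)
    finally show "linrec_pair (\<Sum>i<d. linrec_shift j (linrec_dual p i) \<otimes>\<^sub>Z linrec_shift i f) a b =
      linrec_pair (linrec_comult (linrec_shift j f)) a b"
      by (simp add: linrec_shift.rep_eq add.assoc)
  qed
  also have "\<dots> = tensor_map (\<lambda>x. x) linrec_comult (linrec_comult f)"
    unfolding \<Delta> tensor_map_def tensor_lift_sum[OF b4] tensor_lift_tens[OF b4] ..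
  finally show "tensor_assoc (tensor_map linrec_comult (\<lambda>x. x) (linrec_comult f)) =
    tensor_map (\<lambda>x. x) linrec_comult (linrec_comult f)" .
  fix n :: nat assume n: "n > 0" "((+) f ^^ n) 0 = 0"
  have "linrec_nth (((+) f ^^ n) 0) k = of_nat n * linrec_nth f k" for k n
    by (induction n) (simp_all add: algebra_simps)
  from this[of n] n show "f = 0" by (intro linrec_eqI) simp
qed

section \<open>The biring of torified varieties\<close>

text \<open>
  The Grothendieck ring of torified varieties is \<open>\<int>[T]\<close>, with \<open>T = [G\<^sub>m]\<close> the indeterminate
  \<open>[:0, 1:]\<close> of \<^typ>\<open>int poly\<close>. The element \<open>D = T - m\<close> is primitive; \<open>p \<circ>\<^sub>p [:m, 1:]\<close> expands
  \<open>p\<close> in powers of \<open>D\<close>.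
\<close>

definition lie_gen :: "nat \<Rightarrow> int poly"
  where "lie_gen m = [:- int m, 1:]"

definition lie_comult :: "nat \<Rightarrow> int poly \<Rightarrow> (int poly, int poly) tensor"
  where "lie_comult m p = (let q = p \<circ>\<^sub>p [:int m, 1:] in
    \<Sum>k\<le>degree q. ([:coeff q k:] \<otimes>\<^sub>Z 1) * (lie_gen m \<otimes>\<^sub>Z 1 + 1 \<otimes>\<^sub>Z lie_gen m) ^ k)"

definition lie_counit :: "nat \<Rightarrow> int poly \<Rightarrow> int"
  where "lie_counit m p = poly p (int m)"

lemma pcompose_hom: "ring_morphism (\<lambda>p :: int poly. p \<circ>\<^sub>p r)"
  by (rule ring_morphismI) (simp_all add: pcompose_add pcompose_mult pcompose_1)

lemma eval_hom:
  fixes P :: "(int poly, int poly) tensor"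
  shows "ring_morphism (\<lambda>q. \<Sum>k\<le>degree q. ([:coeff q k:] \<otimes>\<^sub>Z 1) * P ^ k)"
proof -
  define E where "E = (\<lambda>q. \<Sum>k\<le>degree q. ([:coeff q k:] \<otimes>\<^sub>Z (1 :: int poly)) * P ^ k)"
  have E0: "E 0 = 0" by (simp add: E_def)
  have Ep: "E (pCons a q) = ([:a:] \<otimes>\<^sub>Z 1) + P * E q" for a q
  proof -
    have "E (pCons a q) = (\<Sum>k\<le>Suc (degree q). ([:coeff (pCons a q) k:] \<otimes>\<^sub>Z 1) * P ^ k)"
      unfolding E_def by (rule sum.mono_neutral_left) (auto simp: coeff_eq_0 degree_pCons_le)
    then show ?thesis
      by (simp add: sum.atMost_Suc_shift E_def sum_distrib_left mult_ac del: sum.atMost_Suc)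
  qed
  have add: "E (p + q) = E p + E q" for p q
  proof (induction p q rule: poly_induct2)
    case (pCons a p b q)
    have "[:a + b:] = [:a:] + [:b:]" by simp
    then show ?case using pCons by (simp only: add_pCons Ep tens_add_left[symmetric] distrib_left) (simp add: ac_simps tens_add_left[symmetric])
  qed (simp add: E0)
  have sm: "E (Polynomial.smult a q) = ([:a:] \<otimes>\<^sub>Z 1) * E q" for a q
    by (induction q) (simp_all add: E0 Ep distrib_left tens_mult mult_ac)
  have mult: "E (p * q) = E p * E q" for p q
    by (induction p) (simp_all add: E0 Ep add sm distrib_right mult.assoc)
  have one: "E 1 = 1" unfolding one_pCons Ep by (simp add: E0 one_tensor_def one_pCons)
  have "ring_morphism E" by (rule ring_morphismI) (simp_all add: add mult one)
  then show ?thesis by (simp add: E_def)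
qed

lemma ring_morphism_lie_comult: "ring_morphism (lie_comult m)"
  using ring_morphism_comp[OF eval_hom[of "lie_gen m \<otimes>\<^sub>Z 1 + 1 \<otimes>\<^sub>Z lie_gen m"] pcompose_hom[of "[:int m, 1:]"]]
  by (simp add: lie_comult_def[abs_def] Let_def)

lemma ring_morphism_lie_counit: "ring_morphism (lie_counit m)"
  by (rule ring_morphismI) (simp_all add: lie_counit_def)

lemma lie_comult_gen: "lie_comult m (lie_gen m) = lie_gen m \<otimes>\<^sub>Z 1 + 1 \<otimes>\<^sub>Z lie_gen m"
  by (simp add: lie_comult_def lie_gen_def[of m] pcompose_pCons tens_mult)
    (simp add: one_pCons[symmetric] one_tensor_def[symmetric])

lemma lie_counit_gen: "lie_counit m (lie_gen m) = 0"
  by (simp add: lie_counit_def lie_gen_def)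

lemma ring_morphism_lie_eqI:
  fixes f g :: "int poly \<Rightarrow> 'a::{comm_ring, comm_monoid_mult}"
  assumes f: "ring_morphism f" and g: "ring_morphism g" and "f (lie_gen m) = g (lie_gen m)"
  shows "f = g"
proof -
  have "(\<lambda>p. f (p \<circ>\<^sub>p lie_gen m)) = (\<lambda>p. g (p \<circ>\<^sub>p lie_gen m))"
    using assms(3) by (intro ring_morphism_poly_eqI ring_morphism_comp[OF f pcompose_hom]
      ring_morphism_comp[OF g pcompose_hom]) (simp add: pcompose_pCons)
  then have "f (p \<circ>\<^sub>p lie_gen m) = g (p \<circ>\<^sub>p lie_gen m)" for p by (rule fun_cong)
  from this[of "_ \<circ>\<^sub>p [:int m, 1:]"] show ?thesis
    by (simp add: fun_eq_iff pcompose_assoc[symmetric] lie_gen_def pcompose_pCons pcompose_idR)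
qed

lemma lie_comult_unique:
  assumes "ring_morphism \<Delta>" "\<Delta> (lie_gen m) = lie_gen m \<otimes>\<^sub>Z 1 + 1 \<otimes>\<^sub>Z lie_gen m"
  shows "\<Delta> = lie_comult m"
  using assms lie_comult_gen ring_morphism_lie_comult by (metis ring_morphism_lie_eqI)

lemma lie_counit_unique:
  assumes "ring_morphism \<epsilon>" "\<epsilon> (lie_gen m) = 0"
  shows "\<epsilon> = lie_counit m"
  using assms lie_counit_gen ring_morphism_lie_counit by (metis ring_morphism_lie_eqI)

lemma ring_morphism_tens_left: "ring_morphism (\<lambda>x. x \<otimes>\<^sub>Z 1)" and ring_morphism_tens_right: "ring_morphism (\<lambda>x. 1 \<otimes>\<^sub>Z x)"
  by (rule ring_morphismI; simp add: tens_add_left tens_add_right tens_mult one_tensor_def)+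

theorem lie_biring: "cocomm_torsion_free_biring (lie_comult m) (lie_counit m)"
proof
  note \<Delta> = ring_morphism_lie_comult[of m] and \<epsilon> = ring_morphism_lie_counit[of m]
  note id = ring_morphism_id
  note add = ring_morphismD(1)[OF \<Delta>] ring_morphismD(1)[OF \<epsilon>]
  show "ring_morphism (lie_comult m)" "ring_morphism (lie_counit m)" by fact+
  fix a :: "int poly"
  let ?D = "lie_gen m"
  have "(\<lambda>a. tensor_assoc (tensor_map (lie_comult m) (\<lambda>x. x) (lie_comult m a))) =
    (\<lambda>a. tensor_map (\<lambda>x. x) (lie_comult m) (lie_comult m a))"
    by (rule ring_morphism_lie_eqI[OF
        ring_morphism_comp[OF ring_morphism_tensor_assoc ring_morphism_comp[OF ring_morphism_tensor_map[OF \<Delta> id] \<Delta>]]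
        ring_morphism_comp[OF ring_morphism_tensor_map[OF id \<Delta>] \<Delta>], of m])
      (simp add: lie_comult_gen ring_morphismD(1)[OF ring_morphism_tensor_assoc]
         ring_morphismD(1)[OF ring_morphism_tensor_map[OF \<Delta> id]]
         ring_morphismD(1)[OF ring_morphism_tensor_map[OF id \<Delta>]]
         tensor_map_tens add ring_morphismD(2)[OF \<Delta>] tens_add_left tens_add_right tensor_assoc_tens
         one_tensor_def add.assoc)
  then show "tensor_assoc (tensor_map (lie_comult m) (\<lambda>x. x) (lie_comult m a)) =
    tensor_map (\<lambda>x. x) (lie_comult m) (lie_comult m a)" by (rule fun_cong)
  have "(\<lambda>a. tensor_map (lie_counit m) (\<lambda>x. x) (lie_comult m a)) = (\<lambda>a. 1 \<otimes>\<^sub>Z a)"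
    by (rule ring_morphism_lie_eqI[OF
        ring_morphism_comp[OF ring_morphism_tensor_map[OF \<epsilon> id] \<Delta>] ring_morphism_tens_right, of m])
      (simp add: lie_comult_gen ring_morphismD(1)[OF ring_morphism_tensor_map[OF \<epsilon> id]]
         tensor_map_tens add ring_morphismD(2)[OF \<epsilon>] lie_counit_gen)
  then show "tensor_map (lie_counit m) (\<lambda>x. x) (lie_comult m a) = 1 \<otimes>\<^sub>Z a" by (rule fun_cong)
  have "(\<lambda>a. tensor_map (\<lambda>x. x) (lie_counit m) (lie_comult m a)) = (\<lambda>a. a \<otimes>\<^sub>Z 1)"
    by (rule ring_morphism_lie_eqI[OF
        ring_morphism_comp[OF ring_morphism_tensor_map[OF id \<epsilon>] \<Delta>] ring_morphism_tens_left, of m])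
      (simp add: lie_comult_gen ring_morphismD(1)[OF ring_morphism_tensor_map[OF id \<epsilon>]]
         tensor_map_tens add ring_morphismD(2)[OF \<epsilon>] lie_counit_gen)
  then show "tensor_map (\<lambda>x. x) (lie_counit m) (lie_comult m a) = a \<otimes>\<^sub>Z 1" by (rule fun_cong)
  have "(\<lambda>a. tensor_swap (lie_comult m a)) = lie_comult m"
    by (rule ring_morphism_lie_eqI[OF ring_morphism_comp[OF ring_morphism_tensor_swap \<Delta>] \<Delta>, of m])
      (simp add: lie_comult_gen ring_morphismD(1)[OF ring_morphism_tensor_swap] tensor_swap_tens add.commute)
  then show "tensor_swap (lie_comult m a) = lie_comult m a" by (rule fun_cong)
  fix n :: nat assume n: "n > 0" "((+) a ^^ n) 0 = 0"
  have "coeff (((+) a ^^ n) 0) k = of_nat n * coeff a k" for k n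
    by (induction n) (simp_all add: algebra_simps)
  from this[of n] n show "a = 0" by (intro poly_eqI) simp
qed

section \<open>The big Witt ring\<close>

text \<open>
  \<open>W(\<rat>) = 1 + t\<rat>[[t]]\<close>, with \<open>W(\<int>)\<close> as the subset of series with integral coefficients. Rational
  coefficients are needed as the codomain of the zeta function: \<open>T \<mapsto> exp(m t/(1 - t))\<close> is not
  integral.
\<close>

typedef witt = "{P :: rat fps. fps_nth P 0 = 1}"
  morphisms witt_fps Abs_witt
  by (rule exI[of _ 1]) simp

setup_lifting type_definition_witt

definition witt_int :: "witt set"
  where "witt_int = {P. \<forall>n. fps_nth (witt_fps P) n \<in> \<int>}"

text \<open>\<open>gh P = (a\<^sub>1, a\<^sub>2, \<dots>)\<close> where \<open>t d/dt log P = \<Sum> a\<^sub>n t\<^sup>n\<close>; thus \<open>gh P n = a\<^bsub>n+1\<^esub>\<close>.\<close>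

definition gh :: "witt \<Rightarrow> nat \<Rightarrow> rat"
  where "gh P n = fps_nth (fps_X * fps_deriv (fps_ln 1 oo (witt_fps P - 1))) (Suc n)"

lift_definition witt_of_gh :: "(nat \<Rightarrow> rat) \<Rightarrow> witt"
  is "\<lambda>a. fps_exp 1 oo Abs_fps (\<lambda>n. if n = 0 then 0 else a (n - 1) / of_nat n)"
  by simp

lemma witt_fps_0 [simp]: "fps_nth (witt_fps P) 0 = 1"
  using witt_fps[of P] by simp

lemma witt_fps_nonzero [simp]: "witt_fps P \<noteq> 0"
  using witt_fps_0[of P] by (metis fps_zero_nth zero_neq_one)

lemma gh_eq: "gh P n = fps_nth (fps_deriv (witt_fps P) * inverse (witt_fps P)) n"
proof -
  have "inverse (1 + fps_X) oo (witt_fps P - 1) = inverse ((1 + fps_X) oo (witt_fps P - 1))"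
    by (rule fps_inverse_compose) simp_all
  also have "(1 + fps_X) oo (witt_fps P - 1) = witt_fps P"
    by (simp add: fps_compose_add_distrib)
  finally show ?thesis
    by (simp add: gh_def fps_compose_deriv fps_ln_deriv mult.commute del: fps_deriv_nth)
qed

lemma gh_witt_of_gh [simp]: "gh (witt_of_gh a) = a"
proof
  fix n
  let ?L = "Abs_fps (\<lambda>n. if n = 0 then 0 else a (n - 1) / of_nat n)"
  let ?E = "fps_exp 1 oo ?L"
  have "inverse ?E * ?E = 1" by (intro inverse_mult_eq_1) simp
  then have "fps_deriv ?E * inverse ?E = fps_deriv ?L"
    by (simp add: fps_compose_deriv mult_ac)
  then show "gh (witt_of_gh a) n = a n"
    by (simp add: gh_eq witt_of_gh.rep_eq)
qed

lemma gh_inject: "gh P = gh Q \<longleftrightarrow> P = Q"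
proof
  assume eq: "gh P = gh Q"
  let ?P = "witt_fps P" and ?Q = "witt_fps Q"
  have P: "inverse ?P * ?P = 1" and Q: "inverse ?Q * ?Q = 1" by (simp_all add: inverse_mult_eq_1)
  have "fps_deriv ?P * inverse ?P = fps_deriv ?Q * inverse ?Q"
    using eq by (intro fps_ext) (metis gh_eq)
  then have "(fps_deriv ?P * inverse ?P) * (?P * ?Q) = (fps_deriv ?Q * inverse ?Q) * (?P * ?Q)"
    by (rule arg_cong)
  moreover have "(fps_deriv ?P * inverse ?P) * (?P * ?Q) = fps_deriv ?P * ?Q * (inverse ?P * ?P)"
    "(fps_deriv ?Q * inverse ?Q) * (?P * ?Q) = fps_deriv ?Q * ?P * (inverse ?Q * ?Q)"
    by (simp_all only: mult_ac)
  ultimately have d: "fps_deriv ?P * ?Q = fps_deriv ?Q * ?P" by (simp only: P Q mult_1_right)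
  have "fps_deriv (?P * inverse ?Q) = (fps_deriv ?P * ?Q - fps_deriv ?Q * ?P) * (inverse ?Q)\<^sup>2"
  proof -
    have i: "fps_deriv (inverse ?Q) = - fps_deriv ?Q * (inverse ?Q)\<^sup>2" by (rule fps_inverse_deriv) simp
    have "fps_deriv ?P * inverse ?Q = fps_deriv ?P * (inverse ?Q * ?Q) * inverse ?Q" by (simp only: Q mult_1_right)
    also have "\<dots> = fps_deriv ?P * ?Q * (inverse ?Q)\<^sup>2" by (simp only: power2_eq_square mult_ac)
    finally have "fps_deriv ?P * inverse ?Q = fps_deriv ?P * ?Q * (inverse ?Q)\<^sup>2" .
    then show ?thesis by (simp only: fps_deriv_mult i left_diff_distrib) (simp add: mult_ac)
  qed
  then have "fps_deriv (?P * inverse ?Q) = 0" using d by simp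
  then have "?P * inverse ?Q = fps_const (fps_nth (?P * inverse ?Q) 0)"
    by (simp only: fps_deriv_eq_0_iff)
  then have "?P * inverse ?Q = 1" by simp
  then have "?P * inverse ?Q * ?Q = ?Q" by simp
  then have "?P * (inverse ?Q * ?Q) = ?Q" by (simp only: mult.assoc)
  then show "P = Q" by (simp only: Q mult_1_right witt_fps_inject)
qed simp

lemma fps_geom_log_deriv:
  fixes a :: rat
  defines "P \<equiv> inverse (1 - fps_const a * fps_X)"
  shows "fps_nth (fps_deriv P * inverse P) n = a ^ Suc n"
proof -
  let ?Q = "1 - fps_const a * fps_X"
  have 1: "fps_nth ?Q 0 \<noteq> 0" by simp
  have P: "P * ?Q = 1" unfolding P_def by (rule inverse_mult_eq_1[OF 1])
  have "fps_deriv P = fps_const a * P\<^sup>2"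
    using fps_inverse_deriv[OF 1] by (simp add: P_def)
  moreover have "inverse P = ?Q" unfolding P_def using 1 by (rule fps_inverse_idempotent)
  ultimately have "fps_deriv P * inverse P = fps_const a * P"
    using P by (simp only: power2_eq_square mult.assoc mult_1_right)
  moreover have "P = Abs_fps (\<lambda>n. a ^ n)"
    unfolding P_def
  proof (rule fps_inverse_unique)
    have "fps_nth (?Q * Abs_fps (\<lambda>n. a ^ n)) n = fps_nth 1 n" for n
      by (cases n) (simp_all add: left_diff_distrib mult.assoc)
    then show "?Q * Abs_fps (\<lambda>n. a ^ n) = 1" by (rule fps_ext)
  qed
  ultimately show ?thesis by simp
qed

instantiation witt :: comm_ring_1
begin

lift_definition zero_witt :: witt is 1 by simp
lift_definition one_witt :: witt is "inverse (1 - fps_X)" by simp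
lift_definition plus_witt :: "witt \<Rightarrow> witt \<Rightarrow> witt" is "(*)" by simp
lift_definition uminus_witt :: "witt \<Rightarrow> witt" is inverse by simp
lift_definition minus_witt :: "witt \<Rightarrow> witt \<Rightarrow> witt" is "\<lambda>P Q. P * inverse Q" by simp
definition times_witt :: "witt \<Rightarrow> witt \<Rightarrow> witt"
  where "times_witt P Q = witt_of_gh (\<lambda>n. gh P n * gh Q n)"

lemma gh_witt_simps [simp]:
  "gh 0 n = 0" "gh 1 n = 1" "gh (P + Q) n = gh P n + gh Q n" "gh (- P) n = - gh P n"
  "gh (P - Q) n = gh P n - gh Q n" "gh (P * Q) n = gh P n * gh Q n"
proof -
  have inv: "inverse (witt_fps P) * witt_fps P = 1" for P by (simp add: inverse_mult_eq_1)
  have dinv: "fps_deriv (inverse (witt_fps P)) = - fps_deriv (witt_fps P) * (inverse (witt_fps P))\<^sup>2" for P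
    by (rule fps_inverse_deriv) simp
  show "gh 0 n = 0" by (simp add: gh_eq zero_witt.rep_eq)
  show "gh 1 n = 1"
    using fps_geom_log_deriv[of 1 n] by (simp add: gh_eq one_witt.rep_eq)
  have a: "gh (P + Q) n = gh P n + gh Q n" for P Q
  proof -
    have "fps_deriv (witt_fps P * witt_fps Q) * inverse (witt_fps P * witt_fps Q) =
      fps_deriv (witt_fps P) * inverse (witt_fps P) * (inverse (witt_fps Q) * witt_fps Q) +
      fps_deriv (witt_fps Q) * inverse (witt_fps Q) * (inverse (witt_fps P) * witt_fps P)"
      by (simp only: fps_inverse_mult fps_deriv_mult distrib_right distrib_left mult_ac add_ac)
    then show ?thesis by (simp add: gh_eq plus_witt.rep_eq inv del: fps_deriv_mult)
  qed
  then show "gh (P + Q) n = gh P n + gh Q n" .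
  have u: "gh (- P) n = - gh P n" for P
  proof -
    have "- P + P = 0"
      by transfer (simp add: inverse_mult_eq_1)
    then have "gh (- P) n + gh P n = 0" using a[of "- P" P] \<open>gh 0 n = 0\<close> by simp
    then show ?thesis by simp
  qed
  then show "gh (- P) n = - gh P n" .
  have "P - Q = P + - Q" by transfer simp
  then show "gh (P - Q) n = gh P n - gh Q n" by (simp add: a u)
  show "gh (P * Q) n = gh P n * gh Q n" by (simp add: times_witt_def)
qed

instance
proof
  fix a b c :: witt
  show "a * b * c = a * (b * c)" "a * b = b * a" "1 * a = a" "a + b + c = a + (b + c)" "a + b = b + a" "0 + a = a"
    "- a + a = 0" "a - b = a + - b" "(a + b) * c = a * c + b * c"
    by (simp_all add: gh_inject[symmetric] fun_eq_iff add_ac mult_ac distrib_left)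
  have "gh 0 0 \<noteq> gh 1 0" by simp
  then show "(0 :: witt) \<noteq> 1" by metis
qed

end

text \<open>The multiplication of \<open>W(\<rat>)\<close> is the one with \<open>(1 - at)\<^sup>-\<^sup>1 * (1 - bt)\<^sup>-\<^sup>1 = (1 - abt)\<^sup>-\<^sup>1\<close>.\<close>

lift_definition witt_geom :: "rat \<Rightarrow> witt" is "\<lambda>a. inverse (1 - fps_const a * fps_X)" by simp

lemma gh_geom: "gh (witt_geom a) n = a ^ Suc n"
  using fps_geom_log_deriv[of a n] by (simp add: gh_eq witt_geom.rep_eq)

lemma witt_geom_mult: "witt_geom a * witt_geom b = witt_geom (a * b)"
  by (simp add: gh_inject[symmetric] fun_eq_iff gh_geom power_mult_distrib)


section \<open>The zeta function\<close>

definition polylog :: "int \<Rightarrow> rat fps"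
  where "polylog s = Abs_fps (\<lambda>l. if l = 0 then 0 else of_nat l powi (- s))"

lift_definition zeta_F1m :: "nat \<Rightarrow> int poly \<Rightarrow> witt"
  is "\<lambda>m p. fps_exp 1 oo
    (\<Sum>k\<le>degree p. fps_const (of_int (coeff p k) * of_nat m ^ k) * polylog (1 - int k))"
  by simp

lemma gh_zeta: "gh (zeta_F1m m p) n = of_int (poly p (int (m * Suc n)))"
proof -
  let ?L = "\<Sum>k\<le>degree p. fps_const (of_int (coeff p k) * of_nat m ^ k) * polylog (1 - int k)"
  have L0: "fps_nth ?L 0 = 0" by (simp add: fps_sum_nth polylog_def)
  let ?f = "\<lambda>n. fps_nth (fps_deriv ?L) n"
  have "?L = Abs_fps (\<lambda>n. if n = 0 then 0 else ?f (n - 1) / of_nat n)"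
    using L0 by (intro fps_ext) (simp del: of_nat_Suc)
  then have "zeta_F1m m p = witt_of_gh ?f"
    unfolding witt_fps_inject[symmetric] zeta_F1m.rep_eq witt_of_gh.rep_eq by (rule arg_cong)
  then have "gh (zeta_F1m m p) n = ?f n" by simp
  also have "\<dots> = (\<Sum>k\<le>degree p. of_int (coeff p k) * of_nat m ^ k * of_nat (Suc n) ^ k)"
  proof -
    have e: "of_nat (Suc n) * (c * of_nat (Suc n) powi (int k - 1)) = c * (of_nat (Suc n) ^ k :: rat)" for c k
      by (simp add: power_int_diff del: of_nat_Suc)
    show ?thesis
      by (simp add: fps_sum_nth polylog_def sum_distrib_left del: of_nat_Suc) (simp only: e)
  qed
  also have "\<dots> = of_int (poly p (int (m * Suc n)))"
    by (simp only: poly_altdef of_int_sum of_int_mult of_int_power of_int_of_nat_eq of_nat_mult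
        power_mult_distrib mult.assoc)
  finally show ?thesis .
qed

lemma ring_morphism_zeta: "ring_morphism (zeta_F1m m)"
  by (rule ring_morphismI) (simp_all add: gh_inject[symmetric] fun_eq_iff gh_zeta)

lemma zeta_F1_not_integral: "zeta_F1m 1 [:0, 1:] \<notin> witt_int"
proof
  let ?P = "witt_fps (zeta_F1m 1 [:0, 1:])"
  assume "zeta_F1m 1 [:0, 1:] \<in> witt_int"
  then have int: "fps_nth ?P 2 \<in> \<int>" by (simp add: witt_int_def)
  have "fps_deriv ?P * inverse ?P = Abs_fps (\<lambda>n. of_nat (Suc n))"
    by (rule fps_ext) (simp only: gh_eq[symmetric] gh_zeta, simp)
  then have "fps_deriv ?P * (inverse ?P * ?P) = Abs_fps (\<lambda>n. of_nat (Suc n)) * ?P"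
    by (metis mult.assoc)
  then have d: "fps_deriv ?P = Abs_fps (\<lambda>n. of_nat (Suc n)) * ?P"
    by (simp add: inverse_mult_eq_1)
  from arg_cong[OF d, of "\<lambda>F. fps_nth F 0"] have 1: "fps_nth ?P 1 = 1" by simp
  from arg_cong[OF d, of "\<lambda>F. fps_nth F 1"] 1 have "2 * fps_nth ?P 2 = 3"
    by (simp add: fps_mult_nth numeral_2_eq_2)
  moreover obtain k where "fps_nth ?P 2 = of_int k" using int by (auto elim: Ints_cases)
  ultimately have "(of_int (2 * k) :: rat) = of_int 3" by simp
  then have "2 * k = 3" by (simp only: of_int_eq_iff)
  then show False by presburger
qed

section \<open>Direct sums and tensor products of endomorphisms\<close>

text \<open>
  A projective \<open>\<int>\<close>-module of finite rank is isomorphic to some \<open>\<int>\<^sup>n\<close>, so the objects \<open>(E, f)\<close> are given up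
  to isomorphism by square integer matrices, and \<^const>\<open>similar_mat\<close>, that is conjugation by
  \<open>GL\<^sub>n(\<int>)\<close>, is isomorphism of pairs.
\<close>

definition mat_dsum :: "'a::zero mat \<Rightarrow> 'a mat \<Rightarrow> 'a mat"
  where "mat_dsum A B = four_block_mat A (0\<^sub>m (dim_row A) (dim_col B)) (0\<^sub>m (dim_row B) (dim_col A)) B"

text \<open>The Kronecker product, the matrix of \<open>f \<otimes> g\<close>.\<close>

definition mat_kron :: "'a::times mat \<Rightarrow> 'a mat \<Rightarrow> 'a mat"
  where "mat_kron A B = mat (dim_row A * dim_row B) (dim_col A * dim_col B)
    (\<lambda>(i, j). A $$ (i div dim_row B, j div dim_col B) * B $$ (i mod dim_row B, j mod dim_col B))"

definition mat_trace :: "'a::comm_monoid_add mat \<Rightarrow> 'a"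
  where "mat_trace A = (\<Sum>i<dim_row A. A $$ (i, i))"

lemma mat_dsum_carrier [simp, intro]:
  "A \<in> carrier_mat n n \<Longrightarrow> B \<in> carrier_mat k k \<Longrightarrow> mat_dsum A B \<in> carrier_mat (n + k) (n + k)"
  by (auto simp: mat_dsum_def)

lemma mat_dsum_dim [simp]: "dim_row (mat_dsum A B) = dim_row A + dim_row B" "dim_col (mat_dsum A B) = dim_col A + dim_col B"
  by (auto simp: mat_dsum_def)

lemma mat_dsum_index:
  "A \<in> carrier_mat n n \<Longrightarrow> B \<in> carrier_mat k k \<Longrightarrow> i < n + k \<Longrightarrow> j < n + k \<Longrightarrow>
   mat_dsum A B $$ (i, j) = (if i < n then if j < n then A $$ (i, j) else 0
     else if j < n then 0 else B $$ (i - n, j - n))"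
  by (auto simp: mat_dsum_def)

lemma mat_kron_carrier [simp, intro]:
  "A \<in> carrier_mat n n \<Longrightarrow> B \<in> carrier_mat k k \<Longrightarrow> mat_kron A B \<in> carrier_mat (n * k) (n * k)"
  by (auto simp: mat_kron_def)

lemma mat_kron_dim [simp]: "dim_row (mat_kron A B) = dim_row A * dim_row B" "dim_col (mat_kron A B) = dim_col A * dim_col B"
  by (auto simp: mat_kron_def)

lemma mat_kron_index:
  "A \<in> carrier_mat n n \<Longrightarrow> B \<in> carrier_mat k k \<Longrightarrow> i < n * k \<Longrightarrow> j < n * k \<Longrightarrow>
   mat_kron A B $$ (i, j) = A $$ (i div k, j div k) * B $$ (i mod k, j mod k)"
  by (auto simp: mat_kron_def)

lemma div_mod_less:
  assumes "i < n * (k :: nat)" shows "i div k < n" "i mod k < k"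
proof -
  have "k > 0" using assms by (cases k) auto
  then show "i div k < n" "i mod k < k" using assms by (simp_all add: less_mult_imp_div_less)
qed

lemma mat_mult_index:
  "A \<in> carrier_mat n n \<Longrightarrow> B \<in> carrier_mat n n \<Longrightarrow> i < n \<Longrightarrow> j < n \<Longrightarrow>
   (A * B) $$ (i, j) = (\<Sum>k<n. A $$ (i, k) * B $$ (k, j))"
  by (simp add: scalar_prod_def atLeast0LessThan)

lemma similar_mat_square: "similar_mat A B \<Longrightarrow> \<exists>n. A \<in> carrier_mat n n \<and> B \<in> carrier_mat n n"
  by (drule similar_matD) blast

lemma similar_mat_perm:
  fixes A B :: "'a::comm_ring_1 mat"
  assumes A: "A \<in> carrier_mat n n" and B: "B \<in> carrier_mat n n" and h: "bij_betw h {..<n} {..<n}"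
    and AB: "\<And>i j. i < n \<Longrightarrow> j < n \<Longrightarrow> A $$ (i, j) = B $$ (h i, h j)"
  shows "similar_mat A B"
proof -
  define P where "P = (mat n n (\<lambda>(i, j). if j = h i then 1 else 0) :: 'a mat)"
  define Q where "Q = (mat n n (\<lambda>(i, j). if i = h j then 1 else 0) :: 'a mat)"
  have P: "P \<in> carrier_mat n n" and Q: "Q \<in> carrier_mat n n" by (simp_all add: P_def Q_def)
  have hn: "h i < n" if "i < n" for i using h that by (auto dest: bij_betwE)
  have inj: "h i = h j \<longleftrightarrow> i = j" if "i < n" "j < n" for i j
    using h that by (auto simp: bij_betw_def inj_on_def)
  have PQ: "P * Q = 1\<^sub>m n"
  proof (rule eq_matI)
    fix i j assume "i < dim_row (1\<^sub>m n :: 'a mat)" "j < dim_col (1\<^sub>m n :: 'a mat)"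
    then have ij: "i < n" "j < n" by auto
    have "(P * Q) $$ (i, j) = (\<Sum>k<n. (if k = h i then 1 else 0) * (if k = h j then 1 else 0))"
      unfolding mat_mult_index[OF P Q ij] using ij by (intro sum.cong refl) (auto simp: P_def Q_def)
    also have "\<dots> = (\<Sum>k<n. if k = h i then if h i = h j then 1 else 0 else 0)"
      by (rule sum.cong) auto
    finally show "(P * Q) $$ (i, j) = 1\<^sub>m n $$ (i, j)" using ij hn[of i] inj by simp
  qed (use P Q in auto)
  have QP: "Q * P = 1\<^sub>m n"
  proof (rule eq_matI)
    fix i j assume "i < dim_row (1\<^sub>m n :: 'a mat)" "j < dim_col (1\<^sub>m n :: 'a mat)"
    then have ij: "i < n" "j < n" by auto
    have "i \<in> h ` {..<n}" using h ij by (simp add: bij_betw_def)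
    then obtain g where g: "g < n" "h g = i" by auto
    have "(Q * P) $$ (i, j) = (\<Sum>k<n. (if i = h k then 1 else 0) * (if j = h k then 1 else 0))"
      unfolding mat_mult_index[OF Q P ij] using ij by (intro sum.cong refl) (auto simp: P_def Q_def)
    also have "\<dots> = (\<Sum>k<n. if k = g then if i = j then 1 else 0 else 0)"
      by (rule sum.cong) (use g inj in auto)
    finally show "(Q * P) $$ (i, j) = 1\<^sub>m n $$ (i, j)" using ij g by simp
  qed (use P Q in auto)
  have PB: "(P * B) $$ (i, j) = B $$ (h i, j)" if "i < n" "j < n" for i j
  proof -
    have "(P * B) $$ (i, j) = (\<Sum>k<n. (if k = h i then 1 else 0) * B $$ (k, j))"
      unfolding mat_mult_index[OF P B that] using that by (intro sum.cong refl) (auto simp: P_def)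
    also have "\<dots> = (\<Sum>k<n. if k = h i then B $$ (k, j) else 0)"
      by (rule sum.cong) auto
    finally show ?thesis using hn that by simp
  qed
  have PBc: "P * B \<in> carrier_mat n n" using P B by simp
  have "A = P * B * Q"
  proof (rule eq_matI)
    fix i j assume "i < dim_row (P * B * Q)" "j < dim_col (P * B * Q)"
    then have ij: "i < n" "j < n" using P Q by auto
    have "(P * B * Q) $$ (i, j) = (\<Sum>k<n. (P * B) $$ (i, k) * (if k = h j then 1 else 0))"
      unfolding mat_mult_index[OF PBc Q ij] using ij by (intro sum.cong refl) (auto simp: Q_def)
    also have "\<dots> = (\<Sum>k<n. if k = h j then B $$ (h i, k) else 0)"
      by (rule sum.cong) (simp_all add: PB ij del: index_mult_mat)
    finally show "A $$ (i, j) = (P * B * Q) $$ (i, j)" using ij hn[of j] by (simp add: AB del: index_mult_mat)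
  qed (use A P Q in auto)
  then show ?thesis using A B P Q PQ QP by (intro similar_matI[of _ _ P Q n]) auto
qed

lemma mat_dsum_similar:
  fixes A A' B B' :: "'a::comm_ring_1 mat"
  assumes "similar_mat A A'" "similar_mat B B'"
  shows "similar_mat (mat_dsum A B) (mat_dsum A' B')"
proof -
  obtain n k where "A \<in> carrier_mat n n" "A' \<in> carrier_mat n n" "B \<in> carrier_mat k k" "B' \<in> carrier_mat k k"
    using assms similar_mat_square by meson
  then show ?thesis
    using similar_mat_four_block_0_0[OF assms, of n k] by (simp add: mat_dsum_def)
qed

lemma mat_kron_mult:
  fixes A B C D :: "'a::comm_ring_1 mat"
  assumes A: "A \<in> carrier_mat n n" and B: "B \<in> carrier_mat k k"
    and C: "C \<in> carrier_mat n n" and D: "D \<in> carrier_mat k k"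
  shows "mat_kron A B * mat_kron C D = mat_kron (A * C) (B * D)"
proof (rule eq_matI)
  fix i j assume "i < dim_row (mat_kron (A * C) (B * D))" "j < dim_col (mat_kron (A * C) (B * D))"
  then have ij: "i < n * k" "j < n * k" using assms by auto
  note dm = div_mod_less[OF ij(1)] div_mod_less[OF ij(2)]
  have "(mat_kron A B * mat_kron C D) $$ (i, j) = (\<Sum>l<n * k. mat_kron A B $$ (i, l) * mat_kron C D $$ (l, j))"
    by (rule mat_mult_index[OF mat_kron_carrier[OF A B] mat_kron_carrier[OF C D] ij])
  also have "\<dots> = (\<Sum>l<n * k. (A $$ (i div k, l div k) * B $$ (i mod k, l mod k)) *
      (C $$ (l div k, j div k) * D $$ (l mod k, j mod k)))"
    using ij assms by (intro sum.cong refl) (simp add: mat_kron_index[of _ n _ k])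
  also have "\<dots> = (\<Sum>r<n. \<Sum>s<k. (A $$ (i div k, r) * B $$ (i mod k, s)) * (C $$ (r, j div k) * D $$ (s, j mod k)))"
    by (rule sum_div_mod)
  also have "\<dots> = (\<Sum>r<n. A $$ (i div k, r) * C $$ (r, j div k)) * (\<Sum>s<k. B $$ (i mod k, s) * D $$ (s, j mod k))"
    by (simp add: sum_product mult_ac)
  also have "\<dots> = (A * C) $$ (i div k, j div k) * (B * D) $$ (i mod k, j mod k)"
    by (simp only: mat_mult_index[OF A C dm(1) dm(3)] mat_mult_index[OF B D dm(2) dm(4)])
  finally show "(mat_kron A B * mat_kron C D) $$ (i, j) = mat_kron (A * C) (B * D) $$ (i, j)"
    by (simp only: mat_kron_index[OF mult_carrier_mat[OF A C] mult_carrier_mat[OF B D] ij])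
qed (use assms in auto)

lemma mat_kron_one: "mat_kron (1\<^sub>m n) (1\<^sub>m k) = (1\<^sub>m (n * k) :: 'a::comm_ring_1 mat)"
proof (rule eq_matI)
  fix i j assume "i < dim_row (1\<^sub>m (n * k) :: 'a mat)" "j < dim_col (1\<^sub>m (n * k) :: 'a mat)"
  then have ij: "i < n * k" "j < n * k" by auto
  have "i = j \<longleftrightarrow> i div k = j div k \<and> i mod k = j mod k" by (metis div_mult_mod_eq)
  then show "mat_kron (1\<^sub>m n) (1\<^sub>m k) $$ (i, j) = (1\<^sub>m (n * k) :: 'a mat) $$ (i, j)"
    using ij div_mod_less[OF ij(1)] div_mod_less[OF ij(2)] by (simp add: mat_kron_index[of _ n _ k])
qed auto

lemma mat_kron_similar:
  fixes A A' B B' :: "'a::comm_ring_1 mat"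
  assumes "similar_mat A A'" "similar_mat B B'"
  shows "similar_mat (mat_kron A B) (mat_kron A' B')"
proof -
  obtain n P Q where 1: "{A, A', P, Q} \<subseteq> carrier_mat n n" "P * Q = 1\<^sub>m n" "Q * P = 1\<^sub>m n" "A = P * A' * Q"
    using similar_matD[OF assms(1)] by blast
  obtain k R S where 2: "{B, B', R, S} \<subseteq> carrier_mat k k" "R * S = 1\<^sub>m k" "S * R = 1\<^sub>m k" "B = R * B' * S"
    using similar_matD[OF assms(2)] by blast
  have c: "A \<in> carrier_mat n n" "A' \<in> carrier_mat n n" "P \<in> carrier_mat n n" "Q \<in> carrier_mat n n"
    "B \<in> carrier_mat k k" "B' \<in> carrier_mat k k" "R \<in> carrier_mat k k" "S \<in> carrier_mat k k"
    using 1(1) 2(1) by simp_all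
  show ?thesis
  proof (rule similar_matI[of _ _ "mat_kron P R" "mat_kron Q S" "n * k"])
    show "{mat_kron A B, mat_kron A' B', mat_kron P R, mat_kron Q S} \<subseteq> carrier_mat (n * k) (n * k)"
      by (simp add: c)
    show "mat_kron P R * mat_kron Q S = 1\<^sub>m (n * k)"
      by (simp only: mat_kron_mult[OF c(3,7,4,8)] 1(2) 2(2) mat_kron_one)
    show "mat_kron Q S * mat_kron P R = 1\<^sub>m (n * k)"
      by (simp only: mat_kron_mult[OF c(4,8,3,7)] 1(3) 2(3) mat_kron_one)
    have "mat_kron P R * mat_kron A' B' * mat_kron Q S = mat_kron (P * A' * Q) (R * B' * S)"
      by (simp only: mat_kron_mult[OF c(3,7,2,6)]
          mat_kron_mult[OF mult_carrier_mat[OF c(3,2)] mult_carrier_mat[OF c(7,6)] c(4,8)])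
    then show "mat_kron A B = mat_kron P R * mat_kron A' B' * mat_kron Q S"
      by (simp only: 1(4)[symmetric] 2(4)[symmetric])
  qed
qed

lemma bij_betw_lessThanI:
  fixes h :: "nat \<Rightarrow> nat"
  assumes "\<And>i. i < n \<Longrightarrow> h i < n" "\<And>i j. i < n \<Longrightarrow> j < n \<Longrightarrow> h i = h j \<Longrightarrow> i = j"
  shows "bij_betw h {..<n} {..<n}"
proof -
  have "inj_on h {..<n}" using assms(2) by (simp add: inj_on_def)
  moreover have "h ` {..<n} \<subseteq> {..<n}" using assms(1) by auto
  ultimately show ?thesis by (simp add: bij_betw_def endo_inj_surj)
qed

lemma mat_dsum_commute:
  fixes A B :: "'a::comm_ring_1 mat"
  assumes A: "A \<in> carrier_mat n n" and B: "B \<in> carrier_mat k k"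
  shows "similar_mat (mat_dsum A B) (mat_dsum B A)"
proof (rule similar_mat_perm[of _ "n + k" _ "\<lambda>i. if i < n then i + k else i - n"])
  show "mat_dsum A B \<in> carrier_mat (n + k) (n + k)" by (rule mat_dsum_carrier[OF A B])
  show "mat_dsum B A \<in> carrier_mat (n + k) (n + k)"
    using mat_dsum_carrier[OF B A] by (simp only: add.commute)
  show "bij_betw (\<lambda>i. if i < n then i + k else i - n) {..<n + k} {..<n + k}"
    by (rule bij_betw_lessThanI) (auto split: if_splits)
  show "mat_dsum A B $$ (i, j) = mat_dsum B A $$ (if i < n then i + k else i - n, if j < n then j + k else j - n)"
    if "i < n + k" "j < n + k" for i j
  proof -
    let ?h = "\<lambda>i. if i < n then i + k else i - n"
    have h: "?h i < k + n" "?h j < k + n" using that by auto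
    have lt: "?h i < k \<longleftrightarrow> \<not> i < n" "?h j < k \<longleftrightarrow> \<not> j < n" using that by auto
    show ?thesis
      unfolding mat_dsum_index[OF A B that] mat_dsum_index[OF B A h] lt by simp
  qed
qed

lemma mat_dsum_assoc:
  assumes A: "A \<in> carrier_mat n n" and B: "B \<in> carrier_mat k k" and C: "C \<in> carrier_mat l l"
  shows "mat_dsum (mat_dsum A B) C = mat_dsum A (mat_dsum B C)"
proof (rule eq_matI)
  fix i j assume "i < dim_row (mat_dsum A (mat_dsum B C))" "j < dim_col (mat_dsum A (mat_dsum B C))"
  then have "i < n + k + l" "j < n + k + l" using assms by auto
  then show "mat_dsum (mat_dsum A B) C $$ (i, j) = mat_dsum A (mat_dsum B C) $$ (i, j)"
    by (auto simp: mat_dsum_index[OF mat_dsum_carrier[OF A B] C] mat_dsum_index[OF A mat_dsum_carrier[OF B C]]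
        mat_dsum_index[OF A B] mat_dsum_index[OF B C])
qed (use assms in auto)

lemma mat_dsum_zero: "A \<in> carrier_mat n n \<Longrightarrow> mat_dsum (0\<^sub>m 0 0) A = A"
  by (rule eq_matI) (auto simp: mat_dsum_index[of _ 0 _ n])

lemma mat_kron_zero: "mat_kron (0\<^sub>m 0 0) A = 0\<^sub>m 0 0"
  by (rule eq_matI) auto

lemma mat_kron_one_left: "A \<in> carrier_mat n n \<Longrightarrow> mat_kron (1\<^sub>m 1) A = (A :: 'a::comm_ring_1 mat)"
  by (rule eq_matI) (auto simp: mat_kron_index[of _ 1 _ n])

lemma mat_kron_commute:
  fixes A B :: "'a::comm_ring_1 mat"
  assumes A: "A \<in> carrier_mat n n" and B: "B \<in> carrier_mat k k"
  shows "similar_mat (mat_kron A B) (mat_kron B A)"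
proof (rule similar_mat_perm[of _ "n * k" _ "\<lambda>i. (i mod k) * n + i div k"])
  let ?h = "\<lambda>i. (i mod k) * n + i div k"
  show "mat_kron A B \<in> carrier_mat (n * k) (n * k)" by (rule mat_kron_carrier[OF A B])
  show "mat_kron B A \<in> carrier_mat (n * k) (n * k)"
    using mat_kron_carrier[OF B A] by (simp only: mult.commute)
  have dm: "?h i div n = i mod k" "?h i mod n = i div k" "?h i < n * k" if "i < n * k" for i
  proof -
    note i = div_mod_less[OF that]
    show "?h i div n = i mod k" "?h i mod n = i div k" using i by simp_all
    have "?h i < Suc (i mod k) * n" using i by simp
    also have "\<dots> \<le> k * n" using i by (intro mult_right_mono) auto
    finally show "?h i < n * k" by (simp add: mult.commute)
  qed
  show "bij_betw ?h {..<n * k} {..<n * k}"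
  proof (rule bij_betw_lessThanI)
    fix i j assume "i < n * k" "j < n * k" "?h i = ?h j"
    then have "i div k = j div k" "i mod k = j mod k" using dm by metis+
    then show "i = j" by (metis div_mult_mod_eq)
  qed (rule dm)
  show "mat_kron A B $$ (i, j) = mat_kron B A $$ (?h i, ?h j)" if "i < n * k" "j < n * k" for i j
    using mat_kron_index[OF B A, of "?h i" "?h j"] dm[OF that(1)] dm[OF that(2)]
    by (simp only: mat_kron_index[OF A B that] mult.commute[of k n]) (simp only: mult.commute)
qed

lemma mat_kron_assoc:
  fixes A B C :: "'a::comm_ring_1 mat"
  assumes A: "A \<in> carrier_mat n n" and B: "B \<in> carrier_mat k k" and C: "C \<in> carrier_mat l l"
  shows "mat_kron (mat_kron A B) C = mat_kron A (mat_kron B C)"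
proof (rule eq_matI)
  fix i j assume "i < dim_row (mat_kron A (mat_kron B C))" "j < dim_col (mat_kron A (mat_kron B C))"
  then have ij: "i < n * k * l" "j < n * k * l" using assms by (auto simp: mult.assoc)
  have l: "l > 0" using ij by (cases l) auto
  have eq: "i div (k * l) = i div l div k" "i mod (k * l) div l = i div l mod k" "i mod (k * l) mod l = i mod l" for i
  proof -
    have kl: "k * l = l * k" by (rule mult.commute)
    show "i div (k * l) = i div l div k" unfolding kl by (rule div_mult2_eq)
    have m: "i mod (k * l) = l * (i div l mod k) + i mod l" unfolding kl by (rule mod_mult2_eq)
    have lt: "i mod l < l" using l by simp
    show "i mod (k * l) div l = i div l mod k" unfolding m using lt l by (subst div_mult_self4) auto
    show "i mod (k * l) mod l = i mod l" unfolding m by (subst mod_mult_self4) auto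
  qed
  have ij': "i < n * (k * l)" "j < n * (k * l)" using ij by (simp_all only: mult.assoc)
  show "mat_kron (mat_kron A B) C $$ (i, j) = mat_kron A (mat_kron B C) $$ (i, j)"
    unfolding mat_kron_index[OF mat_kron_carrier[OF A B] C ij]
      mat_kron_index[OF A B div_mod_less(1)[OF ij(1)] div_mod_less(1)[OF ij(2)]]
      mat_kron_index[OF A mat_kron_carrier[OF B C] ij']
      mat_kron_index[OF B C div_mod_less(2)[OF ij'(1)] div_mod_less(2)[OF ij'(2)]] eq
    by (rule mult.assoc)
qed (use assms in \<open>auto simp: mult.assoc\<close>)

lemma mat_kron_dsum:
  fixes A B C :: "'a::comm_ring_1 mat"
  assumes A: "A \<in> carrier_mat n n" and B: "B \<in> carrier_mat k k" and C: "C \<in> carrier_mat l l"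
  shows "mat_kron (mat_dsum A B) C = mat_dsum (mat_kron A C) (mat_kron B C)"
proof (rule eq_matI)
  fix i j assume "i < dim_row (mat_dsum (mat_kron A C) (mat_kron B C))" "j < dim_col (mat_dsum (mat_kron A C) (mat_kron B C))"
  then have ij': "i < n * l + k * l" "j < n * l + k * l" using assms by auto
  then have ij: "i < (n + k) * l" "j < (n + k) * l" by (simp_all only: distrib_right)
  then have l: "l > 0" by (cases l) auto
  have lt: "i div l < n \<longleftrightarrow> i < n * l" for i using l by (simp add: div_less_iff_less_mult)
  have sub: "(i - n * l) div l = i div l - n" "(i - n * l) mod l = i mod l" if "\<not> i < n * l" for i
  proof -
    define r where "r = i - n * l"
    have i: "i = r + n * l" using that by (simp add: r_def)
    have "r + n * l - n * l = r" by simp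
    moreover have "(r + n * l) div l = r div l + n" "(r + n * l) mod l = r mod l" using l by simp_all
    ultimately show "(i - n * l) div l = i div l - n" "(i - n * l) mod l = i mod l"
      unfolding i by (simp_all only: add_diff_cancel_right')
  qed
  note dm = div_mod_less[OF ij(1)] div_mod_less[OF ij(2)]
  have K: "i - n * l < k * l" if "\<not> i < n * l" "i < n * l + k * l" for i using that by auto
  have AC: "mat_kron A C $$ (i, j) = A $$ (i div l, j div l) * C $$ (i mod l, j mod l)"
    if "i < n * l" "j < n * l"
    by (rule mat_kron_index[OF A C that])
  have BC: "mat_kron B C $$ (i - n * l, j - n * l) = B $$ (i div l - n, j div l - n) * C $$ (i mod l, j mod l)"
    if "\<not> i < n * l" "\<not> j < n * l"
    by (simp only: mat_kron_index[OF B C K[OF that(1) ij'(1)] K[OF that(2) ij'(2)]] sub[OF that(1)] sub[OF that(2)])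
  show "mat_kron (mat_dsum A B) C $$ (i, j) = mat_dsum (mat_kron A C) (mat_kron B C) $$ (i, j)"
    unfolding mat_kron_index[OF mat_dsum_carrier[OF A B] C ij] mat_dsum_index[OF A B dm(1) dm(3)]
      mat_dsum_index[OF mat_kron_carrier[OF A C] mat_kron_carrier[OF B C] ij'] lt
    by (cases "i < n * l"; cases "j < n * l") (simp_all only: AC BC if_True if_False mult_zero_left simp_thms)
qed (use A B C in \<open>simp_all add: distrib_right\<close>)

section \<open>The ring \<open>W\<^sub>0(\<int>)\<close>\<close>

text \<open>
  Isomorphism classes of pairs \<open>(E, f)\<close> form a commutative semiring, with the sum induced by \<open>\<oplus>\<close> and
  the product by \<open>\<otimes>\<close>. \<open>W\<^sub>0(\<int>)\<close> is its group completion modulo the ideal of the pairs \<open>(E, 0)\<close>.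
\<close>

quotient_type endo = "int mat" / partial: similar_mat
proof (rule part_equivpI)
  show "\<exists>A :: int mat. similar_mat A A" by (rule exI[of _ "1\<^sub>m 0"], rule similar_mat_refl[of _ 0]) simp
  show "symp (similar_mat :: int mat \<Rightarrow> _)" by (rule sympI) (rule similar_mat_sym)
  show "transp (similar_mat :: int mat \<Rightarrow> _)" by (rule transpI) (rule similar_mat_trans)
qed

lemma endo_cases:
  obtains n A where "A \<in> carrier_mat n n" "x = abs_endo A"
proof -
  have 1: "similar_mat (rep_endo x) (rep_endo x)" by (rule Quotient3_rep_reflp[OF Quotient3_endo])
  have 2: "x = abs_endo (rep_endo x)" by (rule Quotient3_abs_rep[OF Quotient3_endo, symmetric])
  from similar_mat_square[OF 1] obtain n where "rep_endo x \<in> carrier_mat n n" by blast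
  from that[OF this 2] show ?thesis .
qed

lemma abs_endo_eqI: "similar_mat A B \<Longrightarrow> abs_endo A = abs_endo B"
  by (rule Quotient3_rel_abs[OF Quotient3_endo])

instantiation endo :: "{comm_semiring_0, comm_monoid_mult}"
begin

lift_definition zero_endo :: endo is "0\<^sub>m 0 0" by (rule similar_mat_refl[of _ 0]) simp
lift_definition one_endo :: endo is "1\<^sub>m 1" by (rule similar_mat_refl[of _ 1]) simp
lift_definition plus_endo :: "endo \<Rightarrow> endo \<Rightarrow> endo" is mat_dsum by (rule mat_dsum_similar)
lift_definition times_endo :: "endo \<Rightarrow> endo \<Rightarrow> endo" is mat_kron by (rule mat_kron_similar)

lemma abs_endo_plus:
  "A \<in> carrier_mat n n \<Longrightarrow> B \<in> carrier_mat k k \<Longrightarrow> abs_endo A + abs_endo B = abs_endo (mat_dsum A B)"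
  by (rule plus_endo.abs_eq) (rule similar_mat_refl, assumption)+

lemma abs_endo_times:
  "A \<in> carrier_mat n n \<Longrightarrow> B \<in> carrier_mat k k \<Longrightarrow> abs_endo A * abs_endo B = abs_endo (mat_kron A B)"
  by (rule times_endo.abs_eq) (rule similar_mat_refl, assumption)+

instance
proof
  fix a b c :: endo
  obtain n A where a: "A \<in> carrier_mat n n" "a = abs_endo A" by (rule endo_cases)
  obtain k B where b: "B \<in> carrier_mat k k" "b = abs_endo B" by (rule endo_cases)
  obtain l C where c: "C \<in> carrier_mat l l" "c = abs_endo C" by (rule endo_cases)
  note AB = mat_dsum_carrier[OF a(1) b(1)] mat_kron_carrier[OF a(1) b(1)]
  note BC = mat_dsum_carrier[OF b(1) c(1)] mat_kron_carrier[OF b(1) c(1)]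
  note abc = a(2) b(2) c(2)
  show "a + b + c = a + (b + c)"
    unfolding abc abs_endo_plus[OF a(1) b(1)] abs_endo_plus[OF b(1) c(1)] abs_endo_plus[OF AB(1) c(1)]
      abs_endo_plus[OF a(1) BC(1)] mat_dsum_assoc[OF a(1) b(1) c(1)] ..
  show "a + b = b + a"
    unfolding abc abs_endo_plus[OF a(1) b(1)] abs_endo_plus[OF b(1) a(1)]
    by (rule abs_endo_eqI[OF mat_dsum_commute[OF a(1) b(1)]])
  show "0 + a = a"
    unfolding a(2) zero_endo_def abs_endo_plus[OF zero_carrier_mat[of 0 0] a(1)] mat_dsum_zero[OF a(1)] ..
  show "a * b * c = a * (b * c)"
    unfolding abc abs_endo_times[OF a(1) b(1)] abs_endo_times[OF b(1) c(1)] abs_endo_times[OF AB(2) c(1)]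
      abs_endo_times[OF a(1) BC(2)] mat_kron_assoc[OF a(1) b(1) c(1)] ..
  show comm: "a * b = b * a"
    unfolding abc abs_endo_times[OF a(1) b(1)] abs_endo_times[OF b(1) a(1)]
    by (rule abs_endo_eqI[OF mat_kron_commute[OF a(1) b(1)]])
  show "1 * a = a"
    unfolding a(2) one_endo_def abs_endo_times[OF one_carrier_mat[of 1] a(1)] mat_kron_one_left[OF a(1)] ..
  show z: "0 * a = 0"
    unfolding a(2) zero_endo_def abs_endo_times[OF zero_carrier_mat[of 0 0] a(1)] mat_kron_zero ..
  show "a * 0 = 0"
  proof -
    have "abs_endo A * abs_endo (0\<^sub>m 0 0) = abs_endo (0\<^sub>m 0 0) * abs_endo A"
      unfolding abs_endo_times[OF a(1) zero_carrier_mat[of 0 0]] abs_endo_times[OF zero_carrier_mat[of 0 0] a(1)]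
      by (rule abs_endo_eqI[OF mat_kron_commute[OF a(1) zero_carrier_mat]])
    then show ?thesis using z by (simp add: a(2) zero_endo_def)
  qed
  show "(a + b) * c = a * c + b * c"
    unfolding abc abs_endo_plus[OF a(1) b(1)] abs_endo_times[OF AB(1) c(1)] abs_endo_times[OF a(1) c(1)]
      abs_endo_times[OF b(1) c(1)]
      abs_endo_plus[OF mat_kron_carrier[OF a(1) c(1)] mat_kron_carrier[OF b(1) c(1)]]
      mat_kron_dsum[OF a(1) b(1) c(1)] ..
qed

end

text \<open>A pair \<open>(a, b)\<close> stands for \<open>[a] - [b]\<close>.\<close>

definition groth_rel :: "'a::comm_monoid_add \<times> 'a \<Rightarrow> 'a \<times> 'a \<Rightarrow> bool"
  where "groth_rel x y \<longleftrightarrow> (\<exists>k. fst x + snd y + k = fst y + snd x + k)"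

lemma groth_rel_trans:
  assumes "groth_rel x y" "groth_rel y z"
  shows "groth_rel x z"
proof -
  obtain k where k: "fst x + snd y + k = fst y + snd x + k" using assms(1) by (auto simp: groth_rel_def)
  obtain l where l: "fst y + snd z + l = fst z + snd y + l" using assms(2) by (auto simp: groth_rel_def)
  have "fst x + snd z + (snd y + k + l) = (fst x + snd y + k) + (snd z + l)" by (simp only: add_ac)
  also have "\<dots> = (fst y + snd z + l) + (snd x + k)" unfolding k by (simp only: add_ac)
  also have "\<dots> = fst z + snd x + (snd y + k + l)" unfolding l by (simp only: add_ac)
  finally show ?thesis unfolding groth_rel_def by blast
qed

quotient_type (overloaded) 'a groth = "'a::{comm_semiring_0, comm_monoid_mult} \<times> 'a" / groth_rel
proof (rule equivpI)
  show "reflp (groth_rel :: 'a \<times> 'a \<Rightarrow> _)" by (rule reflpI) (simp add: groth_rel_def)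
  show "symp (groth_rel :: 'a \<times> 'a \<Rightarrow> _)" by (rule sympI) (metis groth_rel_def)
  show "transp (groth_rel :: 'a \<times> 'a \<Rightarrow> _)" by (rule transpI) (rule groth_rel_trans)
qed

instantiation groth :: ("{comm_semiring_0, comm_monoid_mult}") "{comm_ring, comm_monoid_mult}"
begin

lift_definition zero_groth :: "'a groth" is "(0, 0)" .
lift_definition one_groth :: "'a groth" is "(1, 0)" .

lift_definition plus_groth :: "'a groth \<Rightarrow> 'a groth \<Rightarrow> 'a groth"
  is "\<lambda>x y. (fst x + fst y, snd x + snd y)"
proof -
  fix x x' y y' :: "'a \<times> 'a"
  assume "groth_rel x x'" "groth_rel y y'"
  then obtain k l where k: "fst x + snd x' + k = fst x' + snd x + k" and l: "fst y + snd y' + l = fst y' + snd y + l"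
    by (auto simp: groth_rel_def)
  have "fst x + fst y + (snd x' + snd y') + (k + l) = (fst x + snd x' + k) + (fst y + snd y' + l)"
    by (simp only: add_ac)
  also have "\<dots> = fst x' + fst y' + (snd x + snd y) + (k + l)" unfolding k l by (simp only: add_ac)
  finally show "groth_rel (fst x + fst y, snd x + snd y) (fst x' + fst y', snd x' + snd y')"
    unfolding groth_rel_def fst_conv snd_conv by blast
qed

lift_definition uminus_groth :: "'a groth \<Rightarrow> 'a groth" is "\<lambda>x. (snd x, fst x)"
  unfolding groth_rel_def fst_conv snd_conv by (metis add.commute)

definition minus_groth :: "'a groth \<Rightarrow> 'a groth \<Rightarrow> 'a groth"
  where "minus_groth x y = x + - y"

lift_definition times_groth :: "'a groth \<Rightarrow> 'a groth \<Rightarrow> 'a groth"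
  is "\<lambda>x y. (fst x * fst y + snd x * snd y, fst x * snd y + snd x * fst y)"
proof -
  define f :: "'a \<times> 'a \<Rightarrow> 'a \<times> 'a \<Rightarrow> 'a \<times> 'a"
    where "f = (\<lambda>x y. (fst x * fst y + snd x * snd y, fst x * snd y + snd x * fst y))"
  have comm: "f x y = f y x" for x y
    by (simp add: f_def mult.commute add.commute)
  have left: "groth_rel (f x y) (f x' y)" if "groth_rel x x'" for x x' y
  proof -
    from that obtain k where k: "fst x + snd x' + k = fst x' + snd x + k" by (auto simp: groth_rel_def)
    let ?c = "fst y" and ?d = "snd y"
    have "fst (f x y) + snd (f x' y) + (k * ?c + k * ?d) =
      (fst x + snd x' + k) * ?c + (fst x' + snd x + k) * ?d"
      by (simp add: f_def distrib_right add_ac)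
    also have "\<dots> = (fst x' + snd x + k) * ?c + (fst x + snd x' + k) * ?d" by (simp only: k)
    also have "\<dots> = fst (f x' y) + snd (f x y) + (k * ?c + k * ?d)"
      by (simp add: f_def distrib_right add_ac)
    finally show ?thesis unfolding groth_rel_def by blast
  qed
  fix x x' y y' :: "'a \<times> 'a"
  assume x: "groth_rel x x'" and y: "groth_rel y y'"
  have "groth_rel (f x y) (f x' y')"
    using groth_rel_trans[OF left[OF x, of y] left[OF y, of x', unfolded comm[of _ x']]] .
  then show "groth_rel (fst x * fst y + snd x * snd y, fst x * snd y + snd x * fst y)
      (fst x' * fst y' + snd x' * snd y', fst x' * snd y' + snd x' * fst y')"
    by (simp add: f_def)
qed

lemma groth_rel_refl: "x = y \<Longrightarrow> groth_rel x y"
  by (simp add: groth_rel_def)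

instance
proof
  fix a b c :: "'a groth"
  show "a + b + c = a + (b + c)" by transfer (rule groth_rel_refl, simp add: add.assoc)
  show "a + b = b + a" by transfer (rule groth_rel_refl, simp add: add.commute)
  show "0 + a = a" by transfer (rule groth_rel_refl, simp)
  show "- a + a = 0" by transfer (simp add: groth_rel_def add.commute)
  show "a - b = a + - b" by (rule minus_groth_def)
  show "a * b * c = a * (b * c)"
    by transfer (rule groth_rel_refl, simp add: distrib_left distrib_right mult.assoc add_ac)
  show "a * b = b * a" by transfer (rule groth_rel_refl, simp add: mult.commute add.commute)
  show "1 * a = a" by transfer (rule groth_rel_refl, simp)
  show "(a + b) * c = a * c + b * c"
    by transfer (rule groth_rel_refl, simp add: distrib_right add_ac)
qed

end

lift_definition groth_diff :: "'a::{comm_semiring_0, comm_monoid_mult} \<Rightarrow> 'a \<Rightarrow> 'a groth" is Pair .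

lemma groth_diff_add: "groth_diff a b + groth_diff c d = groth_diff (a + c) (b + d)"
  by transfer (rule groth_rel_refl, simp)

lemma groth_diff_uminus: "- groth_diff a b = groth_diff b a"
  by transfer (rule groth_rel_refl, simp)

lemma groth_diff_mult: "groth_diff a b * groth_diff c d = groth_diff (a * c + b * d) (a * d + b * c)"
  by transfer (rule groth_rel_refl, simp)

lemma groth_cases: obtains a b where "x = groth_diff a b"
proof -
  have "x = abs_groth (rep_groth x)" by (rule Quotient3_abs_rep[OF Quotient3_groth, symmetric])
  also have "\<dots> = groth_diff (fst (rep_groth x)) (snd (rep_groth x))" by (simp add: groth_diff.abs_eq)
  finally show ?thesis by (rule that)
qed

text \<open>The differences \<open>[(\<int>\<^sup>n, 0)] - [(\<int>\<^sup>k, 0)]\<close> already form an ideal, see \<open>null_ideal_mult\<close> below.\<close>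

definition null_ideal :: "endo groth set"
  where "null_ideal = {groth_diff (abs_endo (0\<^sub>m n n)) (abs_endo (0\<^sub>m k k)) | n k. True}"

lemma mat_dsum_0: "mat_dsum (0\<^sub>m n n) (0\<^sub>m k k) = 0\<^sub>m (n + k) (n + k)"
  by (rule eq_matI) (auto simp: mat_dsum_index[of _ n _ k])

lemma abs_endo_0_add: "abs_endo (0\<^sub>m n n) + abs_endo (0\<^sub>m k k) = abs_endo (0\<^sub>m (n + k) (n + k))"
  by (simp add: abs_endo_plus[of _ n _ k] mat_dsum_0)

lemma abs_endo_0_mult: "\<exists>k. a * abs_endo (0\<^sub>m n n) = abs_endo (0\<^sub>m k k)"
proof -
  obtain k A where a: "A \<in> carrier_mat k k" "a = abs_endo A" by (rule endo_cases)
  have "mat_kron A (0\<^sub>m n n) = 0\<^sub>m (k * n) (k * n)"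
    by (rule eq_matI) (use a div_mod_less in \<open>auto simp: mat_kron_index[of _ k _ n]\<close>)
  then show ?thesis by (auto simp: a abs_endo_times[of _ k _ n])
qed

lemma null_idealI: "groth_diff (abs_endo (0\<^sub>m n n)) (abs_endo (0\<^sub>m k k)) \<in> null_ideal"
  unfolding null_ideal_def by blast

lemma null_idealE:
  assumes "x \<in> null_ideal"
  obtains n k where "x = groth_diff (abs_endo (0\<^sub>m n n)) (abs_endo (0\<^sub>m k k))"
  using assms unfolding null_ideal_def by blast

lemma null_ideal_0: "0 \<in> null_ideal"
proof -
  have "groth_diff 0 0 = (0 :: endo groth)" by transfer (rule groth_rel_refl, simp)
  then show ?thesis using null_idealI[of 0 0] by (simp add: zero_endo_def)
qed

lemma null_ideal_uminus: "x \<in> null_ideal \<Longrightarrow> - x \<in> null_ideal"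
  by (erule null_idealE) (simp add: groth_diff_uminus null_idealI)

lemma null_ideal_add: "x \<in> null_ideal \<Longrightarrow> y \<in> null_ideal \<Longrightarrow> x + y \<in> null_ideal"
  by (elim null_idealE) (simp add: groth_diff_add abs_endo_0_add null_idealI)

lemma null_ideal_mult:
  assumes "y \<in> null_ideal"
  shows "x * y \<in> null_ideal"
proof -
  obtain a b where x: "x = groth_diff a b" by (rule groth_cases)
  obtain n k where y: "y = groth_diff (abs_endo (0\<^sub>m n n)) (abs_endo (0\<^sub>m k k))"
    using assms by (rule null_idealE)
  obtain i j r s where "a * abs_endo (0\<^sub>m n n) = abs_endo (0\<^sub>m i i)" "b * abs_endo (0\<^sub>m k k) = abs_endo (0\<^sub>m j j)"
    "a * abs_endo (0\<^sub>m k k) = abs_endo (0\<^sub>m r r)" "b * abs_endo (0\<^sub>m n n) = abs_endo (0\<^sub>m s s)"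
    by (metis abs_endo_0_mult)
  then have "x * y = groth_diff (abs_endo (0\<^sub>m (i + j) (i + j))) (abs_endo (0\<^sub>m (r + s) (r + s)))"
    by (simp add: x y groth_diff_mult abs_endo_0_add)
  then show ?thesis by (simp add: null_idealI)
qed

quotient_type W0 = "endo groth" / "\<lambda>x y. x - y \<in> null_ideal"
proof (rule equivpI)
  show "reflp (\<lambda>x y. x - y \<in> null_ideal)" by (rule reflpI) (simp add: null_ideal_0)
  show "symp (\<lambda>x y. x - y \<in> null_ideal)" by (rule sympI) (metis minus_diff_eq null_ideal_uminus)
  show "transp (\<lambda>x y. x - y \<in> null_ideal)" by (rule transpI) (metis diff_add_cancel add_diff_eq null_ideal_add)
qed

instantiation W0 :: "{comm_ring, comm_monoid_mult}"
begin

lift_definition zero_W0 :: W0 is 0 .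
lift_definition one_W0 :: W0 is 1 .
lift_definition plus_W0 :: "W0 \<Rightarrow> W0 \<Rightarrow> W0" is "(+)"
proof -
  fix x x' y y' :: "endo groth"
  assume "x - x' \<in> null_ideal" "y - y' \<in> null_ideal"
  then have "(x - x') + (y - y') \<in> null_ideal" by (rule null_ideal_add)
  then show "x + y - (x' + y') \<in> null_ideal" by (simp only: add_diff_add)
qed
lift_definition uminus_W0 :: "W0 \<Rightarrow> W0" is uminus
proof -
  fix x x' :: "endo groth"
  assume "x - x' \<in> null_ideal"
  then have "- (x - x') \<in> null_ideal" by (rule null_ideal_uminus)
  then show "- x - - x' \<in> null_ideal" by simp
qed
definition minus_W0 :: "W0 \<Rightarrow> W0 \<Rightarrow> W0"
  where "minus_W0 x y = x + - y"
lift_definition times_W0 :: "W0 \<Rightarrow> W0 \<Rightarrow> W0" is "(*)"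
proof -
  fix x x' y y' :: "endo groth"
  assume "x - x' \<in> null_ideal" "y - y' \<in> null_ideal"
  then have "y * (x - x') + x' * (y - y') \<in> null_ideal"
    by (intro null_ideal_add null_ideal_mult)
  moreover have "y * (x - x') + x' * (y - y') = x * y - x' * y'"
    by (simp add: right_diff_distrib mult.commute)
  ultimately show "x * y - x' * y' \<in> null_ideal" by simp
qed

lemma null_ideal_refl: "x = y \<Longrightarrow> x - y \<in> null_ideal"
  by (simp add: null_ideal_0)

instance
proof
  fix a b c :: W0
  show "a + b + c = a + (b + c)" by transfer (rule null_ideal_refl, rule add.assoc)
  show "a + b = b + a" by transfer (rule null_ideal_refl, rule add.commute)
  show "0 + a = a" by transfer (rule null_ideal_refl, simp)
  show "- a + a = 0" by transfer (rule null_ideal_refl, simp)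
  show "a - b = a + - b" by (rule minus_W0_def)
  show "a * b * c = a * (b * c)" by transfer (rule null_ideal_refl, rule mult.assoc)
  show "a * b = b * a" by transfer (rule null_ideal_refl, rule mult.commute)
  show "1 * a = a" by transfer (rule null_ideal_refl, rule mult_1)
  show "(a + b) * c = a * c + b * c" by transfer (rule null_ideal_refl, rule distrib_right)
qed

end

section \<open>The morphism \<open>L\<close>\<close>

definition mat_fps :: "int mat \<Rightarrow> rat fps mat"
  where "mat_fps = map_mat (\<lambda>a. fps_const (of_int a))"

definition rev_char :: "int mat \<Rightarrow> rat fps"
  where "rev_char A = det (1\<^sub>m (dim_row A) - fps_X \<cdot>\<^sub>m mat_fps A)"

definition L_mat :: "int mat \<Rightarrow> witt"
  where "L_mat A = Abs_witt (inverse (rev_char A))"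

lemma comm_ring_hom_const: "comm_ring_hom (\<lambda>a :: int. fps_const (of_int a :: rat))"
  by unfold_locales (simp_all add: fps_const_add[symmetric] fps_const_mult[symmetric] del: fps_const_add fps_const_mult)

lemma mat_fps_carrier [simp]: "mat_fps A \<in> carrier_mat n k \<longleftrightarrow> A \<in> carrier_mat n k"
  by (simp add: mat_fps_def)

lemma mat_fps_mult:
  "A \<in> carrier_mat n n \<Longrightarrow> B \<in> carrier_mat n n \<Longrightarrow> mat_fps (A * B) = mat_fps A * mat_fps B"
proof -
  interpret comm_ring_hom "\<lambda>a :: int. fps_const (of_int a :: rat)" by (rule comm_ring_hom_const)
  show "A \<in> carrier_mat n n \<Longrightarrow> B \<in> carrier_mat n n \<Longrightarrow> mat_fps (A * B) = mat_fps A * mat_fps B"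
    unfolding mat_fps_def by (rule mat_hom_mult)
qed

lemma mat_fps_one: "mat_fps (1\<^sub>m n) = 1\<^sub>m n"
  unfolding mat_fps_def by (rule eq_matI) auto

lemma rev_char_similar:
  assumes "similar_mat A B"
  shows "rev_char A = rev_char B"
proof -
  obtain n P Q where c: "A \<in> carrier_mat n n" "B \<in> carrier_mat n n" "P \<in> carrier_mat n n" "Q \<in> carrier_mat n n"
    and PQ: "P * Q = 1\<^sub>m n" and A: "A = P * B * Q"
    using similar_matD[OF assms] by auto
  define R S T where "R = mat_fps P" and "S = mat_fps Q" and "T = fps_X \<cdot>\<^sub>m mat_fps B"
  have c': "R \<in> carrier_mat n n" "S \<in> carrier_mat n n" "T \<in> carrier_mat n n"
    using c by (simp_all add: R_def S_def T_def)
  have RS: "R * S = 1\<^sub>m n"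
    unfolding R_def S_def mat_fps_mult[OF c(3,4), symmetric] PQ by (rule mat_fps_one)
  have "fps_X \<cdot>\<^sub>m mat_fps A = fps_X \<cdot>\<^sub>m (R * mat_fps B * S)"
    unfolding A R_def S_def mat_fps_mult[OF mult_carrier_mat[OF c(3,2)] c(4)] mat_fps_mult[OF c(3,2)] ..
  also have "\<dots> = R * T * S"
  proof -
    have B: "mat_fps B \<in> carrier_mat n n" using c by simp
    show ?thesis
      unfolding T_def mult_smult_distrib[OF c'(1) B] mult_smult_assoc_mat[OF mult_carrier_mat[OF c'(1) B] c'(2)] ..
  qed
  finally have XA: "fps_X \<cdot>\<^sub>m mat_fps A = R * T * S" .
  have "1\<^sub>m n - R * T * S = R * (1\<^sub>m n - T) * S"
    unfolding mult_minus_distrib_mat[OF c'(1) one_carrier_mat c'(3)] right_mult_one_mat[OF c'(1)]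
      minus_mult_distrib_mat[OF c'(1) mult_carrier_mat[OF c'(1,3)] c'(2)] RS ..
  moreover have "dim_row A = n" "dim_row B = n" using c by auto
  moreover have "det (R * (1\<^sub>m n - T) * S) = det (1\<^sub>m n - T)"
  proof -
    have d: "det R * det S = 1" using det_mult[OF c'(1,2)] RS by simp
    have T1: "1\<^sub>m n - T \<in> carrier_mat n n" using c'(3) by (rule minus_carrier_mat)
    have "det (R * (1\<^sub>m n - T) * S) = det R * det (1\<^sub>m n - T) * det S"
      unfolding det_mult[OF mult_carrier_mat[OF c'(1) T1] c'(2)] det_mult[OF c'(1) T1] ..
    also have "\<dots> = det R * det S * det (1\<^sub>m n - T)" by (simp only: mult_ac)
    finally show ?thesis by (simp only: d mult_1_left)
  qed
  ultimately show ?thesis by (simp only: rev_char_def XA T_def)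
qed

lemma rev_char_dsum:
  assumes A: "A \<in> carrier_mat n n" and B: "B \<in> carrier_mat k k"
  shows "rev_char (mat_dsum A B) = rev_char A * rev_char B"
proof -
  have d: "dim_row A = n" "dim_row B = k" "dim_col A = n" "dim_col B = k" using A B by auto
  have "1\<^sub>m (n + k) - fps_X \<cdot>\<^sub>m mat_fps (mat_dsum A B) =
    four_block_mat (1\<^sub>m n - fps_X \<cdot>\<^sub>m mat_fps A) (0\<^sub>m n k) (0\<^sub>m k n) (1\<^sub>m k - fps_X \<cdot>\<^sub>m mat_fps B)" (is "?L = ?R")
  proof (rule eq_matI)
    fix i j assume "i < dim_row ?R" "j < dim_col ?R"
    then have ij: "i < n + k" "j < n + k" by (simp_all add: mat_fps_def d)
    then show "?L $$ (i, j) = ?R $$ (i, j)"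
      by (auto simp: mat_fps_def d mat_dsum_index[OF A B ij])
  qed (simp_all add: mat_fps_def d)
  moreover have "1\<^sub>m n - fps_X \<cdot>\<^sub>m mat_fps A \<in> carrier_mat n n" "1\<^sub>m k - fps_X \<cdot>\<^sub>m mat_fps B \<in> carrier_mat k k"
    using A B by (auto intro!: minus_carrier_mat)
  ultimately show ?thesis
    by (simp add: rev_char_def d det_four_block_mat_upper_right_zero[of _ n _ k])
qed

lemma rev_char_zero: "rev_char (0\<^sub>m n n) = 1"
proof -
  have "1\<^sub>m n - fps_X \<cdot>\<^sub>m mat_fps (0\<^sub>m n n) = 1\<^sub>m n"
    by (rule eq_matI) (auto simp: mat_fps_def)
  then show ?thesis by (simp add: rev_char_def)
qed

lemma rev_char_nth_0:
  assumes A: "A \<in> carrier_mat n n"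
  shows "fps_nth (rev_char A) 0 = 1"
proof -
  interpret h: comm_ring_hom "\<lambda>P :: rat fps. fps_nth P 0"
    by unfold_locales simp_all
  have d: "dim_row A = n" "dim_col A = n" using A by auto
  have "map_mat (\<lambda>P. fps_nth P 0) (1\<^sub>m n - fps_X \<cdot>\<^sub>m mat_fps A) = 1\<^sub>m n"
    by (rule eq_matI) (auto simp: mat_fps_def d)
  then show ?thesis
    using h.hom_det[of "1\<^sub>m n - fps_X \<cdot>\<^sub>m mat_fps A"] by (simp add: rev_char_def d)
qed

lemma witt_fps_L_mat: "A \<in> carrier_mat n n \<Longrightarrow> witt_fps (L_mat A) = inverse (rev_char A)"
  unfolding L_mat_def by (rule Abs_witt_inverse) (simp add: rev_char_nth_0)

lift_definition L_endo :: "endo \<Rightarrow> witt" is L_mat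
  by (simp add: L_mat_def rev_char_similar)

lemma L_endo_add: "L_endo (a + b) = L_endo a + L_endo b"
proof -
  obtain n A where a: "A \<in> carrier_mat n n" "a = abs_endo A" by (rule endo_cases)
  obtain k B where b: "B \<in> carrier_mat k k" "b = abs_endo B" by (rule endo_cases)
  have L: "L_endo (abs_endo C) = L_mat C" if "C \<in> carrier_mat l l" for C l
    using that by (intro L_endo.abs_eq similar_mat_refl)
  have "witt_fps (L_mat (mat_dsum A B)) = witt_fps (L_mat A + L_mat B)"
    unfolding plus_witt.rep_eq witt_fps_L_mat[OF a(1)] witt_fps_L_mat[OF b(1)]
      witt_fps_L_mat[OF mat_dsum_carrier[OF a(1) b(1)]] rev_char_dsum[OF a(1) b(1)]
    by (rule fps_inverse_mult)
  then show ?thesis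
    unfolding a(2) b(2) abs_endo_plus[OF a(1) b(1)] L[OF a(1)] L[OF b(1)] L[OF mat_dsum_carrier[OF a(1) b(1)]]
    by (simp only: witt_fps_inject)
qed

lemma L_endo_zero: "L_endo (abs_endo (0\<^sub>m n n)) = 0"
proof -
  have "L_endo (abs_endo (0\<^sub>m n n)) = L_mat (0\<^sub>m n n)"
    by (intro L_endo.abs_eq similar_mat_refl[of _ n]) simp
  moreover have "witt_fps (L_mat (0\<^sub>m n n)) = witt_fps 0"
    by (simp add: witt_fps_L_mat[of _ n] rev_char_zero zero_witt.rep_eq)
  ultimately show ?thesis by (simp add: witt_fps_inject)
qed

lemma groth_ext_wf:
  fixes f :: "'a::comm_monoid_add \<Rightarrow> 'b::ab_group_add"
  assumes f: "\<And>a b. f (a + b) = f a + f b" and xy: "groth_rel x y"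
  shows "f (fst x) - f (snd x) = f (fst y) - f (snd y)"
proof -
  obtain k where "fst x + snd y + k = fst y + snd x + k" using xy by (auto simp: groth_rel_def)
  then have "f (fst x) + f (snd y) + f k = f (fst y) + f (snd x) + f k" by (metis f)
  then have "f (fst x) + f (snd y) = f (fst y) + f (snd x)" by (simp only: add_right_cancel)
  then show ?thesis by (simp only: diff_eq_eq diff_add_eq eq_diff_eq)
qed

lift_definition L_groth :: "endo groth \<Rightarrow> witt" is "\<lambda>x. L_endo (fst x) - L_endo (snd x)"
  by (rule groth_ext_wf[OF L_endo_add])

lemma L_groth_add: "L_groth (x + y) = L_groth x + L_groth y"
  by transfer (simp add: L_endo_add add_diff_add)

lemma L_groth_null: "x \<in> null_ideal \<Longrightarrow> L_groth x = 0"
  by (erule null_idealE) (simp add: groth_diff.abs_eq L_groth.abs_eq L_endo_zero)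

lift_definition L_Z :: "W0 \<Rightarrow> witt" is L_groth
proof -
  fix x y assume "x - y \<in> null_ideal"
  then have "L_groth ((x - y) + y) = L_groth y" by (simp only: L_groth_add L_groth_null add_0)
  then show "L_groth x = L_groth y" by simp
qed

text \<open>The class of \<open>(\<int>\<^sup>n, f)\<close> for the square matrix \<open>M\<^sub>f\<close>.\<close>

definition W0_of :: "int mat \<Rightarrow> W0"
  where "W0_of A = abs_W0 (groth_diff (abs_endo A) 0)"

lemma L_Z_W0_of:
  assumes A: "A \<in> carrier_mat n n"
  shows "L_Z (W0_of A) = L_mat A"
proof -
  have "L_endo 0 = 0" using L_endo_zero[of 0] by (simp add: zero_endo_def)
  moreover have "L_endo (abs_endo A) = L_mat A" using A by (intro L_endo.abs_eq similar_mat_refl)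
  ultimately show ?thesis by (simp add: W0_of_def L_Z.abs_eq groth_diff.abs_eq L_groth.abs_eq)
qed

lemma W0_cases:
  obtains n A k B where "A \<in> carrier_mat n n" "B \<in> carrier_mat k k" "x = W0_of A - W0_of B"
proof -
  have "x = abs_W0 (rep_W0 x)" by (rule Quotient3_abs_rep[OF Quotient3_W0, symmetric])
  moreover obtain a b where ab: "rep_W0 x = groth_diff a b" by (rule groth_cases)
  obtain n A where a: "A \<in> carrier_mat n n" "a = abs_endo A" by (rule endo_cases)
  obtain k B where b: "B \<in> carrier_mat k k" "b = abs_endo B" by (rule endo_cases)
  have "W0_of A - W0_of B = abs_W0 (groth_diff a b)"
    by (simp add: minus_W0_def W0_of_def a b uminus_W0.abs_eq plus_W0.abs_eq groth_diff_uminus groth_diff_add)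
  ultimately show ?thesis using that a b ab by simp
qed

subsection \<open>Integrality\<close>

lemma rev_char_int:
  assumes A: "A \<in> carrier_mat n n"
  shows "fps_nth (rev_char A) i \<in> \<int>"
proof -
  define h where "h = (\<lambda>F :: int fps. Abs_fps (\<lambda>i. of_int (fps_nth F i) :: rat))"
  interpret h: comm_ring_hom h
    by unfold_locales (simp_all add: h_def fps_eq_iff fps_mult_nth)
  have d: "dim_row A = n" "dim_col A = n" using A by auto
  let ?M = "1\<^sub>m n - fps_X \<cdot>\<^sub>m map_mat (fps_const :: int \<Rightarrow> int fps) A"
  have c: "h (fps_const a) = fps_const (of_int a)" for a by (simp add: h_def fps_eq_iff)
  have X: "h fps_X = fps_X" by (simp add: h_def fps_eq_iff)
  have "1\<^sub>m n - fps_X \<cdot>\<^sub>m mat_fps A = map_mat h ?M"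
    by (rule eq_matI) (simp_all add: mat_fps_def d h.hom_minus h.hom_mult c X)
  then have "rev_char A = h (det ?M)" by (simp only: rev_char_def d h.hom_det)
  then show ?thesis by (simp add: h_def)
qed

lemma fps_inverse_int:
  fixes P :: "rat fps"
  assumes 0: "fps_nth P 0 = 1" and P: "\<And>i. fps_nth P i \<in> \<int>"
  shows "fps_nth (inverse P) n \<in> \<int>"
proof (induction n rule: less_induct)
  case (less n)
  show ?case
  proof (cases n)
    case 0
    then show ?thesis using assms by simp
  next
    case (Suc k)
    have "inverse P * P = 1" using assms by (intro inverse_mult_eq_1) simp
    then have "0 = fps_nth (inverse P * P) n" by (simp add: Suc)
    also have "\<dots> = (\<Sum>i\<le>k. fps_nth (inverse P) i * fps_nth P (n - i)) + fps_nth (inverse P) n"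
      by (simp add: fps_mult_nth atMost_atLeast0 Suc 0)
    finally have "fps_nth (inverse P) n = - (\<Sum>i\<le>k. fps_nth (inverse P) i * fps_nth P (n - i))"
      by (simp add: eq_neg_iff_add_eq_0 add.commute)
    also have "\<dots> \<in> \<int>" using less P by (intro Ints_minus Ints_sum Ints_mult) (auto simp: Suc)
    finally show ?thesis .
  qed
qed

lemma witt_int_diff: "P \<in> witt_int \<Longrightarrow> Q \<in> witt_int \<Longrightarrow> P - Q \<in> witt_int"
  unfolding witt_int_def minus_witt.rep_eq fps_mult_nth mem_Collect_eq
  by (intro allI Ints_sum Ints_mult fps_inverse_int) auto

lemma L_mat_int: "A \<in> carrier_mat n n \<Longrightarrow> L_mat A \<in> witt_int"
  by (simp add: witt_int_def witt_fps_L_mat fps_inverse_int rev_char_nth_0 rev_char_int)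

lemma L_Z_int: "L_Z x \<in> witt_int"
proof -
  obtain n A k B where AB: "A \<in> carrier_mat n n" "B \<in> carrier_mat k k" "x = W0_of A - W0_of B"
    by (rule W0_cases)
  have add: "L_Z (x + y) = L_Z x + L_Z y" for x y by transfer (rule L_groth_add)
  have "L_Z x + L_Z (W0_of B) = L_Z (W0_of A)"
    unfolding add[symmetric] AB(3) by simp
  then have "L_Z x = L_mat A - L_mat B" by (simp add: L_Z_W0_of[OF AB(1)] L_Z_W0_of[OF AB(2)] eq_diff_eq)
  then show ?thesis using L_mat_int AB witt_int_diff by simp
qed


section \<open>The ghost morphism \<open>gh\<^sub>0\<close>\<close>

lemma mat_trace_mult_commute:
  fixes A B :: "'a::comm_ring_1 mat"
  assumes A: "A \<in> carrier_mat n n" and B: "B \<in> carrier_mat n n"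
  shows "mat_trace (A * B) = mat_trace (B * A)"
proof -
  have d: "dim_row (A * B) = n" "dim_row (B * A) = n" using A B by auto
  have "mat_trace (A * B) = (\<Sum>i<n. \<Sum>k<n. A $$ (i, k) * B $$ (k, i))"
    unfolding mat_trace_def d by (intro sum.cong refl) (simp only: lessThan_iff mat_mult_index[OF A B])
  also have "\<dots> = (\<Sum>k<n. \<Sum>i<n. B $$ (k, i) * A $$ (i, k))"
    by (subst sum.swap) (simp only: mult.commute)
  also have "\<dots> = mat_trace (B * A)"
    unfolding mat_trace_def d by (intro sum.cong refl) (simp only: lessThan_iff mat_mult_index[OF B A])
  finally show ?thesis .
qed

lemma mat_trace_similar:
  fixes A B :: "'a::comm_ring_1 mat"
  assumes "similar_mat A B"
  shows "mat_trace A = mat_trace B"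
proof -
  obtain n P Q where c: "A \<in> carrier_mat n n" "B \<in> carrier_mat n n" "P \<in> carrier_mat n n" "Q \<in> carrier_mat n n"
    and QP: "Q * P = 1\<^sub>m n" and A: "A = P * B * Q"
    using similar_matD[OF assms] by auto
  have "mat_trace A = mat_trace (Q * (P * B))"
    unfolding A by (rule mat_trace_mult_commute[OF mult_carrier_mat[OF c(3,2)] c(4)])
  also have "Q * (P * B) = B"
    unfolding assoc_mult_mat[OF c(4,3,2), symmetric] QP by (rule left_mult_one_mat[OF c(2)])
  finally show ?thesis .
qed

lemma similar_mat_pow: "similar_mat A B \<Longrightarrow> similar_mat (A ^\<^sub>m k) (B ^\<^sub>m k)"
  unfolding similar_mat_def using similar_mat_wit_pow by blast

lemma mat_trace_linrec:
  fixes A :: "int mat"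
  assumes A: "A \<in> carrier_mat n n"
  shows "(\<lambda>k. mat_trace (A ^\<^sub>m Suc k)) \<in> linrec_seqs"
proof -
  have pow: "A ^\<^sub>m k \<in> carrier_mat n n" for k using A by simp
  have entry: "(\<lambda>k. (A ^\<^sub>m Suc k) $$ (i, i)) \<in> linrec_seqs" if i: "i < n" for i
  proof -
    define v where "v = (\<lambda>j k. (A ^\<^sub>m Suc k) $$ (i, j))"
    have "v j (Suc k) = (\<Sum>l<n. A $$ (l, j) * v l k)" if j: "j < n" for j k
      unfolding v_def pow_mat.simps(2)[of A "Suc k"] mat_mult_index[OF pow A i j]
      by (simp only: mult.commute)
    then have "\<exists>p. monic p \<and> (\<forall>j<n. \<forall>k. rec_act p (v j) k = 0)"
      by (rule linrec_system[of n v "\<lambda>j l. A $$ (l, j)"]) auto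
    then show ?thesis using i unfolding linrec_seqs_iff v_def by blast
  qed
  have "(\<lambda>k. \<Sum>i<N. (A ^\<^sub>m Suc k) $$ (i, i)) \<in> linrec_seqs" if "N \<le> n" for N
    using that
  proof (induction N)
    case 0
    then show ?case using linrec_seqs_0 by (simp only: lessThan_0 sum.empty)
  next
    case (Suc N)
    then have "(\<lambda>k. (\<Sum>i<N. (A ^\<^sub>m Suc k) $$ (i, i)) + (A ^\<^sub>m Suc k) $$ (N, N)) \<in> linrec_seqs"
      by (intro linrec_seqs_add entry) simp_all
    then show ?case by (simp only: sum.lessThan_Suc)
  qed
  moreover have "dim_row (A ^\<^sub>m Suc k) = n" for k using pow[of "Suc k"] by (rule carrier_matD)
  ultimately show ?thesis unfolding mat_trace_def by simp
qed

definition gh0_mat :: "int mat \<Rightarrow> linrec"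
  where "gh0_mat A = Abs_linrec (\<lambda>k. mat_trace (A ^\<^sub>m Suc k))"

lemma linrec_nth_gh0_mat: "A \<in> carrier_mat n n \<Longrightarrow> linrec_nth (gh0_mat A) k = mat_trace (A ^\<^sub>m Suc k)"
  unfolding gh0_mat_def by (simp only: Abs_linrec_inverse mat_trace_linrec)

lift_definition gh0_endo :: "endo \<Rightarrow> linrec" is gh0_mat
proof -
  fix A B :: "int mat" assume "similar_mat A B"
  then have "mat_trace (A ^\<^sub>m Suc k) = mat_trace (B ^\<^sub>m Suc k)" for k
    by (intro mat_trace_similar similar_mat_pow)
  then show "gh0_mat A = gh0_mat B" by (simp only: gh0_mat_def)
qed

lemma gh0_endo_abs: "A \<in> carrier_mat n n \<Longrightarrow> gh0_endo (abs_endo A) = gh0_mat A"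
  by (intro gh0_endo.abs_eq similar_mat_refl)

lemma mat_trace_dsum:
  assumes A: "A \<in> carrier_mat n n" and B: "B \<in> carrier_mat k k"
  shows "mat_trace (mat_dsum A B) = mat_trace A + mat_trace B"
proof -
  have d: "dim_row A = n" "dim_row B = k" using A B by auto
  have u: "{..<n + k} = {..<n} \<union> {n..<n + k}" by auto
  have "mat_trace (mat_dsum A B) = (\<Sum>i<n. mat_dsum A B $$ (i, i)) + (\<Sum>i=n..<n + k. mat_dsum A B $$ (i, i))"
    unfolding mat_trace_def mat_dsum_dim d u by (rule sum.union_disjoint) auto
  also have "(\<Sum>i=n..<n + k. mat_dsum A B $$ (i, i)) = (\<Sum>i<k. mat_dsum A B $$ (i + n, i + n))"
    using sum.shift_bounds_nat_ivl[of "\<lambda>i. mat_dsum A B $$ (i, i)" 0 n k] by (simp add: atLeast0LessThan add.commute)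
  finally show ?thesis
    by (simp add: mat_trace_def d mat_dsum_index[OF A B])
qed

lemma mat_dsum_pow:
  assumes A: "A \<in> carrier_mat n n" and B: "B \<in> carrier_mat k k"
  shows "mat_dsum A B ^\<^sub>m l = mat_dsum (A ^\<^sub>m l) (B ^\<^sub>m l)"
  using pow_four_block_mat[OF A B, of l] A B pow_carrier_mat[OF A, of l] pow_carrier_mat[OF B, of l]
  by (simp add: mat_dsum_def)

lemma gh0_endo_add: "gh0_endo (a + b) = gh0_endo a + gh0_endo b"
proof -
  obtain n A where a: "A \<in> carrier_mat n n" "a = abs_endo A" by (rule endo_cases)
  obtain k B where b: "B \<in> carrier_mat k k" "b = abs_endo B" by (rule endo_cases)
  note AB = mat_dsum_carrier[OF a(1) b(1)]
  show ?thesis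
    unfolding a(2) b(2) abs_endo_plus[OF a(1) b(1)] gh0_endo_abs[OF a(1)] gh0_endo_abs[OF b(1)] gh0_endo_abs[OF AB]
    by (intro linrec_eqI)
      (simp only: linrec_nth_simps linrec_nth_gh0_mat[OF a(1)] linrec_nth_gh0_mat[OF b(1)] linrec_nth_gh0_mat[OF AB]
        mat_dsum_pow[OF a(1) b(1)] mat_trace_dsum[OF pow_carrier_mat[OF a(1)] pow_carrier_mat[OF b(1)]])
qed

lemma mat_trace_kron:
  fixes A B :: "'a::comm_ring_1 mat"
  assumes A: "A \<in> carrier_mat n n" and B: "B \<in> carrier_mat k k"
  shows "mat_trace (mat_kron A B) = mat_trace A * mat_trace B"
proof -
  have d: "dim_row A = n" "dim_row B = k" using A B by auto
  have "mat_trace (mat_kron A B) = (\<Sum>i<n * k. A $$ (i div k, i div k) * B $$ (i mod k, i mod k))"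
    unfolding mat_trace_def mat_kron_dim d by (intro sum.cong refl) (simp only: lessThan_iff mat_kron_index[OF A B])
  also have "\<dots> = (\<Sum>i<n. \<Sum>j<k. A $$ (i, i) * B $$ (j, j))"
    by (rule sum_div_mod)
  finally show ?thesis by (simp only: mat_trace_def d sum_product)
qed

lemma mat_kron_pow:
  fixes A B :: "'a::comm_ring_1 mat"
  assumes A: "A \<in> carrier_mat n n" and B: "B \<in> carrier_mat k k"
  shows "mat_kron A B ^\<^sub>m l = mat_kron (A ^\<^sub>m l) (B ^\<^sub>m l)"
proof (induction l)
  case 0
  have "dim_row A = n" "dim_row B = k" using A B by auto
  then show ?case by (simp only: pow_mat.simps(1) mat_kron_dim mat_kron_one)
next
  case (Suc l)
  then show ?case
    by (simp only: pow_mat.simps(2) mat_kron_mult[OF pow_carrier_mat[OF A] pow_carrier_mat[OF B] A B])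
qed

lemma gh0_endo_mult: "gh0_endo (a * b) = gh0_endo a * gh0_endo b"
proof -
  obtain n A where a: "A \<in> carrier_mat n n" "a = abs_endo A" by (rule endo_cases)
  obtain k B where b: "B \<in> carrier_mat k k" "b = abs_endo B" by (rule endo_cases)
  note AB = mat_kron_carrier[OF a(1) b(1)]
  show ?thesis
    unfolding a(2) b(2) abs_endo_times[OF a(1) b(1)] gh0_endo_abs[OF a(1)] gh0_endo_abs[OF b(1)] gh0_endo_abs[OF AB]
    by (intro linrec_eqI)
      (simp only: linrec_nth_simps linrec_nth_gh0_mat[OF a(1)] linrec_nth_gh0_mat[OF b(1)] linrec_nth_gh0_mat[OF AB]
        mat_kron_pow[OF a(1) b(1)] mat_trace_kron[OF pow_carrier_mat[OF a(1)] pow_carrier_mat[OF b(1)]])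
qed

lemma gh0_endo_zero: "gh0_endo (abs_endo (0\<^sub>m n n)) = 0"
proof -
  have "(0\<^sub>m n n :: int mat) ^\<^sub>m Suc k = 0\<^sub>m n n" for k
    by (simp add: right_mult_zero_mat[of _ n n])
  then have "mat_trace ((0\<^sub>m n n :: int mat) ^\<^sub>m Suc k) = 0" for k
    by (simp only: mat_trace_def) simp
  then show ?thesis
    unfolding gh0_endo_abs[OF zero_carrier_mat]
    by (intro linrec_eqI) (simp only: linrec_nth_gh0_mat[OF zero_carrier_mat] linrec_nth_simps)
qed

lemma gh0_endo_one: "gh0_endo 1 = 1"
proof -
  have "(1\<^sub>m 1 :: int mat) ^\<^sub>m k = 1\<^sub>m 1" for k
    by (induction k) simp_all
  then show ?thesis
    unfolding one_endo_def gh0_endo_abs[OF one_carrier_mat]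
    by (intro linrec_eqI) (simp only: linrec_nth_gh0_mat[OF one_carrier_mat] linrec_nth_simps, simp add: mat_trace_def)
qed

lift_definition gh0_groth :: "endo groth \<Rightarrow> linrec" is "\<lambda>x. gh0_endo (fst x) - gh0_endo (snd x)"
  by (rule groth_ext_wf[OF gh0_endo_add])

lemma gh0_groth_add: "gh0_groth (x + y) = gh0_groth x + gh0_groth y"
  by transfer (simp add: gh0_endo_add add_diff_add)

lemma gh0_endo_0: "gh0_endo 0 = 0"
  using gh0_endo_zero[of 0] by (simp add: zero_endo_def)

lemma ring_morphism_gh0_groth: "ring_morphism gh0_groth"
proof (rule ring_morphismI[OF gh0_groth_add])
  show "gh0_groth 1 = 1" by transfer (simp add: gh0_endo_0 gh0_endo_one)
  show "gh0_groth (x * y) = gh0_groth x * gh0_groth y" for x y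
    by transfer (simp add: gh0_endo_add gh0_endo_mult left_diff_distrib right_diff_distrib)
qed

lemma gh0_groth_null: "x \<in> null_ideal \<Longrightarrow> gh0_groth x = 0"
  by (erule null_idealE) (simp add: groth_diff.abs_eq gh0_groth.abs_eq gh0_endo_zero)

lift_definition gh0 :: "W0 \<Rightarrow> linrec" is gh0_groth
proof -
  fix x y assume "x - y \<in> null_ideal"
  then have "gh0_groth ((x - y) + y) = gh0_groth y" by (simp only: gh0_groth_add gh0_groth_null add_0)
  then show "gh0_groth x = gh0_groth y" by simp
qed

lemma ring_morphism_gh0: "ring_morphism gh0"
  by (rule ring_morphismI; transfer) (simp_all add: ring_morphismD[OF ring_morphism_gh0_groth])

lemma linrec_nth_gh0_W0_of:
  assumes A: "A \<in> carrier_mat n n"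
  shows "linrec_nth (gh0 (W0_of A)) k = mat_trace (A ^\<^sub>m Suc k)"
proof -
  have "gh0 (W0_of A) = gh0_mat A"
    by (simp add: W0_of_def gh0.abs_eq groth_diff.abs_eq gh0_groth.abs_eq gh0_endo_0 gh0_endo_abs[OF A])
  then show ?thesis by (simp only: linrec_nth_gh0_mat[OF A])
qed


section \<open>Motivic measures and biring morphisms\<close>

definition linrec_incl :: "linrec \<Rightarrow> nat \<Rightarrow> rat"
  where "linrec_incl f = (\<lambda>n. of_int (linrec_nth f n))"

text \<open>
  The correspondence sends \<open>c\<close> to \<open>a \<mapsto> c(a)\<^sub>1\<close>: sequences are indexed from \<open>0\<close>, so this is the second
  component, the value of the functional \<open>c(a)\<close> at \<open>t\<close>.
\<close>

definition biring_corr :: "('a \<Rightarrow> linrec) \<Rightarrow> 'a \<Rightarrow> int"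
  where "biring_corr c = (\<lambda>a. linrec_nth (c a) 1)"

text \<open>The ring morphism \<open>\<int>[T] \<rightarrow> \<int>\<close> with \<open>T \<mapsto> k\<close>.\<close>

definition motivic_measure :: "int \<Rightarrow> int poly \<Rightarrow> int"
  where "motivic_measure k p = poly p k"

end

theory Submission
  imports Defs "HOL-Computational_Algebra.Primes"
begin

text \<open>
  A biring morphism into the linear recursive sequences sends the primitive element \<open>D = T - m\<close> to an
  additive sequence \<open>n \<mapsto> n k\<close>, so it is \<open>p \<mapsto> (p(m + n k))\<^sub>n\<close> with \<open>k\<close> the value at \<open>D\<close> of the
  corresponding measure. For \<open>\<mu>\<^bsub>2m\<^esub>\<close> this gives \<open>k = m\<close> and the sequence \<open>p(m(n + 1))\<close>, the ghost
  components of the zeta function. The ghost components of \<open>det(1 - tA)\<^sup>-\<^sup>1\<close> are the traces of the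
  powers of \<open>A\<close> by Jacobi's formula for the derivative of a determinant. Finally \<open>L\<close> takes integral
  values, whereas \<open>\<zeta>(T) = exp(m t/(1 - t))\<close> has a denominator \<open>p\<close> at \<open>t\<^sup>p\<close> for every prime \<open>p > m\<close>.
\<close>

section \<open>Ring morphisms into the linear recursive sequences\<close>

text \<open>The annihilating polynomial is \<open>(t - 1)^2\<close>: second differences of an
  arithmetic progression vanish.\<close>

lemma linear_seq_linrec: "(\<lambda>n. b + int n * k) \<in> linrec_seqs"
proof -
  have "rec_act [:1, -2, 1:] (\<lambda>n. b + int n * k) n = 0" for n
    by (simp add: rec_act_pCons algebra_simps)
  then show ?thesis
    unfolding linrec_seqs_iff by (intro exI[of _ "[:1, -2, 1:]"]) simp
qed

text \<open>Horner's scheme builds the sequence from arithmetic progressions by sums and Hadamard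
  products, under which \<open>linrec_seqs\<close> is closed.\<close>

lemma poly_linear_seq_linrec: "(\<lambda>n. poly p (b + int n * k)) \<in> linrec_seqs"
proof (induction p)
  case 0
  then show ?case using linrec_seqs_0 by simp
next
  case (pCons a p)
  have "(\<lambda>n. a + (b + int n * k) * poly p (b + int n * k)) \<in> linrec_seqs"
    using linrec_seqs_add[OF linear_seq_linrec[of a 0] linrec_seqs_mult[OF linear_seq_linrec pCons.IH]]
    by simp
  then show ?case by simp
qed

text \<open>For \<open>b = m\<close>, entry 0 is the counit and entry 1 is evaluation at
  \<open>m + k\<close>, so \<open>k\<close> is the value at D of the associated measure.\<close>

definition poly_seq :: "int \<Rightarrow> int \<Rightarrow> int poly \<Rightarrow> linrec"
  where "poly_seq b k p = Abs_linrec (\<lambda>n. poly p (b + int n * k))"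

lemma linrec_nth_poly_seq: "linrec_nth (poly_seq b k p) n = poly p (b + int n * k)"
  unfolding poly_seq_def by (simp add: Abs_linrec_inverse poly_linear_seq_linrec)

lemma linrec_nth_poly_seq_lie_gen: "linrec_nth (poly_seq (int m) k (lie_gen m)) n = int n * k"
  by (simp add: linrec_nth_poly_seq lie_gen_def)

lemma ring_morphism_poly_seq: "ring_morphism (poly_seq b k)"
  by (rule ring_morphismI; rule linrec_eqI) (simp_all add: linrec_nth_poly_seq)

section \<open>Biring morphisms determined by their value at D\<close>

lemma tensor_map_lie_comult_gen:
  fixes c :: "int poly \<Rightarrow> 'a::{comm_ring, comm_monoid_mult}"
  assumes "ring_morphism c"
  shows "tensor_map c c (lie_comult m (lie_gen m)) = c (lie_gen m) \<otimes>\<^sub>Z 1 + 1 \<otimes>\<^sub>Z c (lie_gen m)"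
  using assms
  by (simp add: lie_comult_gen ring_morphismD ring_morphismD(1)[OF ring_morphism_tensor_map[OF assms assms]]
      tensor_map_tens)

text \<open>Compatibility with the comultiplications is an equality of ring morphisms, so it is
  checked at D, where the pairings read \<open>(i + j) * k = i * k + j * k\<close>.\<close>

lemma poly_seq_biring_hom:
  "poly_seq (int m) k \<in> biring_homs (lie_comult m) (lie_counit m) linrec_comult linrec_counit"
proof -
  let ?c = "poly_seq (int m) k"
  note c = ring_morphism_poly_seq[of "int m" k]
  have "linrec_comult (?c (lie_gen m)) = tensor_map ?c ?c (lie_comult m (lie_gen m))"
    by (rule linrec_pair_eqI)
      (simp add: tensor_map_lie_comult_gen[OF c] linrec_pair_add linrec_nth_poly_seq_lie_gen distrib_right)
  then have "(\<lambda>a. linrec_comult (?c a)) = (\<lambda>a. tensor_map ?c ?c (lie_comult m a))"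
    by (rule ring_morphism_lie_eqI[OF ring_morphism_comp[OF ring_morphism_linrec_comult c]
          ring_morphism_comp[OF ring_morphism_tensor_map[OF c c] ring_morphism_lie_comult]])
  moreover have "linrec_counit (?c a) = lie_counit m a" for a
    by (simp add: linrec_counit_def lie_counit_def linrec_nth_poly_seq)
  ultimately show ?thesis
    using c by (auto simp: biring_homs_def dest: fun_cong)
qed

lemma biring_hom_eq_poly_seq:
  assumes "c \<in> biring_homs (lie_comult m) (lie_counit m) linrec_comult linrec_counit"
  shows "c = poly_seq (int m) (biring_corr c (lie_gen m))"
proof -
  have c: "ring_morphism c" and comult: "\<And>a. linrec_comult (c a) = tensor_map c c (lie_comult m a)"
    using assms by (auto simp: biring_homs_def)
  define h where "h = linrec_nth (c (lie_gen m))"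
  have "linrec_comult (c (lie_gen m)) = c (lie_gen m) \<otimes>\<^sub>Z 1 + 1 \<otimes>\<^sub>Z c (lie_gen m)"
    unfolding comult by (rule tensor_map_lie_comult_gen[OF c])
  \<comment> \<open>Pairing with t^i and t^j turns primitivity of c(D) into Cauchy's equation, since
    the unit is the constant sequence 1.\<close>
  from arg_cong[OF this, of "\<lambda>x. linrec_pair x i j" for i j]
  have add: "h (i + j) = h i + h j" for i j
    by (simp add: linrec_pair_add h_def)
  have h: "h n = int n * h 1" for n
  proof (induction n)
    case 0
    then show ?case using add[of 0 0] by simp
  next
    case (Suc n)
    then show ?case using add[of n 1] by (simp add: algebra_simps)
  qed
  have "c (lie_gen m) = poly_seq (int m) (h 1) (lie_gen m)"
    by (rule linrec_eqI, unfold linrec_nth_poly_seq_lie_gen, fold h_def) (rule h)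
  then show ?thesis
    using ring_morphism_lie_eqI[OF c ring_morphism_poly_seq] by (simp add: h_def biring_corr_def)
qed

lemma biring_corr_ring_morphism: "ring_morphism c \<Longrightarrow> ring_morphism (biring_corr c)"
  by (rule ring_morphismI) (simp_all add: biring_corr_def ring_morphismD)

lemma bij_betw_biring_corr:
  "bij_betw biring_corr (biring_homs (lie_comult m) (lie_counit m) linrec_comult linrec_counit)
    {\<phi>. ring_morphism \<phi>}"
proof (rule bij_betwI[of _ _ _ "\<lambda>\<phi>. poly_seq (int m) (\<phi> (lie_gen m))"])
  let ?H = "biring_homs (lie_comult m) (lie_counit m) linrec_comult linrec_counit"
  show "biring_corr \<in> ?H \<rightarrow> {\<phi>. ring_morphism \<phi>}"
    by (auto simp: biring_homs_def intro: biring_corr_ring_morphism)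
  show "(\<lambda>\<phi>. poly_seq (int m) (\<phi> (lie_gen m))) \<in> {\<phi>. ring_morphism \<phi>} \<rightarrow> ?H"
    by (simp add: poly_seq_biring_hom)
  show "poly_seq (int m) (biring_corr c (lie_gen m)) = c" if "c \<in> ?H" for c
    using biring_hom_eq_poly_seq[OF that] by simp
  fix \<phi> :: "int poly \<Rightarrow> int"
  assume "\<phi> \<in> {\<phi>. ring_morphism \<phi>}"
  then show "biring_corr (poly_seq (int m) (\<phi> (lie_gen m))) = \<phi>"
    by (intro ring_morphism_lie_eqI[of _ _ m] biring_corr_ring_morphism ring_morphism_poly_seq)
      (simp_all add: biring_corr_def linrec_nth_poly_seq_lie_gen)
qed


section \<open>Jacobi's formula and the ghost components of \<open>L\<close>\<close>

text \<open>The factor is differentiated in place so that, inside a determinant, each summand is a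
  permutation product of a matrix with one row differentiated.\<close>

lemma fps_deriv_prod:
  fixes f :: "'i \<Rightarrow> 'a::comm_ring_1 fps"
  assumes "finite S"
  shows "fps_deriv (\<Prod>i\<in>S. f i) = (\<Sum>k\<in>S. \<Prod>i\<in>S. if i = k then fps_deriv (f i) else f i)"
  using assms
proof (induction S)
  case (insert x S)
  have 1: "(\<Prod>i\<in>S. if i = x then fps_deriv (f i) else f i) = (\<Prod>i\<in>S. f i)"
    using insert.hyps by (intro prod.cong) auto
  have 2: "(\<Sum>k\<in>S. (if x = k then fps_deriv (f x) else f x) * (\<Prod>i\<in>S. if i = k then fps_deriv (f i) else f i))
    = (\<Sum>k\<in>S. f x * (\<Prod>i\<in>S. if i = k then fps_deriv (f i) else f i))"
    using insert.hyps by (intro sum.cong) auto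
  show ?case
    using insert by (simp add: 1 2 sum_distrib_left)
qed simp

text \<open>Differentiating the Leibniz expansion gives the determinants of \<open>R k\<close>, with
  row k differentiated; Laplace expansion along that row yields Jacobi's formula.\<close>

lemma fps_deriv_det:
  fixes M :: "'a::comm_ring_1 fps mat"
  assumes M: "M \<in> carrier_mat n n"
  shows "fps_deriv (det M) = (\<Sum>k<n. \<Sum>j<n. fps_deriv (M $$ (k, j)) * adj_mat M $$ (j, k))"
proof -
  define R where "R = (\<lambda>k. mat n n (\<lambda>(i, j). if i = k then fps_deriv (M $$ (i, j)) else M $$ (i, j)))"
  have R: "R k \<in> carrier_mat n n" for k by (simp add: R_def)
  let ?P = "{p. p permutes {0..<n}}"
  have sgn: "fps_deriv (signof p * F) = signof p * fps_deriv F" for p :: "nat \<Rightarrow> nat" and F :: "'a fps"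
    by (simp add: sign_def)
  have "fps_deriv (det M) = (\<Sum>p\<in>?P. signof p * (\<Sum>k\<in>{0..<n}. \<Prod>i\<in>{0..<n}. R k $$ (i, p i)))"
    unfolding det_def'[OF M] fps_deriv_sum sgn fps_deriv_prod[OF finite_atLeastLessThan]
    by (intro sum.cong refl arg_cong2[of _ _ _ _ "(*)"] prod.cong) (auto simp: R_def)
  also have "\<dots> = (\<Sum>k\<in>{0..<n}. det (R k))"
    unfolding det_def'[OF R] sum_distrib_left by (rule sum.swap)
  also have "\<dots> = (\<Sum>k<n. \<Sum>j<n. fps_deriv (M $$ (k, j)) * adj_mat M $$ (j, k))"
    unfolding atLeast0LessThan
  proof (intro sum.cong refl)
    fix k assume "k \<in> {..<n}"
    then have k: "k < n" by simp
    \<comment> \<open>\<open>R k\<close> and \<open>M\<close> can differ only in row k, which the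
      cofactors delete.\<close>
    have "mat_delete (R k) k j = mat_delete M k j" for j
      by (rule eq_matI) (use M in \<open>auto simp: mat_delete_def R_def\<close>)
    then have "cofactor (R k) k j = cofactor M k j" for j by (simp add: cofactor_def)
    then show "det (R k) = (\<Sum>j<n. fps_deriv (M $$ (k, j)) * adj_mat M $$ (j, k))"
      unfolding laplace_expansion_row[OF R k]
      using k M by (intro sum.cong) (auto simp: adj_mat_def R_def)
  qed
  finally show ?thesis .
qed

section \<open>The inverse of 1 - tA and the trace series\<close>

lemma pow_mat_Suc_left:
  fixes A :: "'a::semiring_1 mat"
  assumes A: "A \<in> carrier_mat n n"
  shows "A ^\<^sub>m Suc k = A * A ^\<^sub>m k"
proof (induction k)
  case 0
  then show ?case using A by simp
next
  case (Suc k)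
  have "A ^\<^sub>m Suc (Suc k) = A * A ^\<^sub>m k * A" using Suc by simp
  then show ?case using assoc_mult_mat[OF A pow_carrier_mat[OF A] A] by simp
qed

text \<open>The geometric series with terms A^l t^l, stored entrywise.\<close>

definition mat_geom :: "int mat \<Rightarrow> rat fps mat"
  where "mat_geom A = mat (dim_row A) (dim_row A) (\<lambda>(i, j). Abs_fps (\<lambda>l. of_int ((A ^\<^sub>m l) $$ (i, j))))"

lemma mat_geom_inverse:
  assumes A: "A \<in> carrier_mat n n"
  shows "(1\<^sub>m n - fps_X \<cdot>\<^sub>m mat_fps A) * mat_geom A = 1\<^sub>m n"
proof (rule eq_matI)
  have d: "dim_row A = n" "dim_col A = n" using A by auto
  have M: "1\<^sub>m n - fps_X \<cdot>\<^sub>m mat_fps A \<in> carrier_mat n n" using A by (intro minus_carrier_mat) simp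
  have G: "mat_geom A \<in> carrier_mat n n" by (simp add: mat_geom_def d)
  fix i j assume "i < dim_row (1\<^sub>m n :: rat fps mat)" "j < dim_col (1\<^sub>m n :: rat fps mat)"
  then have ij: "i < n" "j < n" by auto
  show "((1\<^sub>m n - fps_X \<cdot>\<^sub>m mat_fps A) * mat_geom A) $$ (i, j) = 1\<^sub>m n $$ (i, j)"
  proof (rule fps_ext)
    fix l
    have "((1\<^sub>m n - fps_X \<cdot>\<^sub>m mat_fps A) * mat_geom A) $$ (i, j) =
      (\<Sum>k<n. (if i = k then mat_geom A $$ (k, j) else 0) -
        fps_X * (fps_const (of_int (A $$ (i, k))) * mat_geom A $$ (k, j)))"
      unfolding mat_mult_index[OF M G ij] using ij d
      by (intro sum.cong) (auto simp: mat_fps_def left_diff_distrib mult.assoc)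
    also have "\<dots> = mat_geom A $$ (i, j) -
        fps_X * (\<Sum>k<n. fps_const (of_int (A $$ (i, k))) * mat_geom A $$ (k, j))"
      using ij by (simp add: sum_subtractf sum_distrib_left)
    also have "fps_nth \<dots> l = fps_nth (1\<^sub>m n $$ (i, j)) l"
    proof (cases l)
      case 0
      then show ?thesis using ij d by (simp add: mat_geom_def)
    next
      \<comment> \<open>The series is multiplied by \<open>A\<close> from the left, so the left
        recursion for powers makes A^(r+1) - A A^r cancel.\<close>
      case (Suc r)
      have "(A ^\<^sub>m Suc r) $$ (i, j) = (\<Sum>k<n. A $$ (i, k) * (A ^\<^sub>m r) $$ (k, j))"
        by (simp only: pow_mat_Suc_left[OF A] mat_mult_index[OF A pow_carrier_mat[OF A] ij])
      then show ?thesis using ij d by (simp add: Suc mat_geom_def fps_sum_nth del: pow_mat.simps)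
    qed
    finally show "fps_nth (((1\<^sub>m n - fps_X \<cdot>\<^sub>m mat_fps A) * mat_geom A) $$ (i, j)) l = fps_nth (1\<^sub>m n $$ (i, j)) l" .
  qed
qed (use assms in \<open>auto simp: mat_geom_def mat_fps_def\<close>)

text \<open>Jacobi's formula for \<open>M\<close> = 1 - tA, whose derivative is -A: the adjugate is
  \<open>det M\<close> times the geometric series, leaving the traces of A A^l.\<close>

lemma fps_deriv_rev_char:
  assumes A: "A \<in> carrier_mat n n"
  shows "fps_deriv (rev_char A) = - rev_char A * Abs_fps (\<lambda>l. of_int (mat_trace (A ^\<^sub>m Suc l)))"
proof -
  have d: "dim_row A = n" "dim_col A = n" using A by auto
  define M where "M = 1\<^sub>m n - fps_X \<cdot>\<^sub>m mat_fps A"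
  have M: "M \<in> carrier_mat n n" unfolding M_def using A by (intro minus_carrier_mat) simp
  have G: "mat_geom A \<in> carrier_mat n n" by (simp add: mat_geom_def d)
  have det: "rev_char A = det M" by (simp add: rev_char_def M_def d)
  have "adj_mat M = adj_mat M * (M * mat_geom A)"
    unfolding M_def mat_geom_inverse[OF A] by (rule right_mult_one_mat[symmetric], rule adj_mat(1)[OF M[unfolded M_def]])
  also have "\<dots> = (adj_mat M * M) * mat_geom A"
    by (rule assoc_mult_mat[OF adj_mat(1)[OF M] M G, symmetric])
  also have "\<dots> = det M \<cdot>\<^sub>m mat_geom A"
    unfolding adj_mat(3)[OF M] mult_smult_assoc_mat[OF one_carrier_mat G] left_mult_one_mat[OF G] ..
  finally have adj: "adj_mat M = det M \<cdot>\<^sub>m mat_geom A" .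
  have "fps_deriv (det M) = (\<Sum>k<n. \<Sum>j<n. - fps_const (of_int (A $$ (k, j))) * (det M * mat_geom A $$ (j, k)))"
    unfolding fps_deriv_det[OF M] adj
    by (intro sum.cong refl) (use d G in \<open>auto simp: M_def mat_fps_def\<close>)
  also have "\<dots> = - det M * (\<Sum>k<n. \<Sum>j<n. fps_const (of_int (A $$ (k, j))) * mat_geom A $$ (j, k))"
    by (simp add: sum_distrib_left sum_negf mult_ac del: fps_const_neg)
  also have "(\<Sum>k<n. \<Sum>j<n. fps_const (of_int (A $$ (k, j))) * mat_geom A $$ (j, k)) =
      Abs_fps (\<lambda>l. of_int (mat_trace (A ^\<^sub>m Suc l)))"
  proof (rule fps_ext)
    fix l
    have "dim_row (A * A ^\<^sub>m l) = n" by (simp add: d)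
    then have "mat_trace (A ^\<^sub>m Suc l) = (\<Sum>k<n. \<Sum>j<n. A $$ (k, j) * (A ^\<^sub>m l) $$ (j, k))"
      unfolding mat_trace_def pow_mat_Suc_left[OF A]
      by (simp only:) (intro sum.cong refl, simp only: lessThan_iff mat_mult_index[OF A pow_carrier_mat[OF A]])
    then show "fps_nth (\<Sum>k<n. \<Sum>j<n. fps_const (of_int (A $$ (k, j))) * mat_geom A $$ (j, k)) l =
      fps_nth (Abs_fps (\<lambda>l. of_int (mat_trace (A ^\<^sub>m Suc l)))) l"
      by (simp add: fps_sum_nth mat_geom_def d del: pow_mat.simps)
  qed
  finally show ?thesis by (simp only: det)
qed

text \<open>The logarithmic derivative changes sign under inversion, cancelling the sign in
  \<open>fps_deriv_rev_char\<close>. Entry l of \<open>gh\<close> is a_(l+1), hence the power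
  \<open>Suc l\<close>.\<close>

lemma gh_L_mat:
  assumes A: "A \<in> carrier_mat n n"
  shows "gh (L_mat A) l = of_int (mat_trace (A ^\<^sub>m Suc l))"
proof -
  define T :: "rat fps" where "T = Abs_fps (\<lambda>l. of_int (mat_trace (A ^\<^sub>m Suc l)))"
  let ?R = "rev_char A"
  have R0: "fps_nth ?R 0 \<noteq> 0" by (simp add: rev_char_nth_0[OF A])
  have i: "inverse ?R * ?R = 1" by (rule inverse_mult_eq_1[OF R0])
  have d: "- fps_deriv ?R = ?R * T"
    by (simp only: fps_deriv_rev_char[OF A] T_def minus_mult_left[symmetric] minus_minus)
  have "fps_deriv (inverse ?R) * inverse (inverse ?R) = - fps_deriv ?R * (inverse ?R)\<^sup>2 * ?R"
    by (simp only: fps_inverse_deriv[OF R0] fps_inverse_idempotent[OF R0])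
  also have "\<dots> = T * (inverse ?R * ?R) * (inverse ?R * ?R)"
    unfolding d power2_eq_square by (simp only: mult_ac)
  finally have "fps_deriv (inverse ?R) * inverse (inverse ?R) = T" by (simp only: i mult_1_right)
  then show ?thesis by (simp add: gh_eq witt_fps_L_mat[OF A] T_def del: pow_mat.simps)
qed

section \<open>The ghost square on W_0(Z)\<close>

lemma L_Z_add: "L_Z (x + y) = L_Z x + L_Z y"
  by transfer (rule L_groth_add)

text \<open>Every element is a difference of matrix classes and both sides are additive, which
  reduces the claim to the trace formula for one matrix.\<close>

lemma linrec_incl_gh0: "linrec_incl (gh0 x) = gh (L_Z x)"
proof
  fix l
  obtain n A k B where A: "A \<in> carrier_mat n n" and B: "B \<in> carrier_mat k k" and x: "x = W0_of A - W0_of B"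
    by (rule W0_cases)
  have "L_Z x + L_Z (W0_of B) = L_Z (W0_of A)"
    by (simp add: x flip: L_Z_add)
  then have "L_Z x = L_mat A - L_mat B"
    by (simp add: L_Z_W0_of[OF A] L_Z_W0_of[OF B] eq_diff_eq)
  then show "linrec_incl (gh0 x) l = gh (L_Z x) l"
    by (simp add: linrec_incl_def x ring_morphismD[OF ring_morphism_gh0] gh_L_mat[OF A] gh_L_mat[OF B]
        linrec_nth_gh0_W0_of[OF A] linrec_nth_gh0_W0_of[OF B] del: pow_mat.simps)
qed


section \<open>The zeta function of the torus is not integral\<close>

lemma fps_power_int:
  fixes F :: "'a::comm_ring_1 fps"
  assumes "\<And>i. fps_nth F i \<in> \<int>"
  shows "fps_nth (F ^ k) i \<in> \<int>"
proof (induction k arbitrary: i)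
  case (Suc k)
  then show ?case
    unfolding power_Suc fps_mult_nth using assms by (intro Ints_sum Ints_mult)
qed auto

text \<open>
  In \<open>exp F = \<Sum> F\<^sup>i/i!\<close> the coefficient of \<open>t\<^sup>p\<close> has exactly one term with \<open>p\<close> in the denominator,
  namely \<open>(F\<^sub>1)\<^sup>p/p!\<close>.
\<close>

lemma fps_exp_compose_not_integral:
  fixes F :: "rat fps"
  assumes F: "\<And>i. fps_nth F i \<in> \<int>" and F0: "fps_nth F 0 = 0" and F1: "fps_nth F 1 = of_int a"
    and p: "prime p" "\<not> int p dvd a"
  shows "fps_nth (fps_exp 1 oo F) p \<notin> \<int>"
proof
  assume int: "fps_nth (fps_exp 1 oo F) p \<in> \<int>"
  have p0: "p > 0" using p(1) by (rule prime_gt_0_nat)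
  \<comment> \<open>Multiplying by (p-1)! makes all terms with i < p integral and leaves a^p/p from
    i = p.\<close>
  define S where "S = (\<Sum>i<p. fact (p - 1) / fact i * fps_nth (F ^ i) p :: rat)"
  have "fact (p - 1) / fact i \<in> (\<int> :: rat set)" if "i < p" for i
  proof -
    have "(fact i :: int) dvd fact (p - 1)" using that by (intro fact_dvd) simp
    then obtain q where "(fact (p - 1) :: int) = fact i * q" ..
    then have "(of_int (fact (p - 1)) :: rat) = of_int (fact i) * of_int q" by (simp only: of_int_mult)
    then have "fact (p - 1) / fact i = (of_int q :: rat)" by (simp add: field_simps)
    then show ?thesis by simp
  qed
  then have S: "S \<in> \<int>"
    unfolding S_def by (intro Ints_sum Ints_mult fps_power_int F) auto
  have "fps_nth (fps_exp 1 oo F) p = (\<Sum>i<p. fps_nth (F ^ i) p / fact i) + fps_nth (F ^ p) p / fact p"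
    by (simp add: fps_compose_nth atMost_atLeast0[symmetric] lessThan_Suc_atMost[symmetric])
  \<comment> \<open>As F has no constant term, t^p occurs in F^p only through the linear term of
    F.\<close>
  moreover have "fps_nth (F ^ p) p = of_int (a ^ p)"
    using startsby_zero_power_nth_same[OF F0] F1 by simp
  ultimately have "fact (p - 1) * fps_nth (fps_exp 1 oo F) p = S + fact (p - 1) * of_int (a ^ p) / fact p"
    by (simp add: S_def sum_distrib_left distrib_left)
  also have "fact (p - 1) * of_int (a ^ p) / fact p = (of_int (a ^ p) / of_nat p :: rat)"
    using p0 by (simp add: fact_reduce[of p])
  finally have "of_int (a ^ p) / of_nat p = fact (p - 1) * fps_nth (fps_exp 1 oo F) p - S"
    by simp
  also have "\<dots> \<in> \<int>"
  proof -
    have "fact (p - 1) \<in> (\<int> :: rat set)" by (metis Ints_of_nat of_nat_fact)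
    then show ?thesis using int S by (intro Ints_diff Ints_mult)
  qed
  finally obtain q where "of_int (a ^ p) / of_nat p = (of_int q :: rat)" by (auto elim: Ints_cases)
  then have "of_int (a ^ p) = (of_int (int p * q) :: rat)" using p0 by (simp add: field_simps)
  then have "a ^ p = int p * q" by (simp only: of_int_eq_iff)
  then have "int p dvd a ^ p" by simp
  then show False using p prime_dvd_power[of "int p" a p] by simp
qed

text \<open>The exponent m Li_0(t) = m t/(1 - t) has all its positive-degree coefficients equal to
  m, and a prime p > m cannot divide m.\<close>

lemma zeta_F1m_torus_not_integral:
  assumes "m \<ge> 1"
  shows "zeta_F1m m [:0, 1:] \<notin> witt_int"
proof
  assume int: "zeta_F1m m [:0, 1:] \<in> witt_int"
  obtain p where p: "prime p" "p > m" using bigger_prime by blast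
  have "\<not> int p dvd int m" using assms p(2) by (auto dest: dvd_imp_le)
  define F where "F = (fps_const (of_nat m) * polylog 0 :: rat fps)"
  have "witt_fps (zeta_F1m m [:0, 1:]) = fps_exp 1 oo F"
    by (simp add: zeta_F1m.rep_eq F_def)
  moreover have "fps_nth (fps_exp 1 oo F) p \<notin> \<int>"
    by (rule fps_exp_compose_not_integral[of _ "int m"])
      (use \<open>\<not> int p dvd int m\<close> p in \<open>auto simp: F_def polylog_def\<close>)
  ultimately show False using int by (simp add: witt_int_def)
qed

theorem proposition7:
  fixes m :: nat
  assumes "m \<ge> 1"
  shows "bij_betw biring_corr
      (biring_homs (lie_comult m) (lie_counit m) linrec_comult linrec_counit)
      {\<phi>. ring_morphism \<phi>} \<and>
    (\<exists>c \<in> biring_homs (lie_comult m) (lie_counit m) linrec_comult linrec_counit.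
      biring_corr c = motivic_measure (2 * int m) \<and>
      (\<forall>c' \<in> biring_homs (lie_comult m) (lie_counit m) linrec_comult linrec_counit.
        biring_corr c' = motivic_measure (2 * int m) \<longrightarrow> c' = c) \<and>
      linrec_incl \<circ> c = gh \<circ> zeta_F1m m \<and>
      linrec_incl \<circ> gh0 = gh \<circ> L_Z \<and>
      \<not> (\<exists>r. ring_morphism r \<and> L_Z \<circ> r = zeta_F1m m \<and> gh0 \<circ> r = c))"
\<comment> \<open>The witness has k = m because the measure sends D = T - m to 2m - m.\<close>
proof (intro conjI bexI[of _ "poly_seq (int m) (int m)"] ballI impI)
  let ?H = "biring_homs (lie_comult m) (lie_counit m) linrec_comult linrec_counit"
  let ?c = "poly_seq (int m) (int m)"
  show bij: "bij_betw biring_corr ?H {\<phi>. ring_morphism \<phi>}"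
    by (rule bij_betw_biring_corr)
  show c: "?c \<in> ?H"
    by (rule poly_seq_biring_hom)
  show corr: "biring_corr ?c = motivic_measure (2 * int m)"
    by (simp add: fun_eq_iff biring_corr_def motivic_measure_def linrec_nth_poly_seq)
  show "c' = ?c" if "c' \<in> ?H" "biring_corr c' = motivic_measure (2 * int m)" for c'
    using bij_betw_imp_inj_on[OF bij] that c corr by (metis inj_onD)
  \<comment> \<open>Entry n on the left is p(m + nm) = p(m(n+1)), matching the ghost component
    a_(n+1).\<close>
  show "linrec_incl \<circ> ?c = gh \<circ> zeta_F1m m"
    by (simp add: fun_eq_iff linrec_incl_def linrec_nth_poly_seq gh_zeta algebra_simps)
  show "linrec_incl \<circ> gh0 = gh \<circ> L_Z"
    by (simp add: fun_eq_iff linrec_incl_gh0)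
  \<comment> \<open>A lift would exhibit the zeta function of T as a value of \<open>L_Z\<close>,
    hence as an integral series.\<close>
  show "\<not> (\<exists>r. ring_morphism r \<and> L_Z \<circ> r = zeta_F1m m \<and> gh0 \<circ> r = ?c)"
  proof
    assume "\<exists>r. ring_morphism r \<and> L_Z \<circ> r = zeta_F1m m \<and> gh0 \<circ> r = ?c"
    then obtain r where "L_Z \<circ> r = zeta_F1m m" by blast
    then have "zeta_F1m m [:0, 1:] = L_Z (r [:0, 1:])" by (metis comp_apply)
    then show False using zeta_F1m_torus_not_integral[OF assms] L_Z_int by metis
  qed
qed

end
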